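(* Let $H$ be an $n$-dimensional Hilbert space, let $\xi\in M_n(H)$ be a magic basis, let $\pi:A_s(n)\to B(H)\simeq M_n(\mathbb C)$ be the representation associated to $\xi$, and let $A$ be the Hopf image of $\pi$. Then: (1) $A$ is commutative if and only if $\pi$ comes from a Latin square; (2) $A$ is cocommutative if and only if $\pi$ comes from an abelian Latin square.
   Context: A magic basis of $H$ is a square matrix of vectors $\xi\in M_n(H)$ such that each row and each column is an orthogonal basis of $H$. The representation associated to $\xi$ is $\pi:A_s(n)\to B(H)$, $\pi(u_{ij})=P_{ij}$, where $P_{ij}$ is the orthogonal projection onto $\mathbb C\xi_{ij}$. A Latin square is a matrix $\Sigma\in M_n(\mathbb N)$ whose rows and columns are all permutations of $1,\dots,n$. Its conjugate $\Sigma^*$ is the Latin square given by $\Sigma^*_{kj}=i$ when $\Sigma_{ij}=k$. $\Sigma$ is called abelian if the subgroup $G\subset S_n$ generated by the rows of $\Sigma^*$ (viewed as permutations) is abelian. The representation $\pi$ comes from the Latin square $\Sigma$ if there is an orthogonal basis $b_1,\dots,b_n$ of $H$ such that $\pi$ is the representation associated to the magic basis $(b_{\Sigma_{ij}})_{ij}$, i.e. $P_{ij}$ is the projection onto $\mathbb Cb_{\Sigma_{ij}}$ for all $i,j$. C*-algebras and morphisms are unital. A magic unitary over a C*-algebra $A$ is a matrix $u\in M_n(A)$ of projections such that on each row and each column the entries are pairwise orthogonal and sum to $1$. $A_s(n)$ is the universal C*-algebra generated by $n^2$ elements $u_{ij}$ with the relations making $(u_{ij})$ a magic unitary. A quantum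 permutation algebra is a C*-algebra $A$ with a magic unitary $u\in M_n(A)$ whose entries generate $A$, and such that $\Delta(u_{ij})=\sum_k u_{ik}\otimes u_{kj}$, $\varepsilon(u_{ij})=\delta_{ij}$, $S(u_{ij})=u_{ji}$ define morphisms $\Delta:A\to A\otimes A$, $\varepsilon:A\to\mathbb C$, $S:A\to A^{op}$. All quantum permutation algebras are taken full: $A$ is the enveloping C*-algebra of the $*$-algebra generated by the $u_{ij}$. Cocommutative means that $\Delta$ is invariant under the flip. The Hopf image of $\pi:A_s(n)\to B(H)$ is the smallest quantum permutation algebra $A$ (with $n\times n$ magic unitary) realizing a factorization $A_s(n)\to A\to B(H)$ of $\pi$, the first map sending generators to generators; smallest means that any other algebra realizing such a factorization maps onto $A$, generators being sent to generators. *)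

theory Defs
  imports Complex_Main "HOL-Algebra.Module" "HOL-Algebra.Sym_Groups"
begin

section \<open>C*-algebras\<close>

text \<open>
  Star algebras and C*-algebras are unital, complex, and carrier based.  The zero algebra
  is allowed.
\<close>

record 'a star_alg = "(complex, 'a) module" +
  star :: "'a \<Rightarrow> 'a"

record 'a cstar = "'a star_alg" +
  cnorm :: "'a \<Rightarrow> real"

definition complex_cstar :: "complex cstar" where
  "complex_cstar = \<lparr>carrier = UNIV, monoid.mult = (*), one = 1, zero = 0, add = (+),
     smult = (*), star = cnj, cnorm = cmod\<rparr>"

locale star_algebra = scalars: module complex_cstar A + ring A for A (structure) +
  assumes smult_mult_left:
      "\<lbrakk>x \<in> carrier A; y \<in> carrier A\<rbrakk> \<Longrightarrow> (c \<odot>\<^bsub>A\<^esub> x) \<otimes>\<^bsub>A\<^esub> y = c \<odot>\<^bsub>A\<^esub> (x \<otimes>\<^bsub>A\<^esub> y)"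
    and smult_mult_right:
      "\<lbrakk>x \<in> carrier A; y \<in> carrier A\<rbrakk> \<Longrightarrow> x \<otimes>\<^bsub>A\<^esub> (c \<odot>\<^bsub>A\<^esub> y) = c \<odot>\<^bsub>A\<^esub> (x \<otimes>\<^bsub>A\<^esub> y)"
    and star_closed: "x \<in> carrier A \<Longrightarrow> star A x \<in> carrier A"
    and star_star: "x \<in> carrier A \<Longrightarrow> star A (star A x) = x"
    and star_add:
      "\<lbrakk>x \<in> carrier A; y \<in> carrier A\<rbrakk> \<Longrightarrow> star A (x \<oplus>\<^bsub>A\<^esub> y) = star A x \<oplus>\<^bsub>A\<^esub> star A y"
    and star_smult: "x \<in> carrier A \<Longrightarrow> star A (c \<odot>\<^bsub>A\<^esub> x) = cnj c \<odot>\<^bsub>A\<^esub> star A x"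
    and star_mult:
      "\<lbrakk>x \<in> carrier A; y \<in> carrier A\<rbrakk> \<Longrightarrow> star A (x \<otimes>\<^bsub>A\<^esub> y) = star A y \<otimes>\<^bsub>A\<^esub> star A x"

definition cstar_seminorm :: "('a, 'm) star_alg_scheme \<Rightarrow> ('a \<Rightarrow> real) \<Rightarrow> bool" where
  "cstar_seminorm A p \<longleftrightarrow>
     (\<forall>x\<in>carrier A. 0 \<le> p x) \<and>
     (\<forall>x\<in>carrier A. \<forall>y\<in>carrier A. p (x \<oplus>\<^bsub>A\<^esub> y) \<le> p x + p y) \<and>
     (\<forall>c. \<forall>x\<in>carrier A. p (c \<odot>\<^bsub>A\<^esub> x) = cmod c * p x) \<and>
     (\<forall>x\<in>carrier A. \<forall>y\<in>carrier A. p (x \<otimes>\<^bsub>A\<^esub> y) \<le> p x * p y) \<and>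
     (\<forall>x\<in>carrier A. p (star A x \<otimes>\<^bsub>A\<^esub> x) = (p x)\<^sup>2)"

locale cstar_algebra = star_algebra A for A :: "'a cstar" (structure) +
  assumes cnorm_seminorm: "cstar_seminorm A (cnorm A)"
    and cnorm_zero: "\<lbrakk>x \<in> carrier A; cnorm A x = 0\<rbrakk> \<Longrightarrow> x = \<zero>\<^bsub>A\<^esub>"
    and complete:
      "\<lbrakk>\<And>k. X k \<in> carrier A;
        \<And>e. 0 < e \<Longrightarrow> \<exists>N. \<forall>k\<ge>N. \<forall>l\<ge>N. cnorm A (X k \<ominus>\<^bsub>A\<^esub> X l) < e\<rbrakk>
       \<Longrightarrow> \<exists>x\<in>carrier A. (\<lambda>k. cnorm A (X k \<ominus>\<^bsub>A\<^esub> x)) \<longlonglongrightarrow> 0"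

definition star_hom ::
  "('a, 'm) star_alg_scheme \<Rightarrow> ('b, 'k) star_alg_scheme \<Rightarrow> ('a \<Rightarrow> 'b) \<Rightarrow> bool" where
  "star_hom A B f \<longleftrightarrow> f \<in> ring_hom A B \<and>
     (\<forall>c. \<forall>x\<in>carrier A. f (c \<odot>\<^bsub>A\<^esub> x) = c \<odot>\<^bsub>B\<^esub> f x) \<and>
     (\<forall>x\<in>carrier A. f (star A x) = star B (f x))"

definition opposite :: "'a cstar \<Rightarrow> 'a cstar" where
  "opposite A = A\<lparr>monoid.mult := (\<lambda>x y. y \<otimes>\<^bsub>A\<^esub> x)\<rparr>"

inductive_set star_gen :: "('a, 'm) star_alg_scheme \<Rightarrow> 'a set \<Rightarrow> 'a set" for A and X where
  one: "\<one>\<^bsub>A\<^esub> \<in> star_gen A X"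
| incl: "x \<in> X \<Longrightarrow> x \<in> star_gen A X"
| add: "\<lbrakk>x \<in> star_gen A X; y \<in> star_gen A X\<rbrakk> \<Longrightarrow> x \<oplus>\<^bsub>A\<^esub> y \<in> star_gen A X"
| smult: "x \<in> star_gen A X \<Longrightarrow> c \<odot>\<^bsub>A\<^esub> x \<in> star_gen A X"
| mult: "\<lbrakk>x \<in> star_gen A X; y \<in> star_gen A X\<rbrakk> \<Longrightarrow> x \<otimes>\<^bsub>A\<^esub> y \<in> star_gen A X"
| star: "x \<in> star_gen A X \<Longrightarrow> star A x \<in> star_gen A X"

definition dense_in :: "'a cstar \<Rightarrow> 'a set \<Rightarrow> bool" where
  "dense_in A D \<longleftrightarrow> D \<subseteq> carrier A \<and>
     (\<forall>x\<in>carrier A. \<forall>e>0. \<exists>d\<in>D. cnorm A (x \<ominus>\<^bsub>A\<^esub> d) < e)"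

text \<open>
  The enveloping C*-algebra of a star algebra is its completion for the largest C*-seminorm.  For a
  dense star subalgebra \<open>D\<close> of a C*-algebra \<open>A\<close>, the norm of \<open>A\<close> restricts to one of the
  C*-seminorms of \<open>D\<close>, and \<open>A\<close> is the enveloping C*-algebra of \<open>D\<close> iff it is the largest one.
\<close>

definition enveloping :: "'a cstar \<Rightarrow> 'a set \<Rightarrow> bool" where
  "enveloping A D \<longleftrightarrow> dense_in A D \<and>
     (\<forall>p. cstar_seminorm (A\<lparr>carrier := D\<rparr>) p \<longrightarrow> (\<forall>x\<in>D. p x \<le> cnorm A x))"

subsection \<open>Tensor products\<close>

definition bilinear_form ::
  "('a, 'm) star_alg_scheme \<Rightarrow> ('b, 'k) star_alg_scheme \<Rightarrow> ('a \<Rightarrow> 'b \<Rightarrow> complex) \<Rightarrow> bool" where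
  "bilinear_form A B \<beta> \<longleftrightarrow>
     (\<forall>x\<in>carrier A. \<forall>x'\<in>carrier A. \<forall>y\<in>carrier B. \<beta> (x \<oplus>\<^bsub>A\<^esub> x') y = \<beta> x y + \<beta> x' y) \<and>
     (\<forall>x\<in>carrier A. \<forall>y\<in>carrier B. \<forall>y'\<in>carrier B. \<beta> x (y \<oplus>\<^bsub>B\<^esub> y') = \<beta> x y + \<beta> x y') \<and>
     (\<forall>c. \<forall>x\<in>carrier A. \<forall>y\<in>carrier B.
        \<beta> (c \<odot>\<^bsub>A\<^esub> x) y = c * \<beta> x y \<and> \<beta> x (c \<odot>\<^bsub>B\<^esub> y) = c * \<beta> x y)"

definition alg_tensor ::
  "'a cstar \<Rightarrow> 'b cstar \<Rightarrow> 't cstar \<Rightarrow> ('a \<Rightarrow> 'b \<Rightarrow> 't) \<Rightarrow> 't set" where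
  "alg_tensor A B T tens =
     {\<Oplus>\<^bsub>T\<^esub>i\<in>{..<m}. tens (x i) (y i) | (m::nat) x y. \<forall>i<m. x i \<in> carrier A \<and> y i \<in> carrier B}"

text \<open>
  \<open>T\<close>, with elementary tensors \<open>tens\<close>, is the C*-tensor product of \<open>A\<close> and \<open>B\<close>: the enveloping
  C*-algebra of the algebraic tensor product (i.e. the maximal tensor product).  The assumption
  \<open>tens_zero\<close> says that the span of the elementary tensors in \<open>T\<close> is the algebraic tensor product
  and not a proper quotient of it: a finite sum of elementary tensors is zero in \<open>T\<close> only if every
  bilinear form vanishes on it, i.e. only if it is zero in the algebraic tensor product.
\<close>

locale tensor_product =
  cstar_algebra T for A :: "'a cstar" and B :: "'b cstar" and T :: "'t cstar"
    and tens :: "'a \<Rightarrow> 'b \<Rightarrow> 't" +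
  assumes tens_closed: "\<lbrakk>x \<in> carrier A; y \<in> carrier B\<rbrakk> \<Longrightarrow> tens x y \<in> carrier T"
    and tens_add_left:
      "\<lbrakk>x \<in> carrier A; x' \<in> carrier A; y \<in> carrier B\<rbrakk>
       \<Longrightarrow> tens (x \<oplus>\<^bsub>A\<^esub> x') y = tens x y \<oplus>\<^bsub>T\<^esub> tens x' y"
    and tens_add_right:
      "\<lbrakk>x \<in> carrier A; y \<in> carrier B; y' \<in> carrier B\<rbrakk>
       \<Longrightarrow> tens x (y \<oplus>\<^bsub>B\<^esub> y') = tens x y \<oplus>\<^bsub>T\<^esub> tens x y'"
    and tens_smult_left:
      "\<lbrakk>x \<in> carrier A; y \<in> carrier B\<rbrakk> \<Longrightarrow> tens (c \<odot>\<^bsub>A\<^esub> x) y = c \<odot>\<^bsub>T\<^esub> tens x y"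
    and tens_smult_right:
      "\<lbrakk>x \<in> carrier A; y \<in> carrier B\<rbrakk> \<Longrightarrow> tens x (c \<odot>\<^bsub>B\<^esub> y) = c \<odot>\<^bsub>T\<^esub> tens x y"
    and tens_one: "tens \<one>\<^bsub>A\<^esub> \<one>\<^bsub>B\<^esub> = \<one>\<^bsub>T\<^esub>"
    and tens_mult:
      "\<lbrakk>x \<in> carrier A; x' \<in> carrier A; y \<in> carrier B; y' \<in> carrier B\<rbrakk>
       \<Longrightarrow> tens x y \<otimes>\<^bsub>T\<^esub> tens x' y' = tens (x \<otimes>\<^bsub>A\<^esub> x') (y \<otimes>\<^bsub>B\<^esub> y')"
    and tens_star:
      "\<lbrakk>x \<in> carrier A; y \<in> carrier B\<rbrakk> \<Longrightarrow> star T (tens x y) = tens (star A x) (star B y)"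
    and tens_zero:
      "\<And>(m::nat) x y \<beta>. \<lbrakk>\<And>i. i < m \<Longrightarrow> x i \<in> carrier A; \<And>i. i < m \<Longrightarrow> y i \<in> carrier B;
        (\<Oplus>\<^bsub>T\<^esub>i\<in>{..<m}. tens (x i) (y i)) = \<zero>\<^bsub>T\<^esub>; bilinear_form A B \<beta>\<rbrakk>
       \<Longrightarrow> (\<Sum>i<m. \<beta> (x i) (y i)) = 0"
    and tens_enveloping: "enveloping T (alg_tensor A B T tens)"

section \<open>Quantum permutation algebras\<close>

definition magic_unitary :: "nat \<Rightarrow> 'a cstar \<Rightarrow> (nat \<Rightarrow> nat \<Rightarrow> 'a) \<Rightarrow> bool" where
  "magic_unitary n A u \<longleftrightarrow>
     (\<forall>i\<in>{1..n}. \<forall>j\<in>{1..n}.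
        u i j \<in> carrier A \<and> u i j \<otimes>\<^bsub>A\<^esub> u i j = u i j \<and> star A (u i j) = u i j) \<and>
     (\<forall>i\<in>{1..n}. \<forall>j\<in>{1..n}. \<forall>k\<in>{1..n}. j \<noteq> k \<longrightarrow>
        u i j \<otimes>\<^bsub>A\<^esub> u i k = \<zero>\<^bsub>A\<^esub> \<and> u j i \<otimes>\<^bsub>A\<^esub> u k i = \<zero>\<^bsub>A\<^esub>) \<and>
     (\<forall>i\<in>{1..n}. (\<Oplus>\<^bsub>A\<^esub>j\<in>{1..n}. u i j) = \<one>\<^bsub>A\<^esub> \<and> (\<Oplus>\<^bsub>A\<^esub>j\<in>{1..n}. u j i) = \<one>\<^bsub>A\<^esub>)"

definition entries :: "nat \<Rightarrow> (nat \<Rightarrow> nat \<Rightarrow> 'a) \<Rightarrow> 'a set" where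
  "entries n u = {u i j | i j. i \<in> {1..n} \<and> j \<in> {1..n}}"

text \<open>
  HOL cannot quantify over types inside a formula, so the definitions below that speak about all
  (or some) C*-algebras range over the C*-algebras whose carrier is a subset of the fixed type
  \<open>universe\<close>.  Nothing is lost: a C*-algebra generated by finitely many elements, and the tensor
  product of two such algebras, is separable, so it has at most the cardinality of the continuum
  and is isomorphic to a C*-algebra carried by a subset of \<open>universe\<close>.
\<close>

type_synonym universe = "nat \<Rightarrow> complex"

text \<open>\<open>A\<close> is the universal C*-algebra generated by the entries of a magic unitary \<open>u\<close>.\<close>

definition universal_magic :: "nat \<Rightarrow> 'a cstar \<Rightarrow> (nat \<Rightarrow> nat \<Rightarrow> 'a) \<Rightarrow> bool" where
  "universal_magic n A u \<longleftrightarrow> cstar_algebra A \<and> magic_unitary n A u \<and>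
     dense_in A (star_gen A (entries n u)) \<and>
     (\<forall>(B :: universe cstar) w. cstar_algebra B \<and> magic_unitary n B w \<longrightarrow>
        (\<exists>\<phi>. star_hom A B \<phi> \<and> (\<forall>i\<in>{1..n}. \<forall>j\<in>{1..n}. \<phi> (u i j) = w i j)))"

definition comultiplication ::
  "nat \<Rightarrow> 'a cstar \<Rightarrow> (nat \<Rightarrow> nat \<Rightarrow> 'a) \<Rightarrow> 't cstar \<Rightarrow> ('a \<Rightarrow> 'a \<Rightarrow> 't) \<Rightarrow> ('a \<Rightarrow> 't) \<Rightarrow> bool" where
  "comultiplication n A u T tens \<Delta> \<longleftrightarrow> tensor_product A A T tens \<and> star_hom A T \<Delta> \<and>
     (\<forall>i\<in>{1..n}. \<forall>j\<in>{1..n}. \<Delta> (u i j) = (\<Oplus>\<^bsub>T\<^esub>k\<in>{1..n}. tens (u i k) (u k j)))"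

definition counit :: "nat \<Rightarrow> 'a cstar \<Rightarrow> (nat \<Rightarrow> nat \<Rightarrow> 'a) \<Rightarrow> ('a \<Rightarrow> complex) \<Rightarrow> bool" where
  "counit n A u \<epsilon> \<longleftrightarrow> star_hom A complex_cstar \<epsilon> \<and>
     (\<forall>i\<in>{1..n}. \<forall>j\<in>{1..n}. \<epsilon> (u i j) = (if i = j then 1 else 0))"

definition antipode :: "nat \<Rightarrow> 'a cstar \<Rightarrow> (nat \<Rightarrow> nat \<Rightarrow> 'a) \<Rightarrow> ('a \<Rightarrow> 'a) \<Rightarrow> bool" where
  "antipode n A u S \<longleftrightarrow> star_hom A (opposite A) S \<and>
     (\<forall>i\<in>{1..n}. \<forall>j\<in>{1..n}. S (u i j) = u j i)"

text \<open>Quantum permutation algebras are full, as expressed by \<open>enveloping\<close>.\<close>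

definition quantum_permutation_algebra ::
  "nat \<Rightarrow> 'a cstar \<Rightarrow> (nat \<Rightarrow> nat \<Rightarrow> 'a) \<Rightarrow> bool" where
  "quantum_permutation_algebra n A u \<longleftrightarrow> cstar_algebra A \<and> magic_unitary n A u \<and>
     enveloping A (star_gen A (entries n u)) \<and>
     (\<exists>(T :: universe cstar) tens \<Delta>. comultiplication n A u T tens \<Delta>) \<and>
     (\<exists>\<epsilon>. counit n A u \<epsilon>) \<and> (\<exists>S. antipode n A u S)"

definition commutative :: "'a cstar \<Rightarrow> bool" where
  "commutative A \<longleftrightarrow> (\<forall>x\<in>carrier A. \<forall>y\<in>carrier A. x \<otimes>\<^bsub>A\<^esub> y = y \<otimes>\<^bsub>A\<^esub> x)"

text \<open>
  The tensor square \<open>T\<close> and its flip \<open>\<sigma>\<close> exist for every C*-algebra and are unique up to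
  isomorphism, and \<open>\<Delta>\<close> is determined by its values on the generators, so the existential
  quantifiers here involve no choice.
\<close>

definition cocommutative :: "nat \<Rightarrow> 'a cstar \<Rightarrow> (nat \<Rightarrow> nat \<Rightarrow> 'a) \<Rightarrow> bool" where
  "cocommutative n A u \<longleftrightarrow> (\<exists>(T :: universe cstar) tens \<Delta> \<sigma>. comultiplication n A u T tens \<Delta> \<and>
     star_hom T T \<sigma> \<and> (\<forall>x\<in>carrier A. \<forall>y\<in>carrier A. \<sigma> (tens x y) = tens y x) \<and>
     (\<forall>x\<in>carrier A. \<sigma> (\<Delta> x) = \<Delta> x))"

subsection \<open>Hopf images\<close>

definition factorizes ::
  "nat \<Rightarrow> 's cstar \<Rightarrow> (nat \<Rightarrow> nat \<Rightarrow> 's) \<Rightarrow> 'b cstar \<Rightarrow> ('s \<Rightarrow> 'b) \<Rightarrow> 'a cstar \<Rightarrow> (nat \<Rightarrow> nat \<Rightarrow> 'a) \<Rightarrow> bool"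
  where
  "factorizes n As v B \<pi> A u \<longleftrightarrow> (\<exists>\<phi> \<rho>. star_hom As A \<phi> \<and> star_hom A B \<rho> \<and>
     (\<forall>i\<in>{1..n}. \<forall>j\<in>{1..n}. \<phi> (v i j) = u i j) \<and> (\<forall>x\<in>carrier As. \<rho> (\<phi> x) = \<pi> x))"

definition hopf_image ::
  "nat \<Rightarrow> 's cstar \<Rightarrow> (nat \<Rightarrow> nat \<Rightarrow> 's) \<Rightarrow> 'b cstar \<Rightarrow> ('s \<Rightarrow> 'b) \<Rightarrow> 'a cstar \<Rightarrow> (nat \<Rightarrow> nat \<Rightarrow> 'a) \<Rightarrow> bool"
  where
  "hopf_image n As v B \<pi> A u \<longleftrightarrow>
     quantum_permutation_algebra n A u \<and> factorizes n As v B \<pi> A u \<and>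
     (\<forall>(C :: universe cstar) w.
        quantum_permutation_algebra n C w \<and> factorizes n As v B \<pi> C w \<longrightarrow>
        (\<exists>\<psi>. star_hom C A \<psi> \<and> (\<forall>i\<in>{1..n}. \<forall>j\<in>{1..n}. \<psi> (w i j) = u i j) \<and>
             \<psi> ` carrier C = carrier A))"

section \<open>Hilbert spaces and magic bases\<close>

text \<open>
  The inner product is linear in the first argument.  Completeness is not required here: it is
  automatic in the finite-dimensional case.
\<close>

class complex_inner = ab_group_add +
  fixes scaleC :: "complex \<Rightarrow> 'a \<Rightarrow> 'a" (infixr "*\<^sub>C" 75)
    and cinner :: "'a \<Rightarrow> 'a \<Rightarrow> complex"
  assumes scaleC_add_right: "c *\<^sub>C (x + y) = c *\<^sub>C x + c *\<^sub>C y"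
    and scaleC_add_left: "(c + d) *\<^sub>C x = c *\<^sub>C x + d *\<^sub>C x"
    and scaleC_scaleC: "c *\<^sub>C d *\<^sub>C x = (c * d) *\<^sub>C x"
    and scaleC_one: "1 *\<^sub>C x = x"
    and cinner_commute: "cinner x y = cnj (cinner y x)"
    and cinner_add_left: "cinner (x + y) z = cinner x z + cinner y z"
    and cinner_scaleC_left: "cinner (c *\<^sub>C x) y = c * cinner x y"
    and cinner_ge_zero: "0 \<le> Re (cinner x x)"
    and cinner_eq_zero: "cinner x x = 0 \<Longrightarrow> x = 0"

global_interpretation cvec: vector_space "scaleC :: complex \<Rightarrow> 'a \<Rightarrow> 'a::complex_inner"
  by standard (simp_all add: scaleC_add_right scaleC_add_left scaleC_scaleC scaleC_one)

definition hnorm :: "'a::complex_inner \<Rightarrow> real" where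
  "hnorm x = sqrt (Re (cinner x x))"

definition bounded_ops :: "('a::complex_inner \<Rightarrow> 'a) set" where
  "bounded_ops = {f. Vector_Spaces.linear scaleC scaleC f \<and> (\<exists>K. \<forall>x. hnorm (f x) \<le> K * hnorm x)}"

definition op_algebra :: "('a::complex_inner \<Rightarrow> 'a) cstar" where
  "op_algebra = \<lparr>carrier = bounded_ops, monoid.mult = (\<circ>), one = id,
     zero = (\<lambda>x. 0), add = (\<lambda>f g x. f x + g x), smult = (\<lambda>c f x. c *\<^sub>C f x),
     star = (\<lambda>f. THE g. g \<in> bounded_ops \<and> (\<forall>x y. cinner (f x) y = cinner x (g y))),
     cnorm = (\<lambda>f. SUP x\<in>{x. hnorm x \<le> 1}. hnorm (f x))\<rparr>"

definition orth_proj :: "'a::complex_inner set \<Rightarrow> 'a \<Rightarrow> 'a" where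
  "orth_proj W x = (THE y. y \<in> W \<and> (\<forall>w\<in>W. cinner (x - y) w = 0))"

definition orthogonal_basis :: "nat \<Rightarrow> (nat \<Rightarrow> 'a::complex_inner) \<Rightarrow> bool" where
  "orthogonal_basis n b \<longleftrightarrow> inj_on b {1..n} \<and> cvec.independent (b ` {1..n}) \<and>
     cvec.span (b ` {1..n}) = UNIV \<and>
     (\<forall>i\<in>{1..n}. \<forall>j\<in>{1..n}. i \<noteq> j \<longrightarrow> cinner (b i) (b j) = 0)"

definition magic_basis :: "nat \<Rightarrow> (nat \<Rightarrow> nat \<Rightarrow> 'a::complex_inner) \<Rightarrow> bool" where
  "magic_basis n \<xi> \<longleftrightarrow>
     (\<forall>i\<in>{1..n}. orthogonal_basis n (\<lambda>j. \<xi> i j) \<and> orthogonal_basis n (\<lambda>j. \<xi> j i))"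

definition associated_rep ::
  "nat \<Rightarrow> 's cstar \<Rightarrow> (nat \<Rightarrow> nat \<Rightarrow> 's) \<Rightarrow> (nat \<Rightarrow> nat \<Rightarrow> 'h::complex_inner) \<Rightarrow> ('s \<Rightarrow> 'h \<Rightarrow> 'h) \<Rightarrow> bool"
  where
  "associated_rep n As v \<xi> \<pi> \<longleftrightarrow> star_hom As op_algebra \<pi> \<and>
     (\<forall>i\<in>{1..n}. \<forall>j\<in>{1..n}. \<pi> (v i j) = orth_proj (cvec.span {\<xi> i j}))"

section \<open>Latin squares\<close>

definition latin_square :: "nat \<Rightarrow> (nat \<Rightarrow> nat \<Rightarrow> nat) \<Rightarrow> bool" where
  "latin_square n \<Sigma> \<longleftrightarrow> (\<forall>i\<in>{1..n}. bij_betw (\<lambda>j. \<Sigma> i j) {1..n} {1..n} \<and>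
     bij_betw (\<lambda>j. \<Sigma> j i) {1..n} {1..n})"

definition latin_conjugate :: "nat \<Rightarrow> (nat \<Rightarrow> nat \<Rightarrow> nat) \<Rightarrow> nat \<Rightarrow> nat \<Rightarrow> nat" where
  "latin_conjugate n \<Sigma> k j = (THE i. i \<in> {1..n} \<and> \<Sigma> i j = k)"

text \<open>Permutations of \<open>{1..n}\<close> are, as in \<open>sym_group\<close>, the identity outside that set.\<close>

definition row_perm :: "nat \<Rightarrow> (nat \<Rightarrow> nat \<Rightarrow> nat) \<Rightarrow> nat \<Rightarrow> nat \<Rightarrow> nat" where
  "row_perm n \<Sigma> k = (\<lambda>j. if j \<in> {1..n} then \<Sigma> k j else j)"

definition latin_group :: "nat \<Rightarrow> (nat \<Rightarrow> nat \<Rightarrow> nat) \<Rightarrow> (nat \<Rightarrow> nat) set" where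
  "latin_group n \<Sigma> = generate (sym_group n) (row_perm n (latin_conjugate n \<Sigma>) ` {1..n})"

definition abelian_latin_square :: "nat \<Rightarrow> (nat \<Rightarrow> nat \<Rightarrow> nat) \<Rightarrow> bool" where
  "abelian_latin_square n \<Sigma> \<longleftrightarrow> latin_square n \<Sigma> \<and>
     comm_group (sym_group n\<lparr>carrier := latin_group n \<Sigma>\<rparr>)"

definition comes_from ::
  "nat \<Rightarrow> 's cstar \<Rightarrow> (nat \<Rightarrow> nat \<Rightarrow> 's) \<Rightarrow> ('s \<Rightarrow> 'h::complex_inner \<Rightarrow> 'h) \<Rightarrow> (nat \<Rightarrow> nat \<Rightarrow> nat) \<Rightarrow> bool"
  where
  "comes_from n As v \<pi> \<Sigma> \<longleftrightarrow>
     (\<exists>b. orthogonal_basis n b \<and> associated_rep n As v (\<lambda>i j. b (\<Sigma> i j)) \<pi>)"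

end

theory Submission
  imports Defs "HOL-Library.Nat_Bijection"
begin

text \<open>
  If \<open>A\<close> is commutative, the rank one projections \<open>P\<^sub>i\<^sub>j\<close> commute, so each \<open>\<xi>\<^sub>i\<^sub>j\<close> is a multiple of some
  \<open>\<xi>\<^sub>1\<^sub>k\<close>, and \<open>\<Sigma>\<^sub>i\<^sub>j = k\<close> is a Latin square.  If \<open>A\<close> is cocommutative, then
  \<open>\<Sum>\<^sub>k u\<^sub>i\<^sub>k \<otimes> u\<^sub>k\<^sub>j = \<Sum>\<^sub>k u\<^sub>k\<^sub>j \<otimes> u\<^sub>i\<^sub>k\<close>.  Applying \<open>P\<close> to the first factor and
  \<open>\<langle>P(-) e, e\<rangle>\<close> with \<open>e = \<xi>\<^sub>i\<^sub>b\<close> to the second leaves only \<open>P\<^sub>b\<^sub>j\<close> on the right, which is thus a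
  combination of the \<open>P\<^sub>i\<^sub>k\<close>; so the projections commute again, and the same identity evaluated on
  the common basis says that the rows of \<open>\<Sigma>\<^sup>*\<close> commute.

  Conversely, if \<open>\<pi>\<close> comes from \<open>\<Sigma>\<close>, it factors through the algebra \<open>C(G)\<close> of functions on the
  group \<open>G\<close> generated by the rows of \<open>\<Sigma>\<^sup>*\<close>, with magic unitary \<open>w\<^sub>i\<^sub>j(p) = [p j = i]\<close>: evaluate at the
  rows.  By minimality \<open>A\<close> is a quotient of \<open>C(G)\<close>, hence commutative.  It is spanned by finitely
  many orthogonal projections, and so is its tensor square, which therefore has a flip; that flip
  fixes \<open>\<Delta>\<close> when \<open>G\<close> is abelian.
\<close>

section \<open>C*-algebras and C*-seminorms\<close>

text \<open>Universality of \<open>As\<close> prescribes a homomorphism only on the generators, and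
  these generate merely a dense star subalgebra. That two maps agree on all of \<open>As\<close>
  therefore needs continuity of homomorphisms into \<open>op_algebra\<close>. It comes from the
  positivity of x \<mapsto> \<langle>f(x) w, w\<rangle>, hence from square roots of 1 - a in the
  domain, together with the existence of adjoints on H. Fullness of C(G) is a statement about all
  C*-seminorms: finite dimension bounds each of them up to a constant, and the C*-identity removes
  the constant. G is enumerated by natural numbers, and pairs of indices are coded by
  \<open>prod_encode\<close>, because the competitors in \<open>hopf_image\<close> and the tensor
  squares must have type \<open>universe cstar\<close>. A is only shown to be a quotient of C(G),
  and its tensor square T is given abstractly. The nonzero images of the point masses are minimal
  projections of A, and their tensors are minimal projections of T; this gives coordinates on T in
  which the flip swaps two arguments.\<close>

lemma complex_cstar_simps [simp]:
  "carrier complex_cstar = UNIV" "\<one>\<^bsub>complex_cstar\<^esub> = 1" "\<zero>\<^bsub>complex_cstar\<^esub> = 0"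
  "x \<otimes>\<^bsub>complex_cstar\<^esub> y = x * y" "x \<oplus>\<^bsub>complex_cstar\<^esub> y = x + y"
  "c \<odot>\<^bsub>complex_cstar\<^esub> x = c * x" "star complex_cstar = cnj" "cnorm complex_cstar = cmod"
  by (simp_all add: complex_cstar_def)

lemma cring_complex_cstar: "cring complex_cstar"
proof (rule cringI)
  show "abelian_group complex_cstar"
    by (rule abelian_groupI) (auto intro: exI[of _ "- x" for x])
  show "comm_monoid complex_cstar"
    by (rule comm_monoidI) auto
qed (auto simp: algebra_simps)

context star_algebra
begin

lemmas minus_eq = scalars.M.minus_eq and minus_equality = scalars.M.minus_equality
  and minus_minus = scalars.M.minus_minus and minus_add = scalars.M.minus_add
  and r_neg1 = scalars.M.r_neg1 and r_neg2 = scalars.M.r_neg2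
  and r_neg = scalars.M.r_neg and l_neg = scalars.M.l_neg
  and a_assoc = scalars.M.a_assoc and a_comm = scalars.M.a_comm
  and a_ac = scalars.M.a_ac and finsum_Un_disjoint = scalars.M.finsum_Un_disjoint
  and finsum_reindex = scalars.M.finsum_reindex and finsum_cong' = scalars.M.finsum_cong'
  and zero_closed = scalars.M.zero_closed and finsum_insert = scalars.M.finsum_insert and finsum_closed = scalars.M.finsum_closed

lemma smult_in_carrier [simp, intro]: "x \<in> carrier A \<Longrightarrow> c \<odot> x \<in> carrier A"
  using scalars.smult_closed by simp

declare star_closed [simp, intro] star_star [simp]

lemma smult_add_scalar: "x \<in> carrier A \<Longrightarrow> (c + d) \<odot> x = c \<odot> x \<oplus> d \<odot> x"
  using scalars.smult_l_distr[of c d x] by simp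

lemma smult_add_vector:
  "\<lbrakk>x \<in> carrier A; y \<in> carrier A\<rbrakk> \<Longrightarrow> c \<odot> (x \<oplus> y) = c \<odot> x \<oplus> c \<odot> y"
  using scalars.smult_r_distr[of c x y] by simp

lemma smult_smult: "x \<in> carrier A \<Longrightarrow> c \<odot> (d \<odot> x) = (c * d) \<odot> x"
  using scalars.smult_assoc1[of c d x] by simp

lemma smult_1 [simp]: "x \<in> carrier A \<Longrightarrow> 1 \<odot> x = x"
  using scalars.smult_one by simp

lemma smult_0 [simp]: "x \<in> carrier A \<Longrightarrow> 0 \<odot> x = \<zero>"
  using scalars.smult_l_null by simp

lemma smult_zero [simp]: "c \<odot> \<zero> = \<zero>"
  using scalars.smult_r_null by simp

lemma a_inv_eq_smult: "x \<in> carrier A \<Longrightarrow> \<ominus> x = (- 1) \<odot> x"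
proof -
  assume x: "x \<in> carrier A"
  have "(- 1) \<odot> x \<oplus> x = \<zero>"
    using smult_add_scalar[OF x, of "- 1" 1] x by simp
  then show ?thesis
    using x by (simp add: minus_equality)
qed

lemma a_minus_eq_smult: "\<lbrakk>x \<in> carrier A; y \<in> carrier A\<rbrakk> \<Longrightarrow> x \<ominus> y = x \<oplus> (- 1) \<odot> y"
  by (simp add: minus_eq a_inv_eq_smult)

lemma star_one [simp]: "star A \<one> = \<one>"
proof -
  have "star A \<one> = star A (star A \<one> \<otimes> \<one>)"
    by (subst star_mult) auto
  then show ?thesis
    by simp
qed

lemma star_minus: "\<lbrakk>x \<in> carrier A; y \<in> carrier A\<rbrakk> \<Longrightarrow> star A (x \<ominus> y) = star A x \<ominus> star A y"
  by (simp add: a_minus_eq_smult star_add star_smult)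

lemma star_zero [simp]: "star A \<zero> = \<zero>"
  using star_smult[of \<zero> 0] by simp

lemma minus_self_iff: "\<lbrakk>x \<in> carrier A; y \<in> carrier A\<rbrakk> \<Longrightarrow> x \<ominus> y = \<zero> \<longleftrightarrow> x = y"
  by (metis a_minus_def scalars.M.a_inv_closed minus_equality minus_minus r_neg)

lemma finsum_smult:
  "\<lbrakk>finite I; \<And>i. i \<in> I \<Longrightarrow> f i \<in> carrier A\<rbrakk> \<Longrightarrow> c \<odot> (\<Oplus>i\<in>I. f i) = (\<Oplus>i\<in>I. c \<odot> f i)"
  by (induction I rule: finite_induct) (auto simp: smult_add_vector Pi_def)

lemma star_gen_closed: "X \<subseteq> carrier A \<Longrightarrow> star_gen A X \<subseteq> carrier A"
proof
  fix x assume X: "X \<subseteq> carrier A" and "x \<in> star_gen A X"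
  from this(2) show "x \<in> carrier A"
    by induction (use X in auto)
qed

end

section \<open>Norm estimates, square roots and positive functionals in a C*-algebra\<close>

context cstar_algebra
begin

lemma norm_ge0 [simp]: "x \<in> carrier A \<Longrightarrow> 0 \<le> cnorm A x"
  and norm_add: "\<lbrakk>x \<in> carrier A; y \<in> carrier A\<rbrakk> \<Longrightarrow> cnorm A (x \<oplus> y) \<le> cnorm A x + cnorm A y"
  and norm_smult: "x \<in> carrier A \<Longrightarrow> cnorm A (c \<odot> x) = cmod c * cnorm A x"
  and norm_mult: "\<lbrakk>x \<in> carrier A; y \<in> carrier A\<rbrakk> \<Longrightarrow> cnorm A (x \<otimes> y) \<le> cnorm A x * cnorm A y"
  and norm_star_mult: "x \<in> carrier A \<Longrightarrow> cnorm A (star A x \<otimes> x) = (cnorm A x)\<^sup>2"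
  using cnorm_seminorm unfolding cstar_seminorm_def by auto

lemma norm_zero [simp]: "cnorm A \<zero> = 0"
  using norm_smult[of \<zero> 0] by simp

text \<open>Cancelling one factor in the C*-identity, where the norm of
  \<open>star A x \<otimes> x\<close> is at most the product of the norms, gives one inequality;
  applied to \<open>star A x\<close> it gives the other.\<close>

lemma norm_star: "x \<in> carrier A \<Longrightarrow> cnorm A (star A x) = cnorm A x"
proof -
  have le: "cnorm A x \<le> cnorm A (star A x)" if "x \<in> carrier A" for x
  proof (cases "cnorm A x = 0")
    case False
    have "cnorm A x * cnorm A x \<le> cnorm A (star A x) * cnorm A x"
      using norm_star_mult[OF that] norm_mult[of "star A x" x] that by (simp add: power2_eq_square)
    then show ?thesis
      using False norm_ge0[OF that] by (simp add: mult_le_cancel_right)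
  qed (use that in simp)
  assume "x \<in> carrier A"
  then show ?thesis
    using le[of x] le[of "star A x"] by simp
qed

lemma norm_minus_commute:
  "\<lbrakk>x \<in> carrier A; y \<in> carrier A\<rbrakk> \<Longrightarrow> cnorm A (x \<ominus> y) = cnorm A (y \<ominus> x)"
  using norm_smult[of "x \<ominus> y" "- 1"]
  by (simp add: a_minus_eq_smult smult_add_vector smult_smult a_comm)

lemma norm_triangle_minus:
  assumes "x \<in> carrier A" "y \<in> carrier A" "z \<in> carrier A"
  shows "cnorm A (x \<ominus> z) \<le> cnorm A (x \<ominus> y) + cnorm A (y \<ominus> z)"
proof -
  have "x \<ominus> z = (x \<ominus> y) \<oplus> (y \<ominus> z)"
    using assms by (simp add: minus_eq a_assoc r_neg2 l_neg r_neg1)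
  then show ?thesis
    using norm_add[of "x \<ominus> y" "y \<ominus> z"] assms by simp
qed

text \<open>The square root of \<open>1 - a\<close> is \<open>1 - y\<close>, where \<open>y\<close> is the fixed point of the contraction
  \<open>y \<mapsto> (a + y\<^sup>2) / 2\<close> of the ball of radius \<open>\<parallel>a\<parallel>\<close>.\<close>

lemma sqrt_one_minus:
  assumes a: "a \<in> carrier A" "star A a = a" and small: "cnorm A a < 1"
  shows "\<exists>b\<in>carrier A. star A b = b \<and> b \<otimes> b = \<one> \<ominus> a"
proof -
  define r where "r = cnorm A a"
  define F where "F y = (1/2) \<odot> (a \<oplus> y \<otimes> y)" for y
  define Y where "Y k = (F ^^ k) \<zero>" for k
  have r: "0 \<le> r" "r < 1"
    using a small by (auto simp: r_def)
  have Fc: "F y \<in> carrier A" if "y \<in> carrier A" for y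
    using that a by (simp add: F_def)
  have Fn: "cnorm A (F y) \<le> r" if y: "y \<in> carrier A" "cnorm A y \<le> r" for y
  proof -
    have "cnorm A (y \<otimes> y) \<le> r * r"
      using norm_mult[of y y] y r mult_mono[of "cnorm A y" r "cnorm A y" r] by simp
    also have "\<dots> \<le> r"
      using r by (simp add: mult_left_le)
    finally have "cnorm A (a \<oplus> y \<otimes> y) \<le> 2 * r"
      using norm_add[of a "y \<otimes> y"] y a by (simp add: r_def)
    then show ?thesis
      using y a by (simp add: F_def norm_smult)
  qed
  have Fd: "cnorm A (F y \<ominus> F z) \<le> r * cnorm A (y \<ominus> z)"
    if y: "y \<in> carrier A" "cnorm A y \<le> r" and z: "z \<in> carrier A" "cnorm A z \<le> r" for y z
  proof -
    \<comment> \<open>The difference of the squares of \<open>y\<close> and \<open>z\<close> is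
      split without commuting them. Each of the two terms costs at most \<open>r\<close> times the
      distance, and the factor 1/2 pays for there being two.\<close>
    have eq: "F y \<ominus> F z = (1/2) \<odot> (y \<otimes> (y \<ominus> z) \<oplus> (y \<ominus> z) \<otimes> z)"
    proof -
      have "y \<otimes> (y \<ominus> z) \<oplus> (y \<ominus> z) \<otimes> z = y \<otimes> y \<ominus> z \<otimes> z"
        using y z by (simp add: minus_eq r_distr l_distr r_minus l_minus a_assoc r_neg1)
      moreover have "(a \<oplus> y \<otimes> y) \<ominus> (a \<oplus> z \<otimes> z) = y \<otimes> y \<ominus> z \<otimes> z"
        using a y z by (simp add: minus_eq minus_add a_ac r_neg1 r_neg2)
      moreover have "F y \<ominus> F z = (1/2) \<odot> ((a \<oplus> y \<otimes> y) \<ominus> (a \<oplus> z \<otimes> z))"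
        using a y z by (simp add: F_def a_minus_eq_smult smult_add_vector smult_smult)
      ultimately show ?thesis
        by simp
    qed
    have "cnorm A (y \<otimes> (y \<ominus> z)) \<le> r * cnorm A (y \<ominus> z)"
      using norm_mult[of y "y \<ominus> z"] y z mult_right_mono[OF y(2), of "cnorm A (y \<ominus> z)"] by simp
    moreover have "cnorm A ((y \<ominus> z) \<otimes> z) \<le> r * cnorm A (y \<ominus> z)"
      using norm_mult[of "y \<ominus> z" z] y z mult_right_mono[OF z(2), of "cnorm A (y \<ominus> z)"]
      by (simp add: mult.commute)
    ultimately have "cnorm A (y \<otimes> (y \<ominus> z) \<oplus> (y \<ominus> z) \<otimes> z) \<le> 2 * (r * cnorm A (y \<ominus> z))"
      using norm_add[of "y \<otimes> (y \<ominus> z)" "(y \<ominus> z) \<otimes> z"] y z by simp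
    then show ?thesis
      unfolding eq using y z by (simp add: norm_smult)
  qed
  have Y_Suc: "Y (Suc k) = F (Y k)" for k
    by (simp add: Y_def)
  have Y: "Y k \<in> carrier A \<and> cnorm A (Y k) \<le> r \<and> star A (Y k) = Y k" for k
  proof (induction k)
    case (Suc k)
    then show ?case
      using Fc Fn a by (simp add: Y_Suc F_def star_smult star_add star_mult)
  qed (use r in \<open>simp add: Y_def\<close>)
  \<comment> \<open>After \<open>k\<close> contraction steps what remains is the distance from
    \<open>Y m\<close> to \<open>Y 0 = \<zero>\<close>, which is at most \<open>r\<close>.\<close>
  have geometric: "cnorm A (Y (m + k) \<ominus> Y k) \<le> r * r ^ k" for m k
  proof (induction k)
    case 0
    then show ?case
      using Y[of m] by (simp add: Y_def minus_eq)
  next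
    case (Suc k)
    have "cnorm A (F (Y (m + k)) \<ominus> F (Y k)) \<le> r * cnorm A (Y (m + k) \<ominus> Y k)"
      using Fd Y by blast
    also have "\<dots> \<le> r * (r * r ^ k)"
      using Suc r by (simp add: mult_left_mono)
    finally show ?case
      by (simp add: Y_Suc)
  qed
  have lim0: "(\<lambda>k. r * r ^ k) \<longlonglongrightarrow> 0"
    using r by (intro tendsto_mult_right_zero LIMSEQ_power_zero) simp
  have "\<exists>N. \<forall>k\<ge>N. \<forall>l\<ge>N. cnorm A (Y k \<ominus> Y l) < e" if e: "0 < e" for e
  proof -
    obtain N where N: "r * r ^ N < e / 2"
      using order_tendstoD(2)[OF lim0, of "e / 2"] e unfolding eventually_sequentially by auto
    have "cnorm A (Y k \<ominus> Y l) < e" if "k \<ge> N" "l \<ge> N" for k l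
    proof -
      have "cnorm A (Y k \<ominus> Y N) \<le> r * r ^ N" "cnorm A (Y l \<ominus> Y N) \<le> r * r ^ N"
        using geometric[of "k - N" N] geometric[of "l - N" N] that by simp_all
      then show ?thesis
        using norm_triangle_minus[of "Y k" "Y N" "Y l"] norm_minus_commute[of "Y N" "Y l"] Y N
        by simp
    qed
    then show ?thesis
      by blast
  qed
  then obtain y where y: "y \<in> carrier A" and lim: "(\<lambda>k. cnorm A (Y k \<ominus> y)) \<longlonglongrightarrow> 0"
    using complete[of Y] Y by blast
  \<comment> \<open>Uniqueness of the limit, in a form used twice: with \<open>c = 0\<close>,
    \<open>d = 1\<close> it makes \<open>y\<close> self-adjoint, with \<open>c = r\<close>,
    \<open>d = 0\<close> it makes \<open>y\<close> a fixed point.\<close>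
  have eq_if: "x = y"
    if x: "x \<in> carrier A" and c: "0 \<le> c"
      and le: "\<And>k. cnorm A (x \<ominus> Y (Suc k)) \<le> c * cnorm A (Y k \<ominus> y) + d * cnorm A (Y (Suc k) \<ominus> y)"
    for x c d
  proof -
    have "(\<lambda>k. c * cnorm A (Y k \<ominus> y) + d * cnorm A (Y (Suc k) \<ominus> y) + cnorm A (Y (Suc k) \<ominus> y)) \<longlonglongrightarrow> 0"
      by (intro tendsto_add_zero tendsto_mult_right_zero lim LIMSEQ_Suc[OF lim])
    moreover have "cnorm A (x \<ominus> y)
        \<le> c * cnorm A (Y k \<ominus> y) + d * cnorm A (Y (Suc k) \<ominus> y) + cnorm A (Y (Suc k) \<ominus> y)" for k
      using norm_triangle_minus[OF x _ y, of "Y (Suc k)"] le[of k] Y[of "Suc k"] by linarith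
    ultimately have "cnorm A (x \<ominus> y) \<le> 0"
      by (intro LIMSEQ_le_const) auto
    then have "cnorm A (x \<ominus> y) = 0"
      using x y by (intro order_antisym norm_ge0) auto
    then have "x \<ominus> y = \<zero>"
      using x y by (intro cnorm_zero) auto
    then show ?thesis
      using x y minus_self_iff by simp
  qed
  have ystar: "star A y = y"
  proof (rule eq_if[of _ 0 1])
    fix k
    have "cnorm A (star A y \<ominus> Y (Suc k)) = cnorm A (star A (Y (Suc k) \<ominus> y))"
      using y Y norm_minus_commute[of "star A y" "Y (Suc k)"] by (simp add: star_minus)
    then show "cnorm A (star A y \<ominus> Y (Suc k)) \<le> 0 * cnorm A (Y k \<ominus> y) + 1 * cnorm A (Y (Suc k) \<ominus> y)"
      using y Y by (simp add: norm_star)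
  qed (use y in auto)
  \<comment> \<open>The contraction estimate \<open>Fd\<close> holds only in the ball of radius
    \<open>r\<close>, so the limit has to be located there before \<open>F\<close> is applied to
    it.\<close>
  have ynorm: "cnorm A y \<le> r"
  proof -
    have "(\<lambda>k. r + cnorm A (Y k \<ominus> y)) \<longlonglongrightarrow> r + 0"
      by (intro tendsto_add tendsto_const lim)
    moreover have "cnorm A y \<le> r + cnorm A (Y k \<ominus> y)" for k
      using norm_triangle_minus[of y "Y k" \<zero>] norm_minus_commute[of "Y k" y] Y[of k] y
      by (simp add: minus_eq)
    ultimately show ?thesis
      using LIMSEQ_le_const[of _ "r + 0" "cnorm A y"] by auto
  qed
  have "F y = y"
  proof (rule eq_if[of _ r 0])
    fix k
    show "cnorm A (F y \<ominus> Y (Suc k)) \<le> r * cnorm A (Y k \<ominus> y) + 0 * cnorm A (Y (Suc k) \<ominus> y)"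
      using Fd[of y "Y k"] y ynorm Y[of k] norm_minus_commute[of y "Y k"] by (simp add: Y_Suc)
  qed (use y Fc r in auto)
  then have "2 \<odot> y = 2 \<odot> F y"
    by simp
  then have fixpoint: "y \<oplus> y = a \<oplus> y \<otimes> y"
    using y a smult_add_scalar[of y 1 1] by (simp add: F_def smult_smult)
  have "(\<one> \<ominus> y) \<otimes> (\<one> \<ominus> y) = \<one> \<ominus> (y \<oplus> y) \<oplus> y \<otimes> y"
    using y by (simp add: minus_eq r_distr l_distr r_minus l_minus a_assoc minus_add minus_minus)
  also have "\<dots> = \<one> \<ominus> a"
    unfolding fixpoint using y a by (simp add: minus_eq minus_add a_assoc l_neg)
  finally show ?thesis
    using y ystar by (intro bexI[of _ "\<one> \<ominus> y"]) (auto simp: star_minus)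
qed

text \<open>For \<open>t\<close> above the norm of \<open>a\<close>, the element 1 - a/t is the
  square of a self-adjoint \<open>b\<close>, so \<open>g\<close> is nonnegative on it and
  \<open>g a \<le> t * g \<one>\<close>; then \<open>t\<close> descends to the norm. Real linearity
  is the natural hypothesis here because \<open>g\<close> will be the real part of x \<mapsto>
  \<langle>f(x) w, w\<rangle>.\<close>

lemma positive_functional_bounded:
  fixes g :: "'a \<Rightarrow> real"
  assumes add: "\<And>x y. \<lbrakk>x \<in> carrier A; y \<in> carrier A\<rbrakk> \<Longrightarrow> g (x \<oplus> y) = g x + g y"
    and smult: "\<And>c x. x \<in> carrier A \<Longrightarrow> g (complex_of_real c \<odot> x) = c * g x"
    and pos: "\<And>x. x \<in> carrier A \<Longrightarrow> 0 \<le> g (star A x \<otimes> x)"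
    and a: "a \<in> carrier A" "star A a = a"
  shows "g a \<le> cnorm A a * g \<one>"
proof -
  have one: "0 \<le> g \<one>"
    using pos[of \<one>] by simp
  have le: "g a \<le> t * g \<one>" if t: "t > cnorm A a" for t
  proof -
    have t0: "0 < t"
      using t norm_ge0[OF a(1)] by linarith
    let ?a = "complex_of_real (1 / t) \<odot> a"
    have "cnorm A ?a < 1"
      using t t0 a by (simp add: norm_smult norm_divide)
    then obtain b where b: "b \<in> carrier A" "star A b = b" "b \<otimes> b = \<one> \<ominus> ?a"
      using sqrt_one_minus[of ?a] a by (auto simp: star_smult)
    have ac: "?a \<in> carrier A"
      using a by simp
    have "0 \<le> g (\<one> \<oplus> complex_of_real (- 1) \<odot> ?a)"
      using pos[of b] b ac a by (simp add: a_minus_eq_smult)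
    also have "\<dots> = g \<one> + g (complex_of_real (- 1) \<odot> ?a)"
      using a by (intro add) auto
    also have "g (complex_of_real (- 1) \<odot> ?a) = - 1 * (1 / t * g a)"
      by (simp only: smult[OF ac] smult[OF a(1)])
    finally show ?thesis
      using t0 by (simp add: field_simps)
  qed
  \<comment> \<open>The limit in \<open>t\<close> is taken after division by
    \<open>g \<one>\<close>, so the case \<open>g \<one> = 0\<close> is treated apart; there any
    \<open>t\<close> will do.\<close>
  show ?thesis
  proof (cases "g \<one> = 0")
    case True
    then show ?thesis
      using le[of "cnorm A a + 1"] by simp
  next
    case False
    then have pos1: "0 < g \<one>"
      using one by simp
    have "g a / g \<one> \<le> cnorm A a"
    proof (rule dense_ge)
      fix t assume "cnorm A a < t"
      then show "g a / g \<one> \<le> t"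
        using le[of t] pos1 by (simp only: pos_divide_le_eq)
    qed
    then show ?thesis
      using pos1 by (simp only: pos_divide_le_eq)
  qed
qed

end

text \<open>Comparing the two seminorms of \<open>(x\<^sup>* x)^(2^k)\<close> removes the constant \<open>K\<close>.\<close>

lemma cstar_seminorm_le_if_le_const:
  assumes "star_algebra A" and p: "cstar_seminorm A p" and q: "cstar_seminorm A q"
    and le: "\<And>x. x \<in> carrier A \<Longrightarrow> p x \<le> K * q x" and x: "x \<in> carrier A"
  shows "p x \<le> q x"
proof -
  interpret star_algebra A by fact
  define Q where "Q y = star A y \<otimes>\<^bsub>A\<^esub> y" for y
  define X where "X k = (Q ^^ k) x" for k
  have X_Suc: "X (Suc k) = Q (X k)" for k
    by (simp add: X_def)
  have X: "X k \<in> carrier A" for k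
    by (induction k) (use x in \<open>auto simp: X_Suc Q_def X_def\<close>)
  have pow: "s (X k) = s x ^ (2 ^ k)" if "cstar_seminorm A s" for s k
  proof (induction k)
    case (Suc k)
    have "s (X (Suc k)) = (s (X k))\<^sup>2"
      using that X[of k] unfolding cstar_seminorm_def X_Suc Q_def by blast
    then show ?case
      using Suc by (simp add: power_mult[symmetric] mult.commute)
  qed (simp add: X_def)
  have ge: "0 \<le> p x" "0 \<le> q x"
    using p q x unfolding cstar_seminorm_def by auto
  have bound: "p x ^ (2 ^ k) \<le> K * q x ^ (2 ^ k)" for k
    using le[OF X[of k]] pow[OF p] pow[OF q] by simp
  show ?thesis
  proof (rule ccontr)
    assume "\<not> p x \<le> q x"
    then have less: "q x < p x"
      by simp
    show False
    proof (cases "q x = 0")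
      case True
      then show ?thesis
        using bound[of 0] less by simp
    next
      case False
      define r where "r = p x / q x"
      have r: "1 < r"
        using less ge False by (simp add: r_def)
      have "r ^ (2 ^ k) \<le> K" for k
        using bound[of k] False ge by (simp add: r_def power_divide field_simps)
      moreover obtain m where "K < r ^ m"
        using real_arch_pow[OF r] by blast
      moreover have "r ^ m \<le> r ^ (2 ^ m)"
        using r by (intro power_increasing) (auto intro: less_imp_le less_exp)
      ultimately show False
        by (meson not_le order_trans)
    qed
  qed
qed

section \<open>Operators on a Hilbert space\<close>

lemma cinner_zero_left [simp]: "cinner 0 y = 0"
  using cinner_add_left[of 0 0 y] by simp

lemma cinner_zero_right [simp]: "cinner x 0 = 0"
  using cinner_commute[of x 0] by simp

lemma cinner_add_right: "cinner x (y + z) = cinner x y + cinner x z"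
  by (metis cinner_commute cinner_add_left complex_cnj_add)

lemma cinner_scaleC_right: "cinner x (c *\<^sub>C y) = cnj c * cinner x y"
  by (metis cinner_commute cinner_scaleC_left complex_cnj_mult)

lemma cinner_minus_left: "cinner (- x) y = - cinner x y"
  using cinner_add_left[of x "- x" y] by (simp add: eq_neg_iff_add_eq_0 add.commute)

lemma cinner_diff_left: "cinner (x - y) z = cinner x z - cinner y z"
  using cinner_add_left[of x "- y" z] by (simp add: cinner_minus_left)

lemma cinner_diff_right: "cinner x (y - z) = cinner x y - cinner x z"
  by (metis cinner_commute cinner_diff_left complex_cnj_diff)

lemma cinner_sum_left: "cinner (\<Sum>i\<in>I. f i) y = (\<Sum>i\<in>I. cinner (f i) y)"
  by (induction I rule: infinite_finite_induct) (auto simp: cinner_add_left)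

lemma cinner_sum_right: "cinner y (\<Sum>i\<in>I. f i) = (\<Sum>i\<in>I. cinner y (f i))"
  by (induction I rule: infinite_finite_induct) (auto simp: cinner_add_right)

lemma scaleC_zero_left [simp]: "0 *\<^sub>C x = 0"
  by (rule cvec.scale_zero_left)

lemma scaleC_zero_right [simp]: "c *\<^sub>C 0 = 0"
  by (rule cvec.scale_zero_right)

lemma cinner_self_eq_0_iff [simp]: "cinner x x = 0 \<longleftrightarrow> x = 0"
  using cinner_eq_zero by auto

lemma hnorm_ge_0 [simp]: "0 \<le> hnorm x"
  by (simp add: hnorm_def cinner_ge_zero)

lemma hnorm_zero [simp]: "hnorm 0 = 0"
  by (simp add: hnorm_def)

lemma hnorm_power2: "(hnorm x)\<^sup>2 = Re (cinner x x)"
  by (simp add: hnorm_def cinner_ge_zero)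

lemma cnj_cinner_self [simp]: "cnj (cinner x x) = cinner x x"
  using cinner_commute[of x x] by simp

lemma cinner_self: "cinner x x = complex_of_real ((hnorm x)\<^sup>2)"
proof -
  have "Im (cnj (cinner x x)) = Im (cinner x x)"
    by (simp only: cnj_cinner_self)
  then have "Im (cinner x x) = 0"
    by (simp del: cnj_cinner_self)
  then show ?thesis
    by (simp add: hnorm_power2 complex_eq_iff)
qed

lemma hnorm_eq_0_iff [simp]: "hnorm x = 0 \<longleftrightarrow> x = 0"
  by (metis cinner_eq_zero cinner_self hnorm_zero of_real_0 power_zero_numeral)

lemma cinner_ext: "(\<And>y. cinner x y = cinner z y) \<Longrightarrow> x = z"
  using cinner_self_eq_0_iff[of "x - z"] by (simp add: cinner_diff_left)

lemma cinner_ext_right: "(\<And>y. cinner y x = cinner y z) \<Longrightarrow> x = z"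
  using cinner_self_eq_0_iff[of "x - z"] by (simp add: cinner_diff_right)

lemma cinner_Cauchy_Schwarz: "cmod (cinner x y) \<le> hnorm x * hnorm y"
proof (cases "y = 0")
  case False
  define c where "c = cinner x y / cinner y y"
  have y: "cinner y y \<noteq> 0" "hnorm y \<noteq> 0"
    using False by auto
  have "cinner (x - c *\<^sub>C y) (x - c *\<^sub>C y) = cinner x x - cinner x y * cinner y x / cinner y y"
    using y by (simp add: c_def cinner_diff_left cinner_diff_right cinner_scaleC_left cinner_scaleC_right)
  also have "cinner x y * cinner y x = complex_of_real ((cmod (cinner x y))\<^sup>2)"
    using cinner_commute[of y x] complex_norm_square[of "cinner x y"] by simp
  also have "cinner x x - complex_of_real ((cmod (cinner x y))\<^sup>2) / cinner y y
      = complex_of_real ((hnorm x)\<^sup>2 - (cmod (cinner x y))\<^sup>2 / (hnorm y)\<^sup>2)"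
    by (simp add: cinner_self)
  finally have "0 \<le> (hnorm x)\<^sup>2 - (cmod (cinner x y))\<^sup>2 / (hnorm y)\<^sup>2"
    using cinner_ge_zero[of "x - c *\<^sub>C y"] by simp
  then have "(cmod (cinner x y))\<^sup>2 \<le> (hnorm x * hnorm y)\<^sup>2"
    using y by (simp add: field_simps power_mult_distrib)
  then show ?thesis
    by (rule power2_le_imp_le) simp
qed simp

lemma hnorm_triangle: "hnorm (x + y) \<le> hnorm x + hnorm y"
proof (rule power2_le_imp_le)
  have "(hnorm (x + y))\<^sup>2 = (hnorm x)\<^sup>2 + (hnorm y)\<^sup>2 + 2 * Re (cinner x y)"
    using cinner_commute[of y x] by (simp add: hnorm_power2 cinner_add_left cinner_add_right)
  also have "\<dots> \<le> (hnorm x)\<^sup>2 + (hnorm y)\<^sup>2 + 2 * (hnorm x * hnorm y)"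
    using order_trans[OF complex_Re_le_cmod cinner_Cauchy_Schwarz[of x y]] by simp
  finally show "(hnorm (x + y))\<^sup>2 \<le> (hnorm x + hnorm y)\<^sup>2"
    by (simp add: power2_sum)
qed simp

lemma hnorm_scaleC: "hnorm (c *\<^sub>C x) = cmod c * hnorm x"
proof -
  have "cinner (c *\<^sub>C x) (c *\<^sub>C x) = complex_of_real ((cmod c * hnorm x)\<^sup>2)"
    using complex_norm_square[of c] cinner_self[of x]
    by (simp add: cinner_scaleC_left cinner_scaleC_right power_mult_distrib)
  then show ?thesis
    unfolding hnorm_def[of "c *\<^sub>C x"] by simp
qed

lemma linear_scaleC_iff:
  "Vector_Spaces.linear scaleC scaleC f \<longleftrightarrow>
     (\<forall>x y. f (x + y) = f x + f y) \<and> (\<forall>c x. f (c *\<^sub>C x) = c *\<^sub>C f x)"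
  by (simp add: Vector_Spaces.linear_def module_hom_def module_hom_axioms_def
      cvec.vector_space_axioms cvec.module_axioms)

lemma bounded_opsI:
  assumes "\<And>x y. f (x + y) = f x + f y" "\<And>c x. f (c *\<^sub>C x) = c *\<^sub>C f x" "\<And>x. hnorm (f x) \<le> K * hnorm x"
  shows "f \<in> bounded_ops"
  unfolding bounded_ops_def linear_scaleC_iff using assms by blast

lemma
  assumes "f \<in> bounded_ops"
  shows bounded_ops_add: "f (x + y) = f x + f y"
    and bounded_ops_scaleC: "f (c *\<^sub>C x) = c *\<^sub>C f x"
    and bounded_ops_bound: "\<exists>K\<ge>0. \<forall>x. hnorm (f x) \<le> K * hnorm x"
proof -
  show "f (x + y) = f x + f y" "f (c *\<^sub>C x) = c *\<^sub>C f x"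
    using assms unfolding bounded_ops_def linear_scaleC_iff by auto
  obtain K where K: "\<And>x. hnorm (f x) \<le> K * hnorm x"
    using assms unfolding bounded_ops_def by auto
  have "hnorm (f x) \<le> max K 0 * hnorm x" for x
    using K[of x] mult_right_mono[of K "max K 0" "hnorm x"] by simp
  then show "\<exists>K\<ge>0. \<forall>x. hnorm (f x) \<le> K * hnorm x"
    by (intro exI[of _ "max K 0"]) auto
qed

lemma bounded_ops_zero_apply: "f \<in> bounded_ops \<Longrightarrow> f 0 = 0"
  using bounded_ops_scaleC[of f 0 0] by simp

lemma bounded_ops_sum_apply: "f \<in> bounded_ops \<Longrightarrow> f (\<Sum>i\<in>I. g i) = (\<Sum>i\<in>I. f (g i))"
  by (induction I rule: infinite_finite_induct) (auto simp: bounded_ops_add bounded_ops_zero_apply)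

lemma bounded_ops_closed_add:
  assumes f: "f \<in> bounded_ops" and g: "g \<in> bounded_ops"
  shows "(\<lambda>x. f x + g x) \<in> bounded_ops"
proof -
  obtain K L where KL: "\<And>x. hnorm (f x) \<le> K * hnorm x" "\<And>x. hnorm (g x) \<le> L * hnorm x"
    using bounded_ops_bound[OF f] bounded_ops_bound[OF g] by blast
  show ?thesis
  proof (rule bounded_opsI)
    show "hnorm (f x + g x) \<le> (K + L) * hnorm x" for x
      using hnorm_triangle[of "f x" "g x"] KL(1)[of x] KL(2)[of x] by (simp add: distrib_right)
  qed (use f g in \<open>auto simp: bounded_ops_add bounded_ops_scaleC scaleC_add_right\<close>)
qed

lemma bounded_ops_closed_scaleC:
  assumes f: "f \<in> bounded_ops"
  shows "(\<lambda>x. c *\<^sub>C f x) \<in> bounded_ops"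
proof -
  obtain K where K: "\<And>x. hnorm (f x) \<le> K * hnorm x"
    using bounded_ops_bound[OF f] by blast
  show ?thesis
  proof (rule bounded_opsI)
    show "hnorm (c *\<^sub>C f x) \<le> (cmod c * K) * hnorm x" for x
      using mult_left_mono[OF K[of x], of "cmod c"] by (simp add: hnorm_scaleC mult.assoc)
  qed (use f in \<open>auto simp: bounded_ops_add bounded_ops_scaleC scaleC_add_right scaleC_scaleC mult.commute\<close>)
qed

lemma bounded_ops_closed_sum:
  assumes "\<And>i. i \<in> I \<Longrightarrow> f i \<in> bounded_ops"
  shows "(\<lambda>x. \<Sum>i\<in>I. f i x) \<in> bounded_ops"
  using assms
proof (induction I rule: infinite_finite_induct)
  case (insert i I)
  then show ?case
    using bounded_ops_closed_add[of "f i" "\<lambda>x. \<Sum>i\<in>I. f i x"] by simp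
qed (auto intro!: bounded_opsI[where K = 0])

lemma star_op_algebra_eqI:
  assumes "g \<in> bounded_ops" "\<And>x y. cinner (f x) y = cinner x (g y)"
  shows "star op_algebra f = g"
proof -
  have "(THE g. g \<in> bounded_ops \<and> (\<forall>x y. cinner (f x) y = cinner x (g y))) = g"
  proof (rule the_equality)
    show "h = g" if "h \<in> bounded_ops \<and> (\<forall>x y. cinner (f x) y = cinner x (h y))" for h
      using that assms(2) by (intro ext cinner_ext_right) metis
  qed (use assms in auto)
  then show ?thesis
    by (simp add: op_algebra_def)
qed

text \<open>The \<open>star\<close> of \<open>op_algebra\<close> is a definite description, so it is the adjoint only where adjoints
  exist.\<close>

definition has_adjoints :: "'h::complex_inner itself \<Rightarrow> bool" where
  "has_adjoints _ \<longleftrightarrow> (\<forall>f\<in>bounded_ops. \<exists>g\<in>bounded_ops. \<forall>x (y::'h). cinner (f x) y = cinner x (g y))"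

lemma cinner_star_op_algebra:
  fixes f :: "'h::complex_inner \<Rightarrow> 'h"
  assumes "has_adjoints TYPE('h)" "f \<in> bounded_ops"
  shows "cinner (f x) y = cinner x (star op_algebra f y)"
proof -
  obtain g where "g \<in> bounded_ops" "\<And>x y. cinner (f x) y = cinner x (g y)"
    using assms unfolding has_adjoints_def by blast
  then show ?thesis
    by (simp add: star_op_algebra_eqI)
qed

lemma star_hom_op_algebraD:
  assumes "star_hom A op_algebra f"
  shows "x \<in> carrier A \<Longrightarrow> f x \<in> bounded_ops"
    and "\<lbrakk>x \<in> carrier A; y \<in> carrier A\<rbrakk> \<Longrightarrow> f (x \<otimes>\<^bsub>A\<^esub> y) w = f x (f y w)"
    and "\<lbrakk>x \<in> carrier A; y \<in> carrier A\<rbrakk> \<Longrightarrow> f (x \<oplus>\<^bsub>A\<^esub> y) w = f x w + f y w"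
    and "f \<one>\<^bsub>A\<^esub> w = w"
    and "x \<in> carrier A \<Longrightarrow> f (c \<odot>\<^bsub>A\<^esub> x) w = c *\<^sub>C f x w"
    and "x \<in> carrier A \<Longrightarrow> f (star A x) = star op_algebra (f x)"
  using assms unfolding star_hom_def ring_hom_def by (auto simp: op_algebra_def)

text \<open>The bound for positive functionals is applied to y \<mapsto> Re \<langle>f(y) w,
  w\<rangle> at \<open>star A x \<otimes> x\<close>, where the functional equals the squared norm of
  \<open>f x w\<close>. Adjoints are what makes this functional positive. Only the domain enters as
  a C*-algebra.\<close>

lemma (in cstar_algebra) star_hom_op_algebra_contractive:
  fixes f :: "'a \<Rightarrow> 'h::complex_inner \<Rightarrow> 'h"
  assumes adj: "has_adjoints TYPE('h)" and f: "star_hom A op_algebra f" and x: "x \<in> carrier A"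
  shows "hnorm (f x w) \<le> cnorm A x * hnorm w"
proof -
  note D = star_hom_op_algebraD[OF f]
  have sq: "Re (cinner (f (star A y \<otimes> y) w) w) = (hnorm (f y w))\<^sup>2" if "y \<in> carrier A" for y
  proof -
    have "cinner (f (star A y) (f y w)) w = cinner (f y w) (f y w)"
      using cinner_star_op_algebra[OF adj, of "f (star A y)" "f y w" w] D(1)[of "star A y"]
        D(6)[of "star A y"] that by simp
    then show ?thesis
      using that D(2)[of "star A y" y w] by (simp add: hnorm_power2)
  qed
  have "Re (cinner (f (star A x \<otimes> x) w) w) \<le> cnorm A (star A x \<otimes> x) * Re (cinner (f \<one> w) w)"
  proof (rule positive_functional_bounded)
    show "0 \<le> Re (cinner (f (star A y \<otimes> y) w) w)" if "y \<in> carrier A" for y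
      using sq[OF that] by simp
  qed (use x in \<open>auto simp: D(3) D(5) cinner_add_left cinner_scaleC_left star_mult\<close>)
  then have "(hnorm (f x w))\<^sup>2 \<le> (cnorm A x * hnorm w)\<^sup>2"
    using x by (simp add: sq norm_star_mult D(4) hnorm_power2 power_mult_distrib)
  then show ?thesis
    by (rule power2_le_imp_le) (use x in simp)
qed

lemma star_hom_eq_on_star_gen:
  assumes "star_hom A B f" "star_hom A B g" "star_algebra A" "X \<subseteq> carrier A"
    and "\<And>x. x \<in> X \<Longrightarrow> f x = g x" and "x \<in> star_gen A X"
  shows "f x = g x"
proof -
  interpret star_algebra A by fact
  have c: "y \<in> carrier A" if "y \<in> star_gen A X" for y
    using star_gen_closed assms(4) that by blast
  note hom = assms(1,2)[unfolded star_hom_def ring_hom_def]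
  show ?thesis
    using assms(6)
  proof induction
    case one
    show ?case
      using hom by simp
  next
    case (add x y)
    then show ?case
      using hom c[of x] c[of y] by simp
  next
    case (mult x y)
    then show ?case
      using hom c[of x] c[of y] by simp
  next
    case (smult x k)
    then show ?case
      using hom c[of x] by simp
  next
    case (star x)
    then show ?case
      using hom c[of x] by simp
  qed (use assms(5) in auto)
qed

text \<open>Both maps are contractive and agree on some \<open>y\<close> near \<open>x\<close>, so
  at \<open>w\<close> they differ by at most twice the distance times the norm of \<open>w\<close>.
  This upgrades agreement on the generators of \<open>As\<close> to agreement on all of
  \<open>As\<close>.\<close>

lemma (in cstar_algebra) star_hom_op_algebra_eq_if_dense:
  fixes f g :: "'a \<Rightarrow> 'h::complex_inner \<Rightarrow> 'h"
  assumes adj: "has_adjoints TYPE('h)" and f: "star_hom A op_algebra f" and g: "star_hom A op_algebra g"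
    and X: "X \<subseteq> carrier A" and dense: "dense_in A (star_gen A X)"
    and eq: "\<And>x. x \<in> X \<Longrightarrow> f x = g x" and x: "x \<in> carrier A"
  shows "f x = g x"
proof
  fix w
  note Df = star_hom_op_algebraD[OF f] and Dg = star_hom_op_algebraD[OF g]
  have "hnorm (f x w - g x w) \<le> e" if e: "0 < e" for e
  proof -
    \<comment> \<open>The 2 accounts for the two maps \<open>f\<close> and \<open>g\<close>; the 1
      keeps the denominator positive when \<open>w = 0\<close>.\<close>
    define d where "d = e / (2 * (hnorm w + 1))"
    have w: "0 < hnorm w + 1"
      using hnorm_ge_0[of w] by linarith
    then have "0 < d"
      using e by (simp add: d_def)
    then obtain y where y: "y \<in> star_gen A X" "cnorm A (x \<ominus> y) < d"
      using dense x unfolding dense_in_def by blast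
    have yc: "y \<in> carrier A"
      using y star_gen_closed[OF X] by blast
    have fg: "f y = g y"
      using star_hom_eq_on_star_gen[OF f g star_algebra_axioms X eq y(1)] .
    have minus: "h (x \<ominus> y) w = h x w - h y w" if "star_hom A op_algebra h" for h :: "'a \<Rightarrow> 'h \<Rightarrow> 'h"
      using star_hom_op_algebraD(3,5)[OF that] x yc by (simp add: a_minus_eq_smult)
    have le: "hnorm (h (x \<ominus> y) w) \<le> d * hnorm w" if "star_hom A op_algebra h" for h :: "'a \<Rightarrow> 'h \<Rightarrow> 'h"
    proof -
      have "hnorm (h (x \<ominus> y) w) \<le> cnorm A (x \<ominus> y) * hnorm w"
        using star_hom_op_algebra_contractive[OF adj that] x yc by simp
      also have "\<dots> \<le> d * hnorm w"
        using y(2) by (intro mult_right_mono) auto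
      finally show ?thesis .
    qed
    have "f x w - g x w = f (x \<ominus> y) w + (- 1) *\<^sub>C g (x \<ominus> y) w"
      by (simp add: minus[OF f] minus[OF g] fg)
    then have "hnorm (f x w - g x w) \<le> hnorm (f (x \<ominus> y) w) + hnorm (g (x \<ominus> y) w)"
      using hnorm_triangle[of "f (x \<ominus> y) w" "(- 1) *\<^sub>C g (x \<ominus> y) w"] hnorm_scaleC[of "- 1" "g (x \<ominus> y) w"]
      by (metis mult_1 norm_minus_cancel norm_one)
    also have "\<dots> \<le> 2 * d * hnorm w"
      using le[OF f] le[OF g] by simp
    also have "\<dots> \<le> d * (2 * (hnorm w + 1))"
      using \<open>0 < d\<close> by (simp add: distrib_left)
    also have "\<dots> = e"
      using less_imp_neq[OF w, symmetric]
      by (simp add: d_def del: distrib_left_numeral)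
    finally show ?thesis .
  qed
  then have "hnorm (f x w - g x w) \<le> 0"
    by (rule field_le_epsilon[of _ 0, simplified])
  then show "f x w = g x w"
    using hnorm_ge_0[of "f x w - g x w"] by (metis eq_iff_diff_eq_0 hnorm_eq_0_iff order_antisym)
qed

section \<open>Projections onto lines and Latin squares\<close>

lemma orth_proj_line:
  assumes "b \<noteq> 0"
  shows "orth_proj (cvec.span {b}) x = (cinner x b / cinner b b) *\<^sub>C b"
  unfolding orth_proj_def
proof (rule the_equality)
  show "(cinner x b / cinner b b) *\<^sub>C b \<in> cvec.span {b} \<and>
      (\<forall>w\<in>cvec.span {b}. cinner (x - (cinner x b / cinner b b) *\<^sub>C b) w = 0)"
    using assms
    by (auto simp: cvec.span_singleton cinner_diff_left cinner_scaleC_left cinner_scaleC_right)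
next
  fix y assume y: "y \<in> cvec.span {b} \<and> (\<forall>w\<in>cvec.span {b}. cinner (x - y) w = 0)"
  then obtain c where c: "y = c *\<^sub>C b"
    by (auto simp: cvec.span_singleton)
  have "cinner (x - y) b = 0"
    using y cvec.span_base[of b "{b}"] by blast
  then have "c = cinner x b / cinner b b"
    using assms by (simp add: c cinner_diff_left cinner_scaleC_left field_simps)
  then show "y = (cinner x b / cinner b b) *\<^sub>C b"
    using c by simp
qed

lemma orth_proj_line_scaleC:
  assumes "b \<noteq> 0" "c \<noteq> 0"
  shows "orth_proj (cvec.span {c *\<^sub>C b}) = orth_proj (cvec.span {b})"
proof
  fix x
  have "cinner (c *\<^sub>C b) (c *\<^sub>C b) \<noteq> 0"
    using assms by simp
  then show "orth_proj (cvec.span {c *\<^sub>C b}) x = orth_proj (cvec.span {b}) x"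
    using assms by (simp add: orth_proj_line scaleC_scaleC cinner_scaleC_left cinner_scaleC_right)
qed

lemma orth_proj_line_bounded:
  assumes "b \<noteq> 0"
  shows "orth_proj (cvec.span {b}) \<in> bounded_ops"
proof (rule bounded_opsI)
  fix x
  have "hnorm ((cinner x b / cinner b b) *\<^sub>C b) = cmod (cinner x b) / (hnorm b)\<^sup>2 * hnorm b"
    by (simp add: hnorm_scaleC norm_divide norm_power cinner_self[of b])
  also have "\<dots> = cmod (cinner x b) / hnorm b"
    using assms by (simp add: power2_eq_square)
  also have "\<dots> \<le> hnorm x"
    using cinner_Cauchy_Schwarz[of x b] assms
    by (simp add: divide_le_eq order_less_le)
  finally show "hnorm (orth_proj (cvec.span {b}) x) \<le> 1 * hnorm x"
    using assms by (simp add: orth_proj_line)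
qed (use assms in \<open>simp_all add: orth_proj_line cinner_add_left add_divide_distrib scaleC_add_left
      cinner_scaleC_left scaleC_scaleC\<close>)

context
  fixes n :: nat and b :: "nat \<Rightarrow> 'h::complex_inner"
  assumes basis: "orthogonal_basis n b"
begin

lemma orthogonal_basis_nonzero: "i \<in> {1..n} \<Longrightarrow> b i \<noteq> 0"
  using basis unfolding orthogonal_basis_def by (metis cvec.dependent_zero imageI)

lemma orthogonal_basis_orthogonal:
  "\<lbrakk>i \<in> {1..n}; j \<in> {1..n}; i \<noteq> j\<rbrakk> \<Longrightarrow> cinner (b i) (b j) = 0"
  using basis unfolding orthogonal_basis_def by blast

lemma orthogonal_basis_eq_0:
  assumes "\<And>i. i \<in> {1..n} \<Longrightarrow> cinner x (b i) = 0"
  shows "x = 0"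
proof -
  have "x \<in> cvec.span (b ` {1..n})"
    using basis unfolding orthogonal_basis_def by simp
  then obtain I r where "I \<subseteq> b ` {1..n}" "x = (\<Sum>a\<in>I. r a *\<^sub>C a)"
    unfolding cvec.span_explicit by blast
  then have "cinner x x = (\<Sum>a\<in>I. cnj (r a) * cinner x a)"
    by (metis (no_types, lifting) cinner_scaleC_right cinner_sum_right sum.cong)
  also have "\<dots> = 0"
    using \<open>I \<subseteq> b ` {1..n}\<close> assms by (intro sum.neutral) auto
  finally show ?thesis
    by simp
qed

lemma orthogonal_basis_expansion:
  "x = (\<Sum>i\<in>{1..n}. (cinner x (b i) / cinner (b i) (b i)) *\<^sub>C b i)"
proof -
  let ?s = "\<Sum>i\<in>{1..n}. (cinner x (b i) / cinner (b i) (b i)) *\<^sub>C b i"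
  have "cinner (x - ?s) (b j) = 0" if j: "j \<in> {1..n}" for j
  proof -
    have "cinner ?s (b j) = (\<Sum>i\<in>{1..n}. if i = j then cinner x (b j) else 0)"
      unfolding cinner_sum_left cinner_scaleC_left using j orthogonal_basis_nonzero
      by (intro sum.cong) (auto simp: orthogonal_basis_orthogonal)
    then show ?thesis
      using j by (simp add: cinner_diff_left)
  qed
  then have "x - ?s = 0"
    by (rule orthogonal_basis_eq_0)
  then show ?thesis
    by simp
qed

text \<open>The coefficients of \<open>g y\<close> are forced by expanding \<open>x\<close> in the
  basis. The bound of \<open>f\<close> also bounds \<open>g\<close>: the squared norm of
  \<open>g y\<close> is \<langle>f(g y), y\<rangle>, at most \<open>K\<close> times the norms of
  \<open>g y\<close> and \<open>y\<close>, and one factor cancels unless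
  \<open>g y = 0\<close>.\<close>

lemma has_adjoints_if_orthogonal_basis: "has_adjoints TYPE('h)"
  unfolding has_adjoints_def
proof
  fix f :: "'h \<Rightarrow> 'h" assume f: "f \<in> bounded_ops"
  define g where "g y = (\<Sum>i\<in>{1..n}. (cinner y (f (b i)) / cinner (b i) (b i)) *\<^sub>C b i)" for y
  have adj: "cinner (f x) y = cinner x (g y)" for x y
  proof -
    have "cinner (f x) y = (\<Sum>i\<in>{1..n}. cinner x (b i) / cinner (b i) (b i) * cinner (f (b i)) y)"
      by (subst orthogonal_basis_expansion[of x])
        (simp add: bounded_ops_sum_apply[OF f] bounded_ops_scaleC[OF f] cinner_sum_left cinner_scaleC_left)
    also have "\<dots> = cinner x (g y)"
      unfolding g_def cinner_sum_right cinner_scaleC_right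
      by (intro sum.cong refl) (simp add: cinner_commute[of y "f (b _)"])
    finally show ?thesis .
  qed
  obtain K where K: "K \<ge> 0" "\<And>x. hnorm (f x) \<le> K * hnorm x"
    using bounded_ops_bound[OF f] by blast
  have "g \<in> bounded_ops"
  proof (rule bounded_opsI)
    show "g (x + y) = g x + g y" for x y
      by (simp add: g_def cinner_add_left add_divide_distrib scaleC_add_left sum.distrib)
    show "g (c *\<^sub>C x) = c *\<^sub>C g x" for c x
      by (simp add: g_def cinner_scaleC_left scaleC_scaleC cvec.scale_sum_right)
    show "hnorm (g y) \<le> K * hnorm y" for y
    proof (cases "g y = 0")
      case False
      have "(hnorm (g y))\<^sup>2 = Re (cinner (f (g y)) y)"
        by (simp add: hnorm_power2 adj)
      also have "\<dots> \<le> hnorm (f (g y)) * hnorm y"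
        using complex_Re_le_cmod cinner_Cauchy_Schwarz order_trans by blast
      also have "\<dots> \<le> K * hnorm (g y) * hnorm y"
        using K(2) by (intro mult_right_mono) auto
      finally have "hnorm (g y) * hnorm (g y) \<le> (K * hnorm y) * hnorm (g y)"
        by (simp add: power2_eq_square mult_ac)
      then show ?thesis
        using False by (simp add: mult_le_cancel_right order_less_le)
    qed (use K in simp)
  qed
  then show "\<exists>g\<in>bounded_ops. \<forall>x y. cinner (f x) y = cinner x (g y)"
    using adj by blast
qed

end

section \<open>Latin squares, their conjugates and the groups they generate\<close>

lemma latin_square_closed:
  assumes "latin_square n \<Sigma>" "i \<in> {1..n}" "j \<in> {1..n}"
  shows "\<Sigma> i j \<in> {1..n}"
proof -
  have "bij_betw (\<lambda>j. \<Sigma> i j) {1..n} {1..n}"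
    using assms unfolding latin_square_def by blast
  from bij_betw_apply[OF this assms(3)] show ?thesis .
qed

text \<open>Bijectivity of column \<open>j\<close> of \<open>\<Sigma>\<close> makes the definite
  description in \<open>latin_conjugate\<close> denote.\<close>

lemma latin_conjugate_eq_iff:
  assumes "latin_square n \<Sigma>" "k \<in> {1..n}" "j \<in> {1..n}"
  shows "latin_conjugate n \<Sigma> k j \<in> {1..n}"
    and "i \<in> {1..n} \<Longrightarrow> latin_conjugate n \<Sigma> k j = i \<longleftrightarrow> \<Sigma> i j = k"
proof -
  have bij: "bij_betw (\<lambda>i. \<Sigma> i j) {1..n} {1..n}"
    using assms unfolding latin_square_def by blast
  obtain i0 where i0: "i0 \<in> {1..n}" "\<Sigma> i0 j = k"
    using bij_betw_imp_surj_on[OF bij] assms(2) by (metis (no_types, lifting) imageE)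
  have eq: "i = i0" if "i \<in> {1..n}" "\<Sigma> i j = k" for i
    using inj_onD[OF bij_betw_imp_inj_on[OF bij], of i i0] that i0 by simp
  have the: "latin_conjugate n \<Sigma> k j = i0"
    unfolding latin_conjugate_def using i0 eq by (intro the_equality) blast+
  show "latin_conjugate n \<Sigma> k j \<in> {1..n}"
    unfolding the by (rule i0)
  show "latin_conjugate n \<Sigma> k j = i \<longleftrightarrow> \<Sigma> i j = k" if "i \<in> {1..n}"
    unfolding the using i0 eq that by metis
qed

text \<open>Columns of \<open>\<Sigma>\<close> make the conjugate well defined; rows make it
  injective. If \<open>j\<close> and \<open>l\<close> have the same image \<open>i\<close> under row
  \<open>k\<close> of the conjugate, then \<open>k\<close> stands in row \<open>i\<close> of
  \<open>\<Sigma>\<close> at both \<open>j\<close> and \<open>l\<close>.\<close>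

lemma row_perm_latin_conjugate_permutes:
  assumes "latin_square n \<Sigma>" "k \<in> {1..n}"
  shows "row_perm n (latin_conjugate n \<Sigma>) k permutes {1..n}"
proof (rule bij_imp_permutes)
  let ?p = "row_perm n (latin_conjugate n \<Sigma>) k"
  have "inj_on ?p {1..n}"
  proof (rule inj_onI)
    fix j l assume jl: "j \<in> {1..n}" "l \<in> {1..n}" "?p j = ?p l"
    let ?i = "latin_conjugate n \<Sigma> k j"
    have "?i \<in> {1..n}" "\<Sigma> ?i j = k" "\<Sigma> ?i l = k"
      using jl latin_conjugate_eq_iff[OF assms, of j] latin_conjugate_eq_iff[OF assms, of l]
      by (auto simp: row_perm_def)
    moreover have "inj_on (\<lambda>j. \<Sigma> ?i j) {1..n}"
      using assms \<open>?i \<in> {1..n}\<close> unfolding latin_square_def bij_betw_def by blast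
    ultimately show "j = l"
      using jl by (metis inj_onD)
  qed
  moreover have "?p ` {1..n} \<subseteq> {1..n}"
    using latin_conjugate_eq_iff(1)[OF assms] by (auto simp: row_perm_def)
  ultimately show "bij_betw ?p {1..n} {1..n}"
    by (simp add: bij_betw_def endo_inj_surj)
qed (auto simp: row_perm_def)

lemma latin_group_subgroup: "latin_square n \<Sigma> \<Longrightarrow> subgroup (latin_group n \<Sigma>) (sym_group n)"
  unfolding latin_group_def
  using row_perm_latin_conjugate_permutes
  by (intro group.generate_is_subgroup[OF sym_group_is_group]) (auto simp: sym_group_carrier)

text \<open>The centralizer of \<open>c\<close> is a subgroup, so it contains everything generated
  by a subset of it.\<close>

lemma (in group) generate_commute:
  assumes S: "S \<subseteq> carrier G" and c: "c \<in> carrier G" and comm: "\<And>s. s \<in> S \<Longrightarrow> s \<otimes> c = c \<otimes> s"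
    and x: "x \<in> generate G S"
  shows "x \<otimes> c = c \<otimes> x"
  using x
proof induction
  case (inv h)
  have "h \<in> carrier G" "h \<otimes> c = c \<otimes> h"
    using inv S comm by auto
  then show ?case
    using c by (metis inv_closed inv_solve_left inv_solve_right m_assoc m_closed)
next
  case (eng h1 h2)
  then have "h1 \<in> carrier G" "h2 \<in> carrier G"
    using generate_in_carrier[OF S] by auto
  then show ?case
    using eng.IH c by (metis m_assoc)
qed (use comm c in auto)

text \<open>\<open>generate_commute\<close> is used twice: first with a generator in the role of
  \<open>c\<close>, then, on the strength of that, with an arbitrary element of the generated
  group.\<close>

lemma (in group) comm_group_generate:
  assumes S: "S \<subseteq> carrier G" and comm: "\<And>s t. \<lbrakk>s \<in> S; t \<in> S\<rbrakk> \<Longrightarrow> s \<otimes> t = t \<otimes> s"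
  shows "comm_group (G\<lparr>carrier := generate G S\<rparr>)"
proof (rule group.group_comm_groupI)
  show "group (G\<lparr>carrier := generate G S\<rparr>)"
    using generate_is_subgroup[OF S] subgroup_imp_group by blast
  fix x y
  assume "x \<in> carrier (G\<lparr>carrier := generate G S\<rparr>)" "y \<in> carrier (G\<lparr>carrier := generate G S\<rparr>)"
  then have xy: "x \<in> generate G S" "y \<in> generate G S"
    by auto
  have "y \<otimes> s = s \<otimes> y" if "s \<in> S" for s
    using generate_commute[OF S _ comm xy(2)] that S by blast
  then show "x \<otimes>\<^bsub>G\<lparr>carrier := generate G S\<rparr>\<^esub> y = y \<otimes>\<^bsub>G\<lparr>carrier := generate G S\<rparr>\<^esub> x"
    using generate_commute[OF S generate_in_carrier[OF S xy(2)] _ xy(1)] by simp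
qed

lemma abelian_latin_squareI:
  assumes latin: "latin_square n \<Sigma>"
    and comm: "\<And>a c j. \<lbrakk>a \<in> {1..n}; c \<in> {1..n}; j \<in> {1..n}\<rbrakk> \<Longrightarrow>
      latin_conjugate n \<Sigma> a (latin_conjugate n \<Sigma> c j) = latin_conjugate n \<Sigma> c (latin_conjugate n \<Sigma> a j)"
  shows "abelian_latin_square n \<Sigma>"
proof -
  interpret S: group "sym_group n"
    by (rule sym_group_is_group)
  let ?r = "row_perm n (latin_conjugate n \<Sigma>)"
  have rows: "?r ` {1..n} \<subseteq> carrier (sym_group n)"
    using row_perm_latin_conjugate_permutes[OF latin] by (auto simp: sym_group_carrier)
  have "?r a \<circ> ?r c = ?r c \<circ> ?r a" if "a \<in> {1..n}" "c \<in> {1..n}" for a c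
    using that comm latin_conjugate_eq_iff(1)[OF latin] by (auto simp: row_perm_def fun_eq_iff)
  then have "comm_group (sym_group n\<lparr>carrier := generate (sym_group n) (?r ` {1..n})\<rparr>)"
    by (intro S.comm_group_generate rows) (auto simp: sym_group_mult)
  then show ?thesis
    using latin by (simp add: abelian_latin_square_def latin_group_def)
qed

text \<open>The first row serves as the common basis. Some \<open>\<xi> 1 k\<close> is not
  orthogonal to \<open>\<xi> i j\<close>; projecting it onto the line of \<open>\<xi> i j\<close>
  gives a nonzero multiple of \<open>\<xi> i j\<close>, which by \<open>eig\<close> is also a
  multiple of \<open>\<xi> 1 k\<close>.\<close>

lemma latin_square_of_eigenvectors:
  fixes \<xi> :: "nat \<Rightarrow> nat \<Rightarrow> 'h::complex_inner"
  assumes magic: "magic_basis n \<xi>" and n: "n \<noteq> 0"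
    and eig: "\<And>i j k l. \<lbrakk>i \<in> {1..n}; j \<in> {1..n}; k \<in> {1..n}; l \<in> {1..n}\<rbrakk>
      \<Longrightarrow> \<exists>c. orth_proj (cvec.span {\<xi> i j}) (\<xi> k l) = c *\<^sub>C \<xi> k l"
  shows "\<exists>\<Sigma>. latin_square n \<Sigma> \<and> (\<forall>i\<in>{1..n}. \<forall>j\<in>{1..n}. \<exists>c. c \<noteq> 0 \<and> \<xi> i j = c *\<^sub>C \<xi> 1 (\<Sigma> i j))"
proof -
  have row: "orthogonal_basis n (\<xi> i)" and col: "orthogonal_basis n (\<lambda>j. \<xi> j i)" if "i \<in> {1..n}" for i
    using magic that unfolding magic_basis_def by auto
  have one: "1 \<in> {1..n}"
    using n by simp
  have nz: "\<xi> i j \<noteq> 0" if "i \<in> {1..n}" "j \<in> {1..n}" for i j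
    using orthogonal_basis_nonzero[OF row[OF that(1)] that(2)] .
  have ex: "\<exists>k\<in>{1..n}. \<exists>c. c \<noteq> 0 \<and> \<xi> i j = c *\<^sub>C \<xi> 1 k" if ij: "i \<in> {1..n}" "j \<in> {1..n}" for i j
  proof -
    obtain k where k: "k \<in> {1..n}" "cinner (\<xi> i j) (\<xi> 1 k) \<noteq> 0"
      using orthogonal_basis_eq_0[OF row[OF one], of "\<xi> i j"] nz[OF ij] by blast
    let ?d = "cinner (\<xi> 1 k) (\<xi> i j) / cinner (\<xi> i j) (\<xi> i j)"
    have d: "?d \<noteq> 0"
      using k cinner_commute[of "\<xi> i j" "\<xi> 1 k"] nz[OF ij] by auto
    obtain c where "?d *\<^sub>C \<xi> i j = c *\<^sub>C \<xi> 1 k"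
      using eig[OF ij one k(1)] orth_proj_line[OF nz[OF ij], of "\<xi> 1 k"] by auto
    then have "(inverse ?d * ?d) *\<^sub>C \<xi> i j = (inverse ?d * c) *\<^sub>C \<xi> 1 k"
      by (metis scaleC_scaleC)
    then have eq: "\<xi> i j = (inverse ?d * c) *\<^sub>C \<xi> 1 k"
      using d by (simp add: scaleC_one)
    then have "inverse ?d * c \<noteq> 0"
      using nz[OF ij] by auto
    then show ?thesis
      using eq k(1) by blast
  qed
  define \<Sigma> where "\<Sigma> i j = (SOME k. k \<in> {1..n} \<and> (\<exists>c. c \<noteq> 0 \<and> \<xi> i j = c *\<^sub>C \<xi> 1 k))" for i j
  have Sig: "\<Sigma> i j \<in> {1..n}" "\<exists>c. c \<noteq> 0 \<and> \<xi> i j = c *\<^sub>C \<xi> 1 (\<Sigma> i j)"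
    if "i \<in> {1..n}" "j \<in> {1..n}" for i j
    using someI_ex[of "\<lambda>k. k \<in> {1..n} \<and> (\<exists>c. c \<noteq> 0 \<and> \<xi> i j = c *\<^sub>C \<xi> 1 k)"] ex[OF that]
    unfolding \<Sigma>_def by blast+
  \<comment> \<open>Equal entries of \<open>\<Sigma>\<close> belong to proportional nonzero vectors,
    whereas distinct positions in one row or one column carry orthogonal vectors. Hence
    \<open>\<Sigma>\<close> is injective along rows and columns.\<close>
  have not_orth: "cinner (\<xi> i j) (\<xi> k l) \<noteq> 0"
    if "i \<in> {1..n}" "j \<in> {1..n}" "k \<in> {1..n}" "l \<in> {1..n}" "\<Sigma> i j = \<Sigma> k l" for i j k l
    using Sig(2)[OF that(1,2)] Sig(2)[OF that(3,4)] nz[OF one Sig(1)[OF that(3,4)]] that(5)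
    by (auto simp: cinner_scaleC_left cinner_scaleC_right)
  have "bij_betw (\<Sigma> i) {1..n} {1..n}" if i: "i \<in> {1..n}" for i
  proof -
    have "inj_on (\<Sigma> i) {1..n}"
      using not_orth[OF i _ i] orthogonal_basis_orthogonal[OF row[OF i]] by (intro inj_onI) blast
    moreover have "\<Sigma> i ` {1..n} \<subseteq> {1..n}"
      using Sig(1)[OF i] by blast
    ultimately show ?thesis
      by (simp add: bij_betw_def endo_inj_surj)
  qed
  moreover have "bij_betw (\<lambda>j. \<Sigma> j i) {1..n} {1..n}" if i: "i \<in> {1..n}" for i
  proof -
    have "inj_on (\<lambda>j. \<Sigma> j i) {1..n}"
      using not_orth[OF _ i _ i] orthogonal_basis_orthogonal[OF col[OF i]] by (intro inj_onI) blast
    moreover have "(\<lambda>j. \<Sigma> j i) ` {1..n} \<subseteq> {1..n}"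
      using Sig(1)[OF _ i] by blast
    ultimately show ?thesis
      by (simp add: bij_betw_def endo_inj_surj)
  qed
  ultimately have "latin_square n \<Sigma>"
    unfolding latin_square_def by blast
  then show ?thesis
    using Sig(2) by blast
qed

lemma comes_from_proportional:
  assumes "associated_rep n As v \<xi> \<pi>" and basis: "orthogonal_basis n b" and "latin_square n \<Sigma>"
    and proportional: "\<And>i j. \<lbrakk>i \<in> {1..n}; j \<in> {1..n}\<rbrakk> \<Longrightarrow> \<exists>c. c \<noteq> 0 \<and> \<xi> i j = c *\<^sub>C b (\<Sigma> i j)"
  shows "comes_from n As v \<pi> \<Sigma>"
proof -
  have "orth_proj (cvec.span {\<xi> i j}) = orth_proj (cvec.span {b (\<Sigma> i j)})"
    if ij: "i \<in> {1..n}" "j \<in> {1..n}" for i j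
  proof -
    have "b (\<Sigma> i j) \<noteq> 0"
      using orthogonal_basis_nonzero[OF basis] latin_square_closed[OF assms(3) ij] .
    moreover obtain c where "c \<noteq> 0" "\<xi> i j = c *\<^sub>C b (\<Sigma> i j)"
      using proportional[OF ij] by blast
    ultimately show ?thesis
      by (simp add: orth_proj_line_scaleC)
  qed
  then show ?thesis
    using assms(1) basis unfolding comes_from_def associated_rep_def by auto
qed

section \<open>Equations between tensors, tested by bilinear forms\<close>

lemma (in tensor_product) bilinear_form_eq:
  fixes x x' :: "'i \<Rightarrow> 'a"
  assumes "star_algebra A" and fin: "finite I" "finite J"
    and x: "\<And>i. i \<in> I \<Longrightarrow> x i \<in> carrier A \<and> y i \<in> carrier B"
    and x': "\<And>i. i \<in> J \<Longrightarrow> x' i \<in> carrier A \<and> y' i \<in> carrier B"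
    and eq: "(\<Oplus>\<^bsub>T\<^esub>i\<in>I. tens (x i) (y i)) = (\<Oplus>\<^bsub>T\<^esub>i\<in>J. tens (x' i) (y' i))"
    and \<beta>: "bilinear_form A B \<beta>"
  shows "(\<Sum>i\<in>I. \<beta> (x i) (y i)) = (\<Sum>i\<in>J. \<beta> (x' i) (y' i))"
proof -
  interpret A: star_algebra A by fact
  \<comment> \<open>\<open>tens_zero\<close> concerns sums that vanish, so the right-hand side is
    moved over with the factor -1, and both families are joined over the disjoint sum of their index
    sets.\<close>
  define K where "K = Inl ` I \<union> Inr ` J"
  define X where "X = case_sum x (\<lambda>i. (- 1) \<odot>\<^bsub>A\<^esub> x' i)"
  define Y where "Y = case_sum y y'"
  have finK: "finite K"
    using fin by (simp add: K_def)
  have XY: "X k \<in> carrier A" "Y k \<in> carrier B" if "k \<in> K" for k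
    using that x x' by (auto simp: K_def X_def Y_def)
  have tXY: "tens (X k) (Y k) \<in> carrier T" if "k \<in> K" for k
    using XY[OF that] tens_closed by blast
  have "(\<Oplus>\<^bsub>T\<^esub>k\<in>K. tens (X k) (Y k))
      = (\<Oplus>\<^bsub>T\<^esub>k\<in>Inl ` I. tens (X k) (Y k)) \<oplus>\<^bsub>T\<^esub> (\<Oplus>\<^bsub>T\<^esub>k\<in>Inr ` J. tens (X k) (Y k))"
    unfolding K_def using fin tXY
    by (intro finsum_Un_disjoint) (auto simp: K_def)
  also have "(\<Oplus>\<^bsub>T\<^esub>k\<in>Inl ` I. tens (X k) (Y k)) = (\<Oplus>\<^bsub>T\<^esub>i\<in>I. tens (x i) (y i))"
    using tXY by (subst finsum_reindex) (auto simp: K_def X_def Y_def)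
  also have "(\<Oplus>\<^bsub>T\<^esub>k\<in>Inr ` J. tens (X k) (Y k)) = (\<Oplus>\<^bsub>T\<^esub>i\<in>J. (- 1) \<odot>\<^bsub>T\<^esub> tens (x' i) (y' i))"
    using tXY x' tens_closed
    by (subst finsum_reindex) (auto simp: K_def X_def Y_def tens_smult_left intro!: finsum_cong')
  also have "\<dots> = (- 1) \<odot>\<^bsub>T\<^esub> (\<Oplus>\<^bsub>T\<^esub>i\<in>J. tens (x' i) (y' i))"
    using x' fin tens_closed by (subst finsum_smult) auto
  also have "(\<Oplus>\<^bsub>T\<^esub>i\<in>I. tens (x i) (y i)) \<oplus>\<^bsub>T\<^esub> (- 1) \<odot>\<^bsub>T\<^esub> (\<Oplus>\<^bsub>T\<^esub>i\<in>J. tens (x' i) (y' i)) = \<zero>\<^bsub>T\<^esub>"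
    unfolding eq using x' fin tens_closed
    by (simp add: a_inv_eq_smult[symmetric] r_neg Pi_def)
  finally have zero: "(\<Oplus>\<^bsub>T\<^esub>k\<in>K. tens (X k) (Y k)) = \<zero>\<^bsub>T\<^esub>" .
  \<comment> \<open>\<open>tens_zero\<close> indexes its sums by an initial segment of the natural
    numbers, hence this enumeration of \<open>K\<close>.\<close>
  obtain h where "bij_betw h {0..<card K} K"
    using ex_bij_betw_nat_finite[OF finK] by blast
  then have h: "bij_betw h {..<card K} K"
    by (simp add: atLeast0LessThan)
  have hK: "h i \<in> K" if "i < card K" for i
    using h that unfolding bij_betw_def by blast
  have "(\<Oplus>\<^bsub>T\<^esub>i\<in>{..<card K}. tens (X (h i)) (Y (h i))) = (\<Oplus>\<^bsub>T\<^esub>k\<in>h ` {..<card K}. tens (X k) (Y k))"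
    using h hK tXY unfolding bij_betw_def by (subst finsum_reindex) auto
  also have "\<dots> = \<zero>\<^bsub>T\<^esub>"
    using h zero by (simp add: bij_betw_def)
  finally have "(\<Sum>i<card K. \<beta> (X (h i)) (Y (h i))) = 0"
    using hK XY \<beta> by (intro tens_zero) auto
  then have "0 = (\<Sum>k\<in>K. \<beta> (X k) (Y k))"
    using sum.reindex_bij_betw[OF h, of "\<lambda>k. \<beta> (X k) (Y k)"] by simp
  also have "\<dots> = (\<Sum>i\<in>I. \<beta> (x i) (y i)) + (\<Sum>i\<in>J. \<beta> ((- 1) \<odot>\<^bsub>A\<^esub> x' i) (y' i))"
    unfolding K_def using fin
    by (subst sum.union_disjoint) (auto simp: sum.reindex X_def Y_def)
  also have "(\<Sum>i\<in>J. \<beta> ((- 1) \<odot>\<^bsub>A\<^esub> x' i) (y' i)) = (\<Sum>i\<in>J. - 1 * \<beta> (x' i) (y' i))"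
    using \<beta> x' unfolding bilinear_form_def by (intro sum.cong) auto
  finally show ?thesis
    by (simp add: sum_negf)
qed

lemma star_homD:
  assumes "star_hom A B f"
  shows "x \<in> carrier A \<Longrightarrow> f x \<in> carrier B"
    and "\<lbrakk>x \<in> carrier A; y \<in> carrier A\<rbrakk> \<Longrightarrow> f (x \<otimes>\<^bsub>A\<^esub> y) = f x \<otimes>\<^bsub>B\<^esub> f y"
    and "\<lbrakk>x \<in> carrier A; y \<in> carrier A\<rbrakk> \<Longrightarrow> f (x \<oplus>\<^bsub>A\<^esub> y) = f x \<oplus>\<^bsub>B\<^esub> f y"
    and "f \<one>\<^bsub>A\<^esub> = \<one>\<^bsub>B\<^esub>"
    and "x \<in> carrier A \<Longrightarrow> f (c \<odot>\<^bsub>A\<^esub> x) = c \<odot>\<^bsub>B\<^esub> f x"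
    and "x \<in> carrier A \<Longrightarrow> f (star A x) = star B (f x)"
  using assms unfolding star_hom_def ring_hom_def by auto

text \<open>Stated for additive maps rather than homomorphisms, since it is also applied to maps
  that fix one tensor factor and multiply by a fixed element.\<close>

lemma additive_map_finsum:
  assumes A: "star_algebra A" and B: "star_algebra B"
    and closed: "\<And>x. x \<in> carrier A \<Longrightarrow> f x \<in> carrier B"
    and add: "\<And>x y. \<lbrakk>x \<in> carrier A; y \<in> carrier A\<rbrakk> \<Longrightarrow> f (x \<oplus>\<^bsub>A\<^esub> y) = f x \<oplus>\<^bsub>B\<^esub> f y"
    and fin: "finite I" and x: "\<And>i. i \<in> I \<Longrightarrow> x i \<in> carrier A"
  shows "f (\<Oplus>\<^bsub>A\<^esub>i\<in>I. x i) = (\<Oplus>\<^bsub>B\<^esub>i\<in>I. f (x i))"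
proof -
  interpret A: star_algebra A by fact
  interpret B: star_algebra B by fact
  show ?thesis
    using fin x
  proof (induction I rule: finite_induct)
    case empty
    have "f \<zero>\<^bsub>A\<^esub> = f \<zero>\<^bsub>A\<^esub> \<oplus>\<^bsub>B\<^esub> f \<zero>\<^bsub>A\<^esub>"
      using add[of "\<zero>\<^bsub>A\<^esub>" "\<zero>\<^bsub>A\<^esub>"] by simp
    then show ?case
      using closed[of "\<zero>\<^bsub>A\<^esub>"] by simp
  next
    case (insert i I)
    have xI: "x \<in> I \<rightarrow> carrier A" "(\<lambda>i. f (x i)) \<in> I \<rightarrow> carrier B" "x i \<in> carrier A"
      using insert.prems closed by auto
    have "f (\<Oplus>\<^bsub>A\<^esub>i\<in>insert i I. x i) = f (x i \<oplus>\<^bsub>A\<^esub> (\<Oplus>\<^bsub>A\<^esub>i\<in>I. x i))"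
      using insert.hyps xI by (subst A.finsum_insert) auto
    also have "\<dots> = f (x i) \<oplus>\<^bsub>B\<^esub> f (\<Oplus>\<^bsub>A\<^esub>i\<in>I. x i)"
      using xI by (intro add A.finsum_closed)
    also have "\<dots> = f (x i) \<oplus>\<^bsub>B\<^esub> (\<Oplus>\<^bsub>B\<^esub>i\<in>I. f (x i))"
      using insert.IH insert.prems by simp
    also have "\<dots> = (\<Oplus>\<^bsub>B\<^esub>i\<in>insert i I. f (x i))"
      using insert.hyps xI closed by (subst B.finsum_insert) auto
    finally show ?case .
  qed
qed

lemma star_hom_finsum:
  assumes "star_hom A B f" and "star_algebra A" and "star_algebra B" and "finite I"
    and "\<And>i. i \<in> I \<Longrightarrow> x i \<in> carrier A"
  shows "f (\<Oplus>\<^bsub>A\<^esub>i\<in>I. x i) = (\<Oplus>\<^bsub>B\<^esub>i\<in>I. f (x i))"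
  using assms star_homD[OF assms(1)] by (intro additive_map_finsum) auto

text \<open>Applying \<open>\<sigma>\<close> to \<open>\<Delta> (u i j)\<close> swaps the factors of
  each tensor and changes nothing; a bilinear form turns this equation in \<open>T\<close> into one
  between complex numbers. From here on the forward direction no longer mentions the tensor
  square.\<close>

lemma cocommutative_bilinear_form:
  assumes coco: "cocommutative n A u" and "cstar_algebra A" and "magic_unitary n A u"
    and \<beta>: "bilinear_form A A \<beta>" and ij: "i \<in> {1..n}" "j \<in> {1..n}"
  shows "(\<Sum>k\<in>{1..n}. \<beta> (u i k) (u k j)) = (\<Sum>k\<in>{1..n}. \<beta> (u k j) (u i k))"
proof -
  obtain T :: "universe cstar" and tens \<Delta> \<sigma> where \<Delta>: "comultiplication n A u T tens \<Delta>"
    and \<sigma>: "star_hom T T \<sigma>" "\<And>x y. \<lbrakk>x \<in> carrier A; y \<in> carrier A\<rbrakk> \<Longrightarrow> \<sigma> (tens x y) = tens y x"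
    "\<And>x. x \<in> carrier A \<Longrightarrow> \<sigma> (\<Delta> x) = \<Delta> x"
    using coco unfolding cocommutative_def by metis
  interpret A: cstar_algebra A by fact
  interpret tensor_product A A T tens
    using \<Delta> unfolding comultiplication_def by blast
  have u: "u k l \<in> carrier A" if "k \<in> {1..n}" "l \<in> {1..n}" for k l
    using assms(3) that unfolding magic_unitary_def by blast
  have \<Delta>u: "\<Delta> (u i j) = (\<Oplus>\<^bsub>T\<^esub>k\<in>{1..n}. tens (u i k) (u k j))"
    using \<Delta> ij unfolding comultiplication_def by blast
  have "(\<Oplus>\<^bsub>T\<^esub>k\<in>{1..n}. tens (u k j) (u i k)) = (\<Oplus>\<^bsub>T\<^esub>k\<in>{1..n}. \<sigma> (tens (u i k) (u k j)))"
    using \<sigma>(2) u ij tens_closed by (intro finsum_cong') auto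
  also have "\<dots> = \<sigma> (\<Delta> (u i j))"
    unfolding \<Delta>u using u ij tens_closed
    by (subst star_hom_finsum[OF \<sigma>(1) star_algebra_axioms star_algebra_axioms]) auto
  also have "\<dots> = (\<Oplus>\<^bsub>T\<^esub>k\<in>{1..n}. tens (u i k) (u k j))"
    unfolding \<sigma>(3)[OF u[OF ij]] by (rule \<Delta>u)
  finally show ?thesis
    using u ij by (intro bilinear_form_eq[OF A.star_algebra_axioms _ _ _ _ _ \<beta>]) auto
qed

lemma orth_proj_line_self: "b \<noteq> 0 \<Longrightarrow> orth_proj (cvec.span {b}) b = b"
  by (simp add: orth_proj_line scaleC_one)

lemma orth_proj_line_orthogonal: "\<lbrakk>b \<noteq> 0; cinner x b = 0\<rbrakk> \<Longrightarrow> orth_proj (cvec.span {b}) x = 0"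
  by (simp add: orth_proj_line)

text \<open>The forms on which the flip identity is tested. Letting \<open>y\<close> vary recovers
  the vector \<open>\<rho> X x\<close>, while the second factor only contributes a scalar.\<close>

lemma bilinear_form_matrix_coefficients:
  assumes "star_hom A op_algebra \<rho>"
  shows "bilinear_form A A (\<lambda>X Y. cinner (\<rho> X x) y * cinner (\<rho> Y z) w)"
  unfolding bilinear_form_def using star_hom_op_algebraD(3,5)[OF assms]
  by (simp add: cinner_add_left cinner_scaleC_left algebra_simps)

section \<open>From commutation or cocommutation to a Latin square\<close>

context
  fixes n :: nat and \<xi> :: "nat \<Rightarrow> nat \<Rightarrow> 'h::complex_inner" and A :: "'a cstar"
    and u :: "nat \<Rightarrow> nat \<Rightarrow> 'a" and \<rho> :: "'a \<Rightarrow> 'h \<Rightarrow> 'h"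
  assumes magic: "magic_basis n \<xi>" and A: "cstar_algebra A" and u: "magic_unitary n A u"
    and \<rho>: "star_hom A op_algebra \<rho>"
    and \<rho>u: "\<And>i j. \<lbrakk>i \<in> {1..n}; j \<in> {1..n}\<rbrakk> \<Longrightarrow> \<rho> (u i j) = orth_proj (cvec.span {\<xi> i j})"
begin

lemma magic_unitary_closed: "\<lbrakk>i \<in> {1..n}; j \<in> {1..n}\<rbrakk> \<Longrightarrow> u i j \<in> carrier A"
  using u unfolding magic_unitary_def by blast

lemma magic_basis_row: "i \<in> {1..n} \<Longrightarrow> orthogonal_basis n (\<xi> i)"
  using magic unfolding magic_basis_def by auto

lemma magic_basis_nonzero: "\<lbrakk>i \<in> {1..n}; j \<in> {1..n}\<rbrakk> \<Longrightarrow> \<xi> i j \<noteq> 0"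
  using orthogonal_basis_nonzero magic_basis_row by blast

text \<open>The projection onto the line of \<open>\<xi> k l\<close> fixes \<open>\<xi> k l\<close>.
  Commuting it past the other projection shows that the image of \<open>\<xi> k l\<close> stays on
  that line.\<close>

lemma commutative_eigenvectors:
  assumes comm: "commutative A"
    and ij: "i \<in> {1..n}" "j \<in> {1..n}" and kl: "k \<in> {1..n}" "l \<in> {1..n}"
  shows "\<exists>c. orth_proj (cvec.span {\<xi> i j}) (\<xi> k l) = c *\<^sub>C \<xi> k l"
proof -
  note uc = magic_unitary_closed[OF ij] magic_unitary_closed[OF kl]
  note nz = magic_basis_nonzero[OF kl]
  have "\<rho> (u i j) (\<rho> (u k l) (\<xi> k l)) = \<rho> (u k l) (\<rho> (u i j) (\<xi> k l))"
    using comm uc star_hom_op_algebraD(2)[OF \<rho>] unfolding commutative_def by metis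
  then have "orth_proj (cvec.span {\<xi> i j}) (\<xi> k l)
      = orth_proj (cvec.span {\<xi> k l}) (orth_proj (cvec.span {\<xi> i j}) (\<xi> k l))"
    using \<rho>u ij kl nz by (simp add: orth_proj_line_self)
  then show ?thesis
    using orth_proj_line[OF nz] by metis
qed

text \<open>The flip identity is tested at \<open>\<xi> i l\<close> in the first factor and
  \<open>e = \<xi> i b\<close> in the second. Both vectors lie in row \<open>i\<close>, so
  orthogonality leaves only \<open>k = l\<close> on one side and \<open>k = b\<close> on the other.
  The eigenvalue is \<langle>P e, e\<rangle> / \<langle>e, e\<rangle>, with P the projection onto
  the line of \<open>\<xi> l j\<close>.\<close>

lemma cocommutative_eigenvectors:
  assumes coco: "cocommutative n A u"
    and bj: "b \<in> {1..n}" "j \<in> {1..n}" and il: "i \<in> {1..n}" "l \<in> {1..n}"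
  shows "\<exists>c. orth_proj (cvec.span {\<xi> b j}) (\<xi> i l) = c *\<^sub>C \<xi> i l"
proof -
  let ?P = "\<lambda>i j. orth_proj (cvec.span {\<xi> i j})"
  define e where "e = \<xi> i b"
  have e: "cinner e e \<noteq> 0"
    using magic_basis_nonzero[OF il(1) bj(1)] by (simp add: e_def)
  have P: "?P i k (\<xi> i m) = (if k = m then \<xi> i m else 0)" if "k \<in> {1..n}" "m \<in> {1..n}" for k m
    using magic_basis_nonzero[OF il(1)] that orthogonal_basis_orthogonal[OF magic_basis_row[OF il(1)]]
    by (simp add: orth_proj_line_self orth_proj_line_orthogonal)
  have "cinner (cinner e e *\<^sub>C ?P b j (\<xi> i l)) y = cinner (cinner (?P l j e) e *\<^sub>C \<xi> i l) y" for y
  proof -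
    have "(\<Sum>k\<in>{1..n}. cinner (\<rho> (u i k) (\<xi> i l)) y * cinner (\<rho> (u k j) e) e)
        = (\<Sum>k\<in>{1..n}. cinner (\<rho> (u k j) (\<xi> i l)) y * cinner (\<rho> (u i k) e) e)"
      by (rule cocommutative_bilinear_form[OF coco A u
            bilinear_form_matrix_coefficients[OF \<rho>, of "\<xi> i l" y e e] il(1) bj(2)])
    moreover have "(\<Sum>k\<in>{1..n}. cinner (\<rho> (u i k) (\<xi> i l)) y * cinner (\<rho> (u k j) e) e)
        = (\<Sum>k\<in>{1..n}. if k = l then cinner (\<xi> i l) y * cinner (?P l j e) e else 0)"
      using il bj by (intro sum.cong) (auto simp: \<rho>u P)
    moreover have "(\<Sum>k\<in>{1..n}. cinner (\<rho> (u k j) (\<xi> i l)) y * cinner (\<rho> (u i k) e) e)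
        = (\<Sum>k\<in>{1..n}. if k = b then cinner (?P b j (\<xi> i l)) y * cinner e e else 0)"
      using il bj by (intro sum.cong) (auto simp: \<rho>u P e_def)
    ultimately show ?thesis
      using il bj by (simp add: cinner_scaleC_left mult.commute)
  qed
  then have "cinner e e *\<^sub>C ?P b j (\<xi> i l) = cinner (?P l j e) e *\<^sub>C \<xi> i l"
    by (rule cinner_ext)
  then have "(inverse (cinner e e) * cinner e e) *\<^sub>C ?P b j (\<xi> i l)
      = (inverse (cinner e e) * cinner (?P l j e) e) *\<^sub>C \<xi> i l"
    by (metis scaleC_scaleC)
  then show ?thesis
    using e by (auto simp: scaleC_one)
qed

text \<open>Tested on \<open>b a\<close> and \<open>b c\<close>, the two sides of the flip identity
  count, up to the nonzero factor \<open>?N\<close>, the \<open>m\<close> with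
  \<open>\<Sigma> i m = a\<close>, \<open>\<Sigma> m j = c\<close> and those with \<open>a\<close>
  and \<open>c\<close> exchanged. For \<open>i = ?L a (?L c j)\<close> the first count is positive
  because of \<open>m = ?L c j\<close>. A witness \<open>m\<close> of the second count satisfies
  \<open>m = ?L a j\<close> and \<open>i = ?L c m\<close>, which is the commutation sought.\<close>

lemma cocommutative_abelian_latin_square:
  assumes coco: "cocommutative n A u" and latin: "latin_square n \<Sigma>"
    and basis: "orthogonal_basis n b"
    and proportional: "\<And>i j. \<lbrakk>i \<in> {1..n}; j \<in> {1..n}\<rbrakk> \<Longrightarrow> \<exists>c. c \<noteq> 0 \<and> \<xi> i j = c *\<^sub>C b (\<Sigma> i j)"
  shows "abelian_latin_square n \<Sigma>"
proof (rule abelian_latin_squareI[OF latin])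
  let ?L = "latin_conjugate n \<Sigma>"
  fix a c j assume a: "a \<in> {1..n}" and c: "c \<in> {1..n}" and j: "j \<in> {1..n}"
  define k where "k = ?L c j"
  define i where "i = ?L a k"
  have k: "k \<in> {1..n}" "\<Sigma> k j = c"
    using latin_conjugate_eq_iff[OF latin c j] by (auto simp: k_def)
  have i: "i \<in> {1..n}" "\<Sigma> i k = a"
    using latin_conjugate_eq_iff[OF latin a k(1)] by (auto simp: i_def)
  have coeff: "cinner (\<rho> (u i j) (b a)) (b a) = (if \<Sigma> i j = a then cinner (b a) (b a) else 0)"
    if t: "i \<in> {1..n}" "j \<in> {1..n}" "a \<in> {1..n}" for i j a
  proof -
    have s: "\<Sigma> i j \<in> {1..n}"
      using latin_square_closed[OF latin t(1,2)] .
    note nz = orthogonal_basis_nonzero[OF basis s]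
    obtain d where d: "d \<noteq> 0" "\<xi> i j = d *\<^sub>C b (\<Sigma> i j)"
      using proportional[OF t(1,2)] by blast
    have "\<rho> (u i j) = orth_proj (cvec.span {b (\<Sigma> i j)})"
      using \<rho>u[OF t(1,2)] d orth_proj_line_scaleC[OF nz d(1)] by simp
    then show ?thesis
      using orthogonal_basis_orthogonal[OF basis t(3) s] nz
      by (auto simp: orth_proj_line_self orth_proj_line_orthogonal)
  qed
  let ?N = "cinner (b a) (b a) * cinner (b c) (b c)"
  have N: "?N \<noteq> 0"
    using orthogonal_basis_nonzero[OF basis a] orthogonal_basis_nonzero[OF basis c] by simp
  have eq: "(\<Sum>m\<in>{1..n}. cinner (\<rho> (u i m) (b a)) (b a) * cinner (\<rho> (u m j) (b c)) (b c))
      = (\<Sum>m\<in>{1..n}. cinner (\<rho> (u m j) (b a)) (b a) * cinner (\<rho> (u i m) (b c)) (b c))"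
    by (rule cocommutative_bilinear_form[OF coco A u
          bilinear_form_matrix_coefficients[OF \<rho>, of "b a" "b a" "b c" "b c"] i(1) j])
  have card: "(\<Sum>m\<in>{1..n}. if Q m then ?N else 0) = of_nat (card {m\<in>{1..n}. Q m}) * ?N" for Q
    by (simp add: sum.inter_filter[symmetric])
  have left: "(\<Sum>m\<in>{1..n}. cinner (\<rho> (u i m) (b a)) (b a) * cinner (\<rho> (u m j) (b c)) (b c))
      = (\<Sum>m\<in>{1..n}. if \<Sigma> i m = a \<and> \<Sigma> m j = c then ?N else 0)"
    using i(1) j a c by (intro sum.cong) (auto simp: coeff)
  have right: "(\<Sum>m\<in>{1..n}. cinner (\<rho> (u m j) (b a)) (b a) * cinner (\<rho> (u i m) (b c)) (b c))
      = (\<Sum>m\<in>{1..n}. if \<Sigma> m j = a \<and> \<Sigma> i m = c then ?N else 0)"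
    using i(1) j a c by (intro sum.cong) (auto simp: coeff)
  have "card {m\<in>{1..n}. \<Sigma> i m = a \<and> \<Sigma> m j = c} = card {m\<in>{1..n}. \<Sigma> m j = a \<and> \<Sigma> i m = c}"
    using eq N unfolding left right card by (simp only: mult_cancel_right of_nat_eq_iff) simp
  moreover have "card {m\<in>{1..n}. \<Sigma> i m = a \<and> \<Sigma> m j = c} \<noteq> 0"
    using i k by auto
  ultimately have "{m\<in>{1..n}. \<Sigma> m j = a \<and> \<Sigma> i m = c} \<noteq> {}"
    by (metis (no_types, lifting) card.empty)
  then obtain m where m: "m \<in> {1..n}" "\<Sigma> m j = a" "\<Sigma> i m = c"
    by blast
  have "?L a j = m" "?L c m = i"
    using latin_conjugate_eq_iff(2)[OF latin] m i a c j by blast+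
  then show "?L a (?L c j) = ?L c (?L a j)"
    by (simp add: i_def k_def)
qed

text \<open>Common to both forward directions, which differ only in how they obtain
  \<open>eig\<close>. The implication at the end is stated here because it must concern the same
  \<open>\<Sigma>\<close>.\<close>

lemma latin_square_if_eigenvectors:
  fixes \<pi> :: "'s \<Rightarrow> 'h \<Rightarrow> 'h"
  assumes dim: "\<exists>B :: 'h set. finite B \<and> card B = n \<and> cvec.independent B \<and> cvec.span B = UNIV"
    and rep: "associated_rep n As v \<xi> \<pi>"
    and eig: "\<And>i j k l. \<lbrakk>i \<in> {1..n}; j \<in> {1..n}; k \<in> {1..n}; l \<in> {1..n}\<rbrakk>
      \<Longrightarrow> \<exists>c. orth_proj (cvec.span {\<xi> i j}) (\<xi> k l) = c *\<^sub>C \<xi> k l"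
  shows "\<exists>\<Sigma>. latin_square n \<Sigma> \<and> comes_from n As v \<pi> \<Sigma> \<and>
    (cocommutative n A u \<longrightarrow> abelian_latin_square n \<Sigma>)"
proof -
  have "\<exists>\<Sigma> b. latin_square n \<Sigma> \<and> orthogonal_basis n b \<and>
      (\<forall>i\<in>{1..n}. \<forall>j\<in>{1..n}. \<exists>c. c \<noteq> 0 \<and> \<xi> i j = c *\<^sub>C b (\<Sigma> i j))"
  proof (cases "n = 0")
    \<comment> \<open>There is no first row to serve as a basis; the dimension hypothesis makes the
      space zero, so that the empty family spans it.\<close>
    case True
    then have "cvec.span {} = (UNIV :: 'h set)"
      using dim by auto
    then have "orthogonal_basis n (\<lambda>_. 0 :: 'h)"
      using True unfolding orthogonal_basis_def by (simp add: cvec.independent_empty)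
    moreover have "latin_square n (\<lambda>_ _. 0)"
      using True by (simp add: latin_square_def)
    ultimately show ?thesis
      using True by fastforce
  next
    case False
    then have "orthogonal_basis n (\<xi> 1)"
      using magic_basis_row[of 1] by simp
    then show ?thesis
      using latin_square_of_eigenvectors[OF magic False eig] by blast
  qed
  then obtain \<Sigma> b where S: "latin_square n \<Sigma>" "orthogonal_basis n b"
    "\<And>i j. \<lbrakk>i \<in> {1..n}; j \<in> {1..n}\<rbrakk> \<Longrightarrow> \<exists>c. c \<noteq> 0 \<and> \<xi> i j = c *\<^sub>C b (\<Sigma> i j)"
    by blast
  show ?thesis
    using S(1) comes_from_proportional[OF rep S(2,1,3)] cocommutative_abelian_latin_square[OF _ S]
    by blast
qed

end

section \<open>Function algebras of finite sets\<close>

text \<open>Extension by zero outside \<open>I\<close> makes equality of elements plain equality of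
  functions, and for \<open>I\<close> a set of natural numbers the type is
  \<open>universe cstar\<close>. The \<open>insert 0\<close> gives the zero algebra on the empty set
  a norm.\<close>

definition fun_alg :: "'i set \<Rightarrow> ('i \<Rightarrow> complex) cstar" where
  "fun_alg I = \<lparr>carrier = {f. \<forall>i. i \<notin> I \<longrightarrow> f i = 0}, monoid.mult = (\<lambda>f g i. f i * g i),
     one = (\<lambda>i. of_bool (i \<in> I)), zero = (\<lambda>i. 0), add = (\<lambda>f g i. f i + g i),
     smult = (\<lambda>c f i. c * f i), star = (\<lambda>f i. cnj (f i)),
     cnorm = (\<lambda>f. Max (insert 0 ((\<lambda>i. cmod (f i)) ` I)))\<rparr>"

lemma fun_alg_simps [simp]:
  "f \<in> carrier (fun_alg I) \<longleftrightarrow> (\<forall>i. i \<notin> I \<longrightarrow> f i = 0)"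
  "f \<otimes>\<^bsub>fun_alg I\<^esub> g = (\<lambda>i. f i * g i)"
  "\<one>\<^bsub>fun_alg I\<^esub> = (\<lambda>i. of_bool (i \<in> I))"
  "\<zero>\<^bsub>fun_alg I\<^esub> = (\<lambda>i. 0)"
  "f \<oplus>\<^bsub>fun_alg I\<^esub> g = (\<lambda>i. f i + g i)"
  "c \<odot>\<^bsub>fun_alg I\<^esub> f = (\<lambda>i. c * f i)"
  "star (fun_alg I) f = (\<lambda>i. cnj (f i))"
  by (simp_all add: fun_alg_def)

lemma commutative_fun_alg: "commutative (fun_alg I)"
  by (simp add: commutative_def mult.commute)

lemma star_algebra_fun_alg: "star_algebra (fun_alg I)"
proof -
  have grp: "abelian_group (fun_alg I)"
  proof (rule abelian_groupI)
    fix f assume "f \<in> carrier (fun_alg I)"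
    then show "\<exists>g\<in>carrier (fun_alg I). g \<oplus>\<^bsub>fun_alg I\<^esub> f = \<zero>\<^bsub>fun_alg I\<^esub>"
      by (intro bexI[of _ "\<lambda>i. - f i"]) auto
  qed (auto simp: algebra_simps)
  have ring: "ring (fun_alg I)"
    by (rule ringI[OF grp]) (auto intro!: monoidI simp: algebra_simps fun_eq_iff)
  have "Module.module complex_cstar (fun_alg I)"
    by (rule moduleI[OF cring_complex_cstar grp]) (auto simp: algebra_simps)
  then show ?thesis
    by (intro star_algebra.intro ring star_algebra_axioms.intro) (auto simp: algebra_simps)
qed

lemma finsum_fun_alg:
  assumes "finite K" "\<And>k. k \<in> K \<Longrightarrow> f k \<in> carrier (fun_alg I)"
  shows "(\<Oplus>\<^bsub>fun_alg I\<^esub>k\<in>K. f k) = (\<lambda>i. \<Sum>k\<in>K. f k i)"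
  using assms
proof (induction K rule: finite_induct)
  case (insert k K)
  interpret star_algebra "fun_alg I"
    by (rule star_algebra_fun_alg)
  have "(\<Oplus>\<^bsub>fun_alg I\<^esub>k\<in>insert k K. f k) = f k \<oplus>\<^bsub>fun_alg I\<^esub> (\<Oplus>\<^bsub>fun_alg I\<^esub>k\<in>K. f k)"
    using insert by (intro finsum_insert) auto
  then show ?case
    using insert by simp
next
  case empty
  interpret star_algebra "fun_alg I"
    by (rule star_algebra_fun_alg)
  show ?case
    by simp
qed

lemma cnorm_fun_alg_le_iff:
  "finite I \<Longrightarrow> cnorm (fun_alg I) f \<le> c \<longleftrightarrow> 0 \<le> c \<and> (\<forall>i\<in>I. cmod (f i) \<le> c)"
  by (auto simp: fun_alg_def)

lemma
  assumes "finite I"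
  shows cnorm_fun_alg_nonneg: "0 \<le> cnorm (fun_alg I) f"
    and cmod_le_cnorm_fun_alg: "i \<in> I \<Longrightarrow> cmod (f i) \<le> cnorm (fun_alg I) f"
  using cnorm_fun_alg_le_iff[OF assms, of f "cnorm (fun_alg I) f"] by auto

lemma cstar_seminorm_fun_alg:
  assumes fin: "finite I"
  shows "cstar_seminorm (fun_alg I) (cnorm (fun_alg I))"
proof -
  let ?N = "cnorm (fun_alg I)"
  note le = cnorm_fun_alg_le_iff[OF fin] and ge0 = cnorm_fun_alg_nonneg[OF fin]
    and ge = cmod_le_cnorm_fun_alg[OF fin]
  have add: "?N (\<lambda>i. f i + g i) \<le> ?N f + ?N g" for f g
    unfolding le
  proof (intro conjI ballI)
    show "cmod (f i + g i) \<le> ?N f + ?N g" if "i \<in> I" for i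
      using norm_triangle_ineq[of "f i" "g i"] ge[OF that, of f] ge[OF that, of g] by linarith
  qed (use ge0 in simp)
  have mult: "?N (\<lambda>i. f i * g i) \<le> ?N f * ?N g" for f g
    using ge0 ge by (auto simp: le norm_mult intro: mult_mono)
  have smult_le: "?N (\<lambda>i. c * f i) \<le> cmod c * ?N f" for c f
    using ge0 ge by (auto simp: le norm_mult intro: mult_left_mono)
  have smult: "?N (\<lambda>i. c * f i) = cmod c * ?N f" for c f
  proof (cases "c = 0")
    case True
    then have "?N (\<lambda>i. c * f i) \<le> 0"
      by (simp add: le)
    then show ?thesis
      using True ge0[of "\<lambda>i. c * f i"] by simp
  next
    case False
    \<comment> \<open>The reverse inequality is \<open>smult_le\<close> for the scalar
      \<open>inverse c\<close>.\<close>
    have "?N (\<lambda>i. inverse c * (c * f i)) \<le> cmod (inverse c) * ?N (\<lambda>i. c * f i)"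
      by (rule smult_le)
    then have "cmod c * ?N f \<le> ?N (\<lambda>i. c * f i)"
      using False by (simp add: norm_divide norm_inverse field_simps)
    then show ?thesis
      using smult_le[of c f] by simp
  qed
  have star: "?N (\<lambda>i. cnj (f i) * f i) = (?N f)\<^sup>2" for f
  proof (rule order_antisym)
    show "?N (\<lambda>i. cnj (f i) * f i) \<le> (?N f)\<^sup>2"
      using ge0 ge by (auto simp: le norm_mult power2_eq_square intro: mult_mono)
    have "?N f \<le> sqrt (?N (\<lambda>i. cnj (f i) * f i))"
      unfolding le
    proof (intro conjI ballI)
      fix i assume "i \<in> I"
      then have "(cmod (f i))\<^sup>2 \<le> ?N (\<lambda>i. cnj (f i) * f i)"
        using ge[of i "\<lambda>i. cnj (f i) * f i"] by (simp add: norm_mult power2_eq_square)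
      then show "cmod (f i) \<le> sqrt (?N (\<lambda>i. cnj (f i) * f i))"
        by (simp add: real_le_rsqrt)
    qed (use ge0 in simp)
    then show "(?N f)\<^sup>2 \<le> ?N (\<lambda>i. cnj (f i) * f i)"
      using ge0[of f] ge0[of "\<lambda>i. cnj (f i) * f i"] by (metis power_mono real_sqrt_pow2)
  qed
  show ?thesis
    unfolding cstar_seminorm_def using ge0 add mult smult star by simp
qed

lemma cstar_algebra_fun_alg:
  fixes I :: "'i set"
  assumes fin: "finite I"
  shows "cstar_algebra (fun_alg I)"
proof -
  interpret star_algebra "fun_alg I"
    by (rule star_algebra_fun_alg)
  let ?N = "cnorm (fun_alg I)"
  have minus: "x \<ominus>\<^bsub>fun_alg I\<^esub> y = (\<lambda>i. x i - y i)"
    if "x \<in> carrier (fun_alg I)" "y \<in> carrier (fun_alg I)" for x y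
    using that by (subst a_minus_eq_smult) auto
  show ?thesis
  proof (intro cstar_algebra.intro cstar_algebra_axioms.intro star_algebra_axioms
      cstar_seminorm_fun_alg fin)
    fix x assume x: "x \<in> carrier (fun_alg I)" "?N x = 0"
    show "x = \<zero>\<^bsub>fun_alg I\<^esub>"
      using x cmod_le_cnorm_fun_alg[OF fin, of _ x] by (fastforce simp: fun_eq_iff)
  next
    fix X :: "nat \<Rightarrow> 'i \<Rightarrow> complex"
    assume X: "\<And>k. X k \<in> carrier (fun_alg I)"
      and cauchy: "\<And>e. 0 < e \<Longrightarrow> \<exists>N. \<forall>k\<ge>N. \<forall>l\<ge>N. ?N (X k \<ominus>\<^bsub>fun_alg I\<^esub> X l) < e"
    have conv: "convergent (\<lambda>k. X k i)" if i: "i \<in> I" for i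
    proof -
      have "Cauchy (\<lambda>k. X k i)"
      proof (rule CauchyI)
        fix e :: real assume "0 < e"
        then obtain N where N: "\<And>k l. k \<ge> N \<Longrightarrow> l \<ge> N \<Longrightarrow> ?N (X k \<ominus>\<^bsub>fun_alg I\<^esub> X l) < e"
          using cauchy by blast
        have "cmod (X k i - X l i) < e" if kl: "k \<ge> N" "l \<ge> N" for k l
          using cmod_le_cnorm_fun_alg[OF fin i, of "\<lambda>i. X k i - X l i"] N[OF kl]
          unfolding minus[OF X X] by linarith
        then show "\<exists>M. \<forall>m\<ge>M. \<forall>n\<ge>M. cmod (X m i - X n i) < e"
          by blast
      qed
      then show ?thesis
        by (rule Cauchy_convergent)
    qed
    define x where "x i = (if i \<in> I then lim (\<lambda>k. X k i) else 0)" for i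
    have x: "x \<in> carrier (fun_alg I)"
      by (simp add: x_def)
    have lim: "(\<lambda>k. X k i) \<longlonglongrightarrow> x i" if "i \<in> I" for i
      using conv[OF that] that by (simp add: x_def convergent_LIMSEQ_iff)
    \<comment> \<open>Finiteness of \<open>I\<close> makes pointwise convergence uniform. The values
      are brought below \<open>e / 2\<close> because the resulting bound on the norm is not
      strict.\<close>
    have "(\<lambda>k. ?N (X k \<ominus>\<^bsub>fun_alg I\<^esub> x)) \<longlonglongrightarrow> 0"
    proof (rule tendstoI)
      fix e :: real assume "0 < e"
      then have e2: "0 < e / 2"
        by simp
      have "\<forall>\<^sub>F k in sequentially. \<forall>i\<in>I. dist (X k i) (x i) < e / 2"
        using lim e2 by (intro eventually_ball_finite fin ballI tendstoD)
      then show "\<forall>\<^sub>F k in sequentially. dist (?N (X k \<ominus>\<^bsub>fun_alg I\<^esub> x)) 0 < e"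
      proof eventually_elim
        case (elim k)
        have "?N (\<lambda>i. X k i - x i) \<le> e / 2"
          unfolding cnorm_fun_alg_le_iff[OF fin] using elim e2 by (auto simp: dist_norm)
        then show ?case
          using \<open>0 < e\<close> cnorm_fun_alg_nonneg[OF fin, of "\<lambda>i. X k i - x i"]
          unfolding minus[OF X x] by (simp add: dist_norm)
      qed
    qed
    then show "\<exists>x\<in>carrier (fun_alg I). (\<lambda>k. ?N (X k \<ominus>\<^bsub>fun_alg I\<^esub> x)) \<longlonglongrightarrow> 0"
      using x by blast
  qed
qed

definition delta :: "'i \<Rightarrow> 'i \<Rightarrow> complex" where
  "delta s = (\<lambda>i. of_bool (i = s))"

lemma delta_closed: "s \<in> I \<Longrightarrow> delta s \<in> carrier (fun_alg I)"
  by (auto simp: delta_def)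

lemma fun_alg_expansion:
  assumes "finite I" "f \<in> carrier (fun_alg I)"
  shows "f = (\<Oplus>\<^bsub>fun_alg I\<^esub>s\<in>I. f s \<odot>\<^bsub>fun_alg I\<^esub> delta s)"
proof -
  have "(\<Oplus>\<^bsub>fun_alg I\<^esub>s\<in>I. f s \<odot>\<^bsub>fun_alg I\<^esub> delta s) = (\<lambda>i. \<Sum>s\<in>I. f s * delta s i)"
    by (subst finsum_fun_alg) (use assms in \<open>auto simp: delta_def\<close>)
  also have "\<dots> = f"
  proof
    fix i
    have "(\<Sum>s\<in>I. f s * delta s i) = (\<Sum>s\<in>I. if i = s then f i else 0)"
      by (intro sum.cong) (auto simp: delta_def)
    then show "(\<Sum>s\<in>I. f s * delta s i) = f i"
      using assms by auto
  qed
  finally show ?thesis ..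
qed

lemma additive_finsum:
  fixes g :: "'a \<Rightarrow> complex"
  assumes "star_algebra A" and add: "\<And>x y. \<lbrakk>x \<in> carrier A; y \<in> carrier A\<rbrakk> \<Longrightarrow> g (x \<oplus>\<^bsub>A\<^esub> y) = g x + g y"
    and fin: "finite K" and x: "\<And>k. k \<in> K \<Longrightarrow> x k \<in> carrier A"
  shows "g (\<Oplus>\<^bsub>A\<^esub>k\<in>K. x k) = (\<Sum>k\<in>K. g (x k))"
proof -
  interpret star_algebra A by fact
  show ?thesis
    using fin x
  proof (induction K rule: finite_induct)
    case empty
    then show ?case
      using add[OF zero_closed zero_closed] by simp
  next
    case (insert k K)
    then have K: "x \<in> K \<rightarrow> carrier A" "x k \<in> carrier A"
      by auto
    have "g (\<Oplus>\<^bsub>A\<^esub>k\<in>insert k K. x k) = g (x k \<oplus>\<^bsub>A\<^esub> (\<Oplus>\<^bsub>A\<^esub>k\<in>K. x k))"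
      using insert.hyps K by (subst finsum_insert) auto
    also have "\<dots> = g (x k) + g (\<Oplus>\<^bsub>A\<^esub>k\<in>K. x k)"
      using K finsum_closed[OF K(1)] by (simp add: add)
    finally show ?case
      using insert by simp
  qed
qed

lemma linear_functional_finsum:
  fixes g :: "'a \<Rightarrow> complex"
  assumes "star_algebra A" and add: "\<And>x y. \<lbrakk>x \<in> carrier A; y \<in> carrier A\<rbrakk> \<Longrightarrow> g (x \<oplus>\<^bsub>A\<^esub> y) = g x + g y"
    and smult: "\<And>c x. x \<in> carrier A \<Longrightarrow> g (c \<odot>\<^bsub>A\<^esub> x) = c * g x"
    and fin: "finite K" and x: "\<And>k. k \<in> K \<Longrightarrow> x k \<in> carrier A"
  shows "g (\<Oplus>\<^bsub>A\<^esub>k\<in>K. c k \<odot>\<^bsub>A\<^esub> x k) = (\<Sum>k\<in>K. c k * g (x k))"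
proof -
  interpret star_algebra A by fact
  have "g (\<Oplus>\<^bsub>A\<^esub>k\<in>K. c k \<odot>\<^bsub>A\<^esub> x k) = (\<Sum>k\<in>K. g (c k \<odot>\<^bsub>A\<^esub> x k))"
    using x by (intro additive_finsum star_algebra_axioms add fin) auto
  then show ?thesis
    using x by (simp add: smult)
qed

lemma cstar_seminorm_finsum_le:
  assumes "star_algebra A" and p: "cstar_seminorm A p"
    and fin: "finite K" and x: "\<And>k. k \<in> K \<Longrightarrow> x k \<in> carrier A"
  shows "p (\<Oplus>\<^bsub>A\<^esub>k\<in>K. c k \<odot>\<^bsub>A\<^esub> x k) \<le> (\<Sum>k\<in>K. cmod (c k) * p (x k))"
proof -
  interpret star_algebra A by fact
  have add: "p (y \<oplus>\<^bsub>A\<^esub> z) \<le> p y + p z" if "y \<in> carrier A" "z \<in> carrier A" for y z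
    using p that unfolding cstar_seminorm_def by blast
  have smult: "p (d \<odot>\<^bsub>A\<^esub> y) = cmod d * p y" if "y \<in> carrier A" for y d
    using p that unfolding cstar_seminorm_def by blast
  show ?thesis
    using fin x
  proof (induction K rule: finite_induct)
    case empty
    then show ?case
      using smult[OF zero_closed, of 0] by simp
  next
    case (insert k K)
    then have K: "(\<lambda>k. c k \<odot>\<^bsub>A\<^esub> x k) \<in> K \<rightarrow> carrier A" "x k \<in> carrier A"
      by auto
    have "p (\<Oplus>\<^bsub>A\<^esub>k\<in>insert k K. c k \<odot>\<^bsub>A\<^esub> x k) = p (c k \<odot>\<^bsub>A\<^esub> x k \<oplus>\<^bsub>A\<^esub> (\<Oplus>\<^bsub>A\<^esub>k\<in>K. c k \<odot>\<^bsub>A\<^esub> x k))"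
      using insert.hyps K by (subst finsum_insert) auto
    also have "\<dots> \<le> cmod (c k) * p (x k) + p (\<Oplus>\<^bsub>A\<^esub>k\<in>K. c k \<odot>\<^bsub>A\<^esub> x k)"
      using add[of "c k \<odot>\<^bsub>A\<^esub> x k" "\<Oplus>\<^bsub>A\<^esub>k\<in>K. c k \<odot>\<^bsub>A\<^esub> x k"] K finsum_closed[OF K(1)] by (simp add: smult)
    finally show ?case
      using insert by simp
  qed
qed

text \<open>Expanding in point masses bounds any C*-seminorm \<open>p\<close> by the sum of the
  \<open>p (delta s)\<close> times the supremum norm, and
  \<open>cstar_seminorm_le_if_le_const\<close> lowers this constant to 1.\<close>

lemma enveloping_fun_alg:
  assumes fin: "finite I"
  shows "enveloping (fun_alg I) (carrier (fun_alg I))"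
  unfolding enveloping_def
proof (intro conjI allI impI ballI)
  interpret cstar_algebra "fun_alg I"
    by (rule cstar_algebra_fun_alg[OF fin])
  have "x \<ominus>\<^bsub>fun_alg I\<^esub> x = \<zero>\<^bsub>fun_alg I\<^esub>" if "x \<in> carrier (fun_alg I)" for x
    using minus_self_iff[OF that that] by simp
  then show "dense_in (fun_alg I) (carrier (fun_alg I))"
    unfolding dense_in_def using norm_zero by (metis order_refl)
  fix p x
  assume "cstar_seminorm (fun_alg I\<lparr>carrier := carrier (fun_alg I)\<rparr>) p" and x: "x \<in> carrier (fun_alg I)"
  then have p: "cstar_seminorm (fun_alg I) p"
    by simp
  have p0: "0 \<le> p (delta s)" if "s \<in> I" for s
    using p delta_closed[OF that] unfolding cstar_seminorm_def by blast
  have "p y \<le> (\<Sum>s\<in>I. p (delta s)) * cnorm (fun_alg I) y" if y: "y \<in> carrier (fun_alg I)" for y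
  proof -
    have "p y = p (\<Oplus>\<^bsub>fun_alg I\<^esub>s\<in>I. y s \<odot>\<^bsub>fun_alg I\<^esub> delta s)"
      using fun_alg_expansion[OF fin y] by simp
    also have "\<dots> \<le> (\<Sum>s\<in>I. cmod (y s) * p (delta s))"
      using cstar_seminorm_finsum_le[OF star_algebra_axioms p fin delta_closed] .
    also have "\<dots> \<le> (\<Sum>s\<in>I. cnorm (fun_alg I) y * p (delta s))"
      by (intro sum_mono mult_right_mono cmod_le_cnorm_fun_alg fin p0)
    finally show ?thesis
      by (simp add: sum_distrib_left mult.commute)
  qed
  then show "p x \<le> cnorm (fun_alg I) x"
    using cstar_seminorm_le_if_le_const[OF star_algebra_axioms p cstar_seminorm_fun_alg[OF fin] _ x]
    by blast
qed

text \<open>Comultiplication and antipode of the functions on a group are of this kind, with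
  multiplication and inversion for \<open>h\<close>.\<close>

lemma star_hom_pullback:
  assumes "\<And>j. j \<in> J \<Longrightarrow> h j \<in> I"
  shows "star_hom (fun_alg I) (fun_alg J) (\<lambda>f j. if j \<in> J then f (h j) else 0)"
  using assms by (auto simp: star_hom_def ring_hom_def fun_eq_iff)

lemma star_hom_eval: "s \<in> I \<Longrightarrow> star_hom (fun_alg I) complex_cstar (\<lambda>f. f s)"
  by (auto simp: star_hom_def ring_hom_def)

lemma star_hom_opposite:
  assumes "commutative B" "star_hom A B f"
  shows "star_hom A (opposite B) f"
  using assms by (auto simp: star_hom_def ring_hom_def opposite_def commutative_def Pi_def)

text \<open>Pairs are coded by natural numbers so that the tensor product of two function algebras
  over \<open>nat\<close> is again one, and so has type \<open>universe cstar\<close>.\<close>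

definition fun_tensor :: "(nat \<Rightarrow> complex) \<Rightarrow> (nat \<Rightarrow> complex) \<Rightarrow> nat \<Rightarrow> complex" where
  "fun_tensor f g m = f (fst (prod_decode m)) * g (snd (prod_decode m))"

text \<open>The axioms with content are \<open>tens_zero\<close>, settled by expanding both
  arguments of \<open>\<beta>\<close> in point masses, and \<open>tens_enveloping\<close>, which
  reduces to \<open>enveloping_fun_alg\<close> because finite sums of tensors already exhaust the
  functions on the product.\<close>

lemma tensor_product_fun_alg:
  assumes I: "finite I" and J: "finite J"
  shows "tensor_product (fun_alg I) (fun_alg J) (fun_alg (prod_encode ` (I \<times> J))) fun_tensor"
proof -
  let ?IJ = "prod_encode ` (I \<times> J)"
  let ?A = "fun_alg I" and ?B = "fun_alg J" and ?T = "fun_alg ?IJ"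
  have mem: "m \<in> ?IJ \<longleftrightarrow> fst (prod_decode m) \<in> I \<and> snd (prod_decode m) \<in> J" for m
  proof -
    have "m \<in> ?IJ \<longleftrightarrow> prod_encode (prod_decode m) \<in> ?IJ"
      by simp
    also have "\<dots> \<longleftrightarrow> prod_decode m \<in> I \<times> J"
      by (rule inj_image_mem_iff[OF inj_prod_encode])
    finally show ?thesis
      by (simp add: mem_Times_iff)
  qed
  have fin: "finite ?IJ"
    using I J by simp
  interpret A: cstar_algebra ?A
    by (rule cstar_algebra_fun_alg[OF I])
  interpret B: cstar_algebra ?B
    by (rule cstar_algebra_fun_alg[OF J])
  interpret T: cstar_algebra ?T
    by (rule cstar_algebra_fun_alg[OF fin])
  have closed: "fun_tensor x y \<in> carrier ?T" if "x \<in> carrier ?A" "y \<in> carrier ?B" for x y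
    using that by (auto simp: mem fun_tensor_def)
  have zero: "(\<Sum>i<m. \<beta> (x i) (y i)) = 0"
    if x: "\<And>i. i < m \<Longrightarrow> x i \<in> carrier ?A" and y: "\<And>i. i < m \<Longrightarrow> y i \<in> carrier ?B"
      and z: "(\<Oplus>\<^bsub>?T\<^esub>i\<in>{..<m}. fun_tensor (x i) (y i)) = \<zero>\<^bsub>?T\<^esub>" and \<beta>: "bilinear_form ?A ?B \<beta>"
    for m :: nat and x y \<beta>
  proof -
    have expand: "\<beta> (x i) (y i) = (\<Sum>s\<in>I. \<Sum>t\<in>J. x i s * y i t * \<beta> (delta s) (delta t))" if i: "i < m" for i
    proof -
      have "\<beta> (x i) (y i) = \<beta> (\<Oplus>\<^bsub>?A\<^esub>s\<in>I. x i s \<odot>\<^bsub>?A\<^esub> delta s) (y i)"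
        using fun_alg_expansion[OF I x[OF i]] by simp
      also have "\<dots> = (\<Sum>s\<in>I. x i s * \<beta> (delta s) (y i))"
        using \<beta> y[OF i] unfolding bilinear_form_def
        by (intro linear_functional_finsum[OF A.star_algebra_axioms, of "\<lambda>x. \<beta> x (y i)"] I delta_closed) blast+
      also have "\<dots> = (\<Sum>s\<in>I. x i s * (\<Sum>t\<in>J. y i t * \<beta> (delta s) (delta t)))"
      proof (intro sum.cong refl arg_cong2[of _ _ _ _ "(*)"])
        fix s assume s: "s \<in> I"
        have "\<beta> (delta s) (y i) = \<beta> (delta s) (\<Oplus>\<^bsub>?B\<^esub>t\<in>J. y i t \<odot>\<^bsub>?B\<^esub> delta t)"
          using fun_alg_expansion[OF J y[OF i]] by simp
        also have "\<dots> = (\<Sum>t\<in>J. y i t * \<beta> (delta s) (delta t))"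
          using \<beta> delta_closed[OF s] unfolding bilinear_form_def
          by (intro linear_functional_finsum[OF B.star_algebra_axioms, of "\<beta> (delta s)"] J delta_closed) blast+
        finally show "\<beta> (delta s) (y i) = (\<Sum>t\<in>J. y i t * \<beta> (delta s) (delta t))" .
      qed
      finally show ?thesis
        by (simp add: sum_distrib_left mult.assoc)
    qed
    \<comment> \<open>This is the coefficient of \<open>\<beta> (delta s) (delta t)\<close>; it
      vanishes as the value of the zero tensor at the code of \<open>(s, t)\<close>.\<close>
    have coeff: "(\<Sum>i<m. x i s * y i t) = 0" for s t
    proof -
      have "(\<Oplus>\<^bsub>?T\<^esub>i\<in>{..<m}. fun_tensor (x i) (y i)) = (\<lambda>k. \<Sum>i<m. fun_tensor (x i) (y i) k)"
        by (rule finsum_fun_alg) (use x y closed in auto)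
      then have "(\<Sum>i<m. fun_tensor (x i) (y i) (prod_encode (s, t))) = 0"
        using z by (simp add: fun_eq_iff)
      then show ?thesis
        by (simp add: fun_tensor_def)
    qed
    have "(\<Sum>i<m. \<beta> (x i) (y i)) = (\<Sum>i<m. \<Sum>s\<in>I. \<Sum>t\<in>J. x i s * y i t * \<beta> (delta s) (delta t))"
      using expand by simp
    also have "\<dots> = (\<Sum>s\<in>I. \<Sum>i<m. \<Sum>t\<in>J. x i s * y i t * \<beta> (delta s) (delta t))"
      by (rule sum.swap)
    also have "\<dots> = (\<Sum>s\<in>I. \<Sum>t\<in>J. \<Sum>i<m. x i s * y i t * \<beta> (delta s) (delta t))"
      by (intro sum.cong refl sum.swap)
    also have "\<dots> = 0"
      by (simp add: sum_distrib_right[symmetric] coeff)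
    finally show ?thesis .
  qed
  have "alg_tensor ?A ?B ?T fun_tensor = carrier ?T"
  proof
    show "alg_tensor ?A ?B ?T fun_tensor \<subseteq> carrier ?T"
      unfolding alg_tensor_def using closed by (auto intro!: T.finsum_closed simp del: fun_alg_simps)
    show "carrier ?T \<subseteq> alg_tensor ?A ?B ?T fun_tensor"
    proof
      fix f assume f: "f \<in> carrier ?T"
      obtain h where "bij_betw h {0..<card (I \<times> J)} (I \<times> J)"
        using ex_bij_betw_nat_finite[of "I \<times> J"] I J by blast
      then have h: "bij_betw h {..<card (I \<times> J)} (I \<times> J)"
        by (simp add: atLeast0LessThan)
      \<comment> \<open>\<open>f\<close> is written as a sum over the pairs \<open>h i\<close> of
        tensors of point masses, with the value of \<open>f\<close> absorbed into the first
        factor.\<close>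
      define x where "x i = f (prod_encode (h i)) \<odot>\<^bsub>?A\<^esub> delta (fst (h i))" for i
      define y where "y i = delta (snd (h i))" for i
      have hin: "fst (h i) \<in> I" "snd (h i) \<in> J" if "i < card (I \<times> J)" for i
        using bij_betw_apply[OF h, of i] that by (simp_all add: mem_Times_iff)
      have xy: "x i \<in> carrier ?A" "y i \<in> carrier ?B" if "i < card (I \<times> J)" for i
        using hin[OF that] by (auto simp: x_def y_def delta_def)
      have "(\<Oplus>\<^bsub>?T\<^esub>i\<in>{..<card (I \<times> J)}. fun_tensor (x i) (y i))
          = (\<lambda>k. \<Sum>i<card (I \<times> J). fun_tensor (x i) (y i) k)"
        by (rule finsum_fun_alg) (use xy closed in auto)
      also have "\<dots> = (\<lambda>k. \<Sum>q\<in>I \<times> J. f (prod_encode q) * of_bool (prod_decode k = q))"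
        unfolding sum.reindex_bij_betw[OF h, symmetric]
        by (intro ext sum.cong) (auto simp: x_def y_def fun_tensor_def delta_def prod_eq_iff)
      also have "\<dots> = f"
      proof
        fix k
        have "(\<Sum>q\<in>I \<times> J. f (prod_encode q) * of_bool (prod_decode k = q))
            = (\<Sum>q\<in>I \<times> J. if prod_decode k = q then f (prod_encode (prod_decode k)) else 0)"
          by (intro sum.cong) (auto simp del: prod_decode_inverse)
        also have "\<dots> = f k"
          using f mem[of k] I J by (auto simp: mem_Times_iff)
        finally show "(\<Sum>q\<in>I \<times> J. f (prod_encode q) * of_bool (prod_decode k = q)) = f k" .
      qed
      finally show "f \<in> alg_tensor ?A ?B ?T fun_tensor"
        unfolding alg_tensor_def using xy by blast
    qed
  qed
  then have "enveloping ?T (alg_tensor ?A ?B ?T fun_tensor)"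
    using enveloping_fun_alg[OF fin] by simp
  then show ?thesis
    by (intro tensor_product.intro tensor_product_axioms.intro T.cstar_algebra_axioms closed zero)
      (auto simp: fun_tensor_def algebra_simps fun_eq_iff mem)
qed

section \<open>Minimal projections and permutation groups\<close>

lemma star_hom_comp:
  assumes "star_hom A B f" "star_hom B C g"
  shows "star_hom A C (\<lambda>x. g (f x))"
proof -
  note f = star_homD[OF assms(1)] and g = star_homD[OF assms(2)]
  show ?thesis
    unfolding star_hom_def ring_hom_def by (auto simp: f g)
qed

lemma (in star_algebra) star_gen_finsum:
  assumes X: "X \<subseteq> carrier A" and "finite K" "\<And>k. k \<in> K \<Longrightarrow> f k \<in> star_gen A X"
  shows "(\<Oplus>k\<in>K. f k) \<in> star_gen A X"
  using assms(2,3)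
proof (induction K rule: finite_induct)
  case empty
  show ?case
    using star_gen.smult[OF star_gen.one[of A X], of 0] by simp
next
  case (insert k K)
  then have "f \<in> K \<rightarrow> carrier A" "f k \<in> carrier A"
    using star_gen_closed[OF X] by auto
  then have "(\<Oplus>k\<in>insert k K. f k) = f k \<oplus> (\<Oplus>k\<in>K. f k)"
    using insert.hyps by (intro finsum_insert)
  then show ?case
    using insert by (simp add: star_gen.add)
qed

text \<open>These axioms identify \<open>A\<close> with the functions on \<open>K\<close> in purely
  algebraic terms. They hold for quotients of function algebras and pass to tensor squares; that the
  \<open>e k\<close> sum to 1 is then a consequence of \<open>e_separating\<close>.\<close>

locale minimal_projections = star_algebra A for A (structure) +
  fixes K :: "'k set" and e :: "'k \<Rightarrow> 'a"
  assumes finite_K: "finite K"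
    and e_closed: "k \<in> K \<Longrightarrow> e k \<in> carrier A"
    and e_idem: "k \<in> K \<Longrightarrow> e k \<otimes> e k = e k"
    and e_star: "k \<in> K \<Longrightarrow> star A (e k) = e k"
    and e_nonzero: "k \<in> K \<Longrightarrow> e k \<noteq> \<zero>"
    and e_orthogonal: "\<lbrakk>k \<in> K; l \<in> K; k \<noteq> l\<rbrakk> \<Longrightarrow> e k \<otimes> e l = \<zero>"
    and e_minimal: "\<lbrakk>k \<in> K; x \<in> carrier A\<rbrakk> \<Longrightarrow> \<exists>c. e k \<otimes> x = c \<odot> e k"
    and e_separating: "\<lbrakk>x \<in> carrier A; \<And>k. k \<in> K \<Longrightarrow> e k \<otimes> x = \<zero>\<rbrakk> \<Longrightarrow> x = \<zero>"
begin

definition coord :: "'k \<Rightarrow> 'a \<Rightarrow> complex" where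
  "coord k x = (SOME c. e k \<otimes> x = c \<odot> e k)"

lemma mult_e: "\<lbrakk>k \<in> K; x \<in> carrier A\<rbrakk> \<Longrightarrow> e k \<otimes> x = coord k x \<odot> e k"
  unfolding coord_def by (rule someI_ex[OF e_minimal])

lemma smult_e_cancel:
  assumes k: "k \<in> K" and eq: "c \<odot> e k = d \<odot> e k"
  shows "c = d"
proof (rule ccontr)
  note ek = e_closed[OF k]
  assume "c \<noteq> d"
  have "(c - d) \<odot> e k = c \<odot> e k \<oplus> (- d) \<odot> e k"
    using smult_add_scalar[OF ek, of c "- d"] by simp
  also have "\<dots> = (d + (- d)) \<odot> e k"
    unfolding eq by (rule smult_add_scalar[OF ek, symmetric])
  also have "\<dots> = \<zero>"
    using ek by simp
  finally have "inverse (c - d) \<odot> ((c - d) \<odot> e k) = \<zero>"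
    by simp
  then show False
    using \<open>c \<noteq> d\<close> e_nonzero[OF k] ek by (simp add: smult_smult)
qed

lemma coord_eqI: "\<lbrakk>k \<in> K; x \<in> carrier A; e k \<otimes> x = c \<odot> e k\<rbrakk> \<Longrightarrow> coord k x = c"
  using mult_e smult_e_cancel by metis

lemma star_hom_coord:
  assumes k: "k \<in> K"
  shows "star_hom A complex_cstar (coord k)"
proof -
  note ek = e_closed[OF k]
  \<comment> \<open>Minimality is one-sided. As \<open>e k \<otimes> star A x\<close> is a multiple
    of \<open>e k\<close>, a further factor \<open>e k\<close> may be put on its right, and that
    exposes the adjoint of \<open>e k \<otimes> x\<close>.\<close>
  have "coord k (star A x) = cnj (coord k x)" if x: "x \<in> carrier A" for x
  proof (rule coord_eqI[OF k])
    have "e k \<otimes> star A x = coord k (star A x) \<odot> (e k \<otimes> e k)"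
      using mult_e[OF k, of "star A x"] x e_idem[OF k] by simp
    also have "\<dots> = (e k \<otimes> star A x) \<otimes> e k"
      using mult_e[OF k, of "star A x"] x ek by (simp add: smult_mult_left)
    also have "\<dots> = e k \<otimes> star A (e k \<otimes> x)"
      using x ek e_star[OF k] by (simp add: star_mult m_assoc)
    also have "\<dots> = cnj (coord k x) \<odot> e k"
      using x ek e_star[OF k] e_idem[OF k] by (simp add: mult_e[OF k x] star_smult smult_mult_right)
    finally show "e k \<otimes> star A x = cnj (coord k x) \<odot> e k" .
  qed (use x in simp)
  moreover have "coord k (x \<otimes> y) = coord k x * coord k y" if x: "x \<in> carrier A" and y: "y \<in> carrier A" for x y
  proof (rule coord_eqI[OF k])
    have "e k \<otimes> (x \<otimes> y) = coord k x \<odot> (e k \<otimes> y)"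
      using x y ek by (simp add: m_assoc[symmetric] mult_e[OF k x] smult_mult_left)
    then show "e k \<otimes> (x \<otimes> y) = (coord k x * coord k y) \<odot> e k"
      using y ek by (simp add: mult_e[OF k y] smult_smult)
  qed (use x y in simp)
  moreover have "coord k (x \<oplus> y) = coord k x + coord k y" if "x \<in> carrier A" "y \<in> carrier A" for x y
    using that ek by (intro coord_eqI[OF k]) (auto simp: r_distr mult_e[OF k] smult_add_scalar)
  moreover have "coord k \<one> = 1"
    using ek by (intro coord_eqI[OF k]) auto
  moreover have "coord k (c \<odot> x) = c * coord k x" if "x \<in> carrier A" for x c
    using that ek by (intro coord_eqI[OF k]) (auto simp: smult_mult_right mult_e[OF k] smult_smult)
  ultimately show ?thesis
    by (auto simp: star_hom_def ring_hom_def)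
qed

lemmas coord_simps = star_homD[OF star_hom_coord, simplified]

lemma coord_finsum:
  "\<lbrakk>k \<in> K; finite I; \<And>i. i \<in> I \<Longrightarrow> x i \<in> carrier A\<rbrakk> \<Longrightarrow> coord k (\<Oplus>i\<in>I. x i) = (\<Sum>i\<in>I. coord k (x i))"
  by (intro additive_finsum star_algebra_axioms coord_simps)

lemma eq_if_coord_eq:
  assumes x: "x \<in> carrier A" and y: "y \<in> carrier A" and eq: "\<And>k. k \<in> K \<Longrightarrow> coord k x = coord k y"
  shows "x = y"
proof -
  have "x \<oplus> (- 1) \<odot> y = \<zero>"
  proof (rule e_separating)
    fix k assume k: "k \<in> K"
    show "e k \<otimes> (x \<oplus> (- 1) \<odot> y) = \<zero>"
      using k x y e_closed[OF k] eq[OF k] by (subst mult_e) (auto simp: coord_simps)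
  qed (use x y in simp)
  then show ?thesis
    using minus_self_iff[OF x y] a_minus_eq_smult[OF x y] by simp
qed

definition of_coords :: "('k \<Rightarrow> complex) \<Rightarrow> 'a" where
  "of_coords c = (\<Oplus>l\<in>K. c l \<odot> e l)"

lemma of_coords_closed: "of_coords c \<in> carrier A"
  unfolding of_coords_def using e_closed by (intro finsum_closed) auto

lemma coord_of_coords:
  assumes k: "k \<in> K"
  shows "coord k (of_coords c) = c k"
proof -
  have "coord k (e l) = (if k = l then 1 else 0)" if "l \<in> K" for l
    using k that e_closed e_idem e_orthogonal[OF k that] by (intro coord_eqI) auto
  then have "(\<Sum>l\<in>K. c l * coord k (e l)) = (\<Sum>l\<in>K. if k = l then c l else 0)"
    by (intro sum.cong) auto
  moreover have "coord k (of_coords c) = (\<Sum>l\<in>K. c l * coord k (e l))"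
    unfolding of_coords_def
    using k e_closed by (intro linear_functional_finsum star_algebra_axioms coord_simps finite_K) auto
  ultimately show ?thesis
    using k finite_K by simp
qed

text \<open>Equations in \<open>A\<close> may be checked in each coordinate, and each coordinate is
  a character, so any family of characters of \<open>B\<close> indexed by \<open>K\<close> assembles
  into a homomorphism. The flip is obtained in this way.\<close>

lemma star_hom_of_coords:
  assumes h: "\<And>k. k \<in> K \<Longrightarrow> star_hom B complex_cstar (h k)" and "star_algebra B"
  shows "star_hom B A (\<lambda>x. of_coords (\<lambda>k. h k x))"
proof -
  note h' = star_homD[OF h, simplified]
  interpret B: star_algebra B by fact
  show ?thesis
    unfolding star_hom_def ring_hom_def
    by (auto intro!: eq_if_coord_eq of_coords_closed m_closed one_closed smult_in_carrier star_closed
        scalars.M.a_closed simp: coord_simps of_coords_closed coord_of_coords h')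
qed

end

section \<open>The function algebra of a finite permutation group\<close>

locale enumerated_permutation_group =
  fixes n N :: nat and G :: "(nat \<Rightarrow> nat) set" and g :: "nat \<Rightarrow> nat \<Rightarrow> nat"
  assumes subgroup_G: "subgroup G (sym_group n)" and enum: "bij_betw g {..<N} G"
begin

definition idx :: "(nat \<Rightarrow> nat) \<Rightarrow> nat" where
  "idx p = inv_into {..<N} g p"

text \<open>Functions on \<open>G\<close>, transported along \<open>g\<close> to the indices below
  \<open>N\<close>; this puts them among the algebras over which the minimality clause of
  \<open>hopf_image\<close> quantifies.\<close>

abbreviation algebra_C :: "universe cstar" where
  "algebra_C \<equiv> fun_alg {..<N}"

definition magic_w :: "nat \<Rightarrow> nat \<Rightarrow> nat \<Rightarrow> complex" where
  "magic_w i j = (\<lambda>s. of_bool (s < N \<and> g s j = i))"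

lemma g_in: "s < N \<Longrightarrow> g s \<in> G"
  using bij_betw_apply[OF enum] by simp

lemma idx_less: "p \<in> G \<Longrightarrow> idx p < N"
  using enum inv_into_into[of p g "{..<N}"] unfolding idx_def bij_betw_def by simp

lemma g_idx: "p \<in> G \<Longrightarrow> g (idx p) = p"
  using enum f_inv_into_f[of p g "{..<N}"] unfolding idx_def bij_betw_def by simp

lemma g_inj: "\<lbrakk>s < N; t < N; g s = g t\<rbrakk> \<Longrightarrow> s = t"
  using enum unfolding bij_betw_def inj_on_def by simp

lemma G_permutes: "p \<in> G \<Longrightarrow> p permutes {1..n}"
  using subgroup.subset[OF subgroup_G] by (auto simp: sym_group_carrier)

lemma G_comp: "\<lbrakk>p \<in> G; q \<in> G\<rbrakk> \<Longrightarrow> p \<circ> q \<in> G"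
  using subgroup.m_closed[OF subgroup_G] by (simp add: sym_group_mult)

lemma G_id: "id \<in> G"
  using subgroup.one_closed[OF subgroup_G] by (simp add: sym_group_one)

lemma G_inv: "p \<in> G \<Longrightarrow> inv' p \<in> G"
  using subgroup.m_inv_closed[OF subgroup_G, of p] subgroup.subset[OF subgroup_G] by auto

lemma g_permutes: "s < N \<Longrightarrow> g s permutes {1..n}"
  by (rule G_permutes[OF g_in])

lemma magic_w_closed: "magic_w i j \<in> carrier algebra_C"
  by (simp add: magic_w_def)

lemma magic_unitary_w: "magic_unitary n algebra_C magic_w"
proof -
  have row: "(\<Sum>j\<in>{1..n}. of_bool (s < N \<and> g s j = i)) = (of_bool (s < N) :: complex)"
    if "i \<in> {1..n}" for i s
  proof (cases "s < N")
    case True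
    note p = g_permutes[OF True]
    have "g s j = i \<longleftrightarrow> j = inv' (g s) i" for j
      using permutes_inv_eq[OF p, of i j] by auto
    moreover have "inv' (g s) i \<in> {1..n}"
      using permutes_in_image[OF permutes_inv[OF p]] that by blast
    ultimately show ?thesis
      using True by (simp add: of_bool_def)
  qed simp
  have col: "(\<Sum>j\<in>{1..n}. of_bool (s < N \<and> g s i = j)) = (of_bool (s < N) :: complex)"
    if "i \<in> {1..n}" for i s
  proof (cases "s < N")
    case True
    have "g s i \<in> {1..n}"
      using permutes_in_image[OF g_permutes[OF True]] that by blast
    then show ?thesis
      using True by (simp add: of_bool_def)
  qed simp
  have inj: "j = k" if "s < N" "g s j = g s k" for s j k
    using permutes_inj[OF g_permutes[OF that(1)]] that(2) by (simp add: inj_eq)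
  have "(\<Oplus>\<^bsub>algebra_C\<^esub>j\<in>{1..n}. magic_w i j) = \<one>\<^bsub>algebra_C\<^esub>" if "i \<in> {1..n}" for i
    using row[OF that] by (subst finsum_fun_alg) (auto simp: magic_w_def)
  moreover have "(\<Oplus>\<^bsub>algebra_C\<^esub>j\<in>{1..n}. magic_w j i) = \<one>\<^bsub>algebra_C\<^esub>" if "i \<in> {1..n}" for i
    using col[OF that] by (subst finsum_fun_alg) (auto simp: magic_w_def)
  moreover have "magic_w i j \<otimes>\<^bsub>algebra_C\<^esub> magic_w i j = magic_w i j"
    "star algebra_C (magic_w i j) = magic_w i j" for i j
    by (auto simp: magic_w_def)
  moreover have "magic_w i j \<otimes>\<^bsub>algebra_C\<^esub> magic_w i k = \<zero>\<^bsub>algebra_C\<^esub>"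
    "magic_w j i \<otimes>\<^bsub>algebra_C\<^esub> magic_w k i = \<zero>\<^bsub>algebra_C\<^esub>" if "j \<noteq> k" for i j k
    using that by (auto simp: magic_w_def fun_eq_iff dest: inj)
  ultimately show ?thesis
    unfolding magic_unitary_def using magic_w_closed by blast
qed

text \<open>A permutation is determined by its values, so the point mass at \<open>t\<close> is the
  product over \<open>j\<close> of the generators \<open>magic_w (g t j) j\<close>. The induction
  runs over the set of positions already compared, from the unit upwards.\<close>

lemma star_gen_w: "star_gen algebra_C (entries n magic_w) = carrier algebra_C"
proof
  interpret star_algebra algebra_C
    by (rule star_algebra_fun_alg)
  let ?S = "star_gen algebra_C (entries n magic_w)"
  have entries: "entries n magic_w \<subseteq> carrier algebra_C"
    unfolding entries_def using magic_w_closed by blast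
  then show "?S \<subseteq> carrier algebra_C"
    by (rule star_gen_closed)
  have agree: "(\<lambda>s. of_bool (s < N \<and> (\<forall>j\<in>J. g s j = g t j))) \<in> ?S"
    if t: "t < N" and J: "finite J" "J \<subseteq> {1..n}" for t J
    using J
  proof (induction J rule: finite_induct)
    case empty
    show ?case
      using star_gen.one[of algebra_C "entries n magic_w"] by simp
  next
    case (insert j J)
    have "g t j \<in> {1..n}"
      using permutes_in_image[OF g_permutes[OF t]] insert.prems by blast
    then have "magic_w (g t j) j \<in> ?S"
      using insert.prems by (intro star_gen.incl) (auto simp: entries_def)
    then have "magic_w (g t j) j \<otimes>\<^bsub>algebra_C\<^esub> (\<lambda>s. of_bool (s < N \<and> (\<forall>j\<in>J. g s j = g t j))) \<in> ?S"
      using insert by (intro star_gen.mult) auto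
    moreover have "magic_w (g t j) j \<otimes>\<^bsub>algebra_C\<^esub> (\<lambda>s. of_bool (s < N \<and> (\<forall>j\<in>J. g s j = g t j)))
        = (\<lambda>s. of_bool (s < N \<and> (\<forall>j\<in>insert j J. g s j = g t j)))"
      by (auto simp: magic_w_def fun_eq_iff)
    ultimately show ?case
      by simp
  qed
  have delta: "delta t \<in> ?S" if t: "t < N" for t
  proof -
    have "s = t" if s: "s < N" and eq: "\<forall>j\<in>{1..n}. g s j = g t j" for s
    proof (rule g_inj[OF s t])
      show "g s = g t"
      proof
        fix j
        show "g s j = g t j"
          using eq permutes_not_in[OF g_permutes[OF s]] permutes_not_in[OF g_permutes[OF t]]
          by (cases "j \<in> {1..n}") auto
      qed
    qed
    then have "(\<lambda>s. of_bool (s < N \<and> (\<forall>j\<in>{1..n}. g s j = g t j))) = delta t"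
      using t by (auto simp: delta_def fun_eq_iff)
    then show ?thesis
      using agree[OF t, of "{1..n}"] by simp
  qed
  show "carrier algebra_C \<subseteq> ?S"
  proof
    fix f assume f: "f \<in> carrier algebra_C"
    have "(\<Oplus>\<^bsub>algebra_C\<^esub>s\<in>{..<N}. f s \<odot>\<^bsub>algebra_C\<^esub> delta s) \<in> ?S"
      using delta by (intro star_gen_finsum[OF entries] star_gen.smult) auto
    then show "f \<in> ?S"
      using fun_alg_expansion[OF _ f] by simp
  qed
qed

text \<open>Comultiplication, counit and antipode are dual to product, unit and inverse in
  \<open>G\<close>. On generators: p(q(j)) = i iff q(j) = k and p(k) = i for some k, which is then
  unique; and the inverse of p sends j to i iff p(i) = j.\<close>

lemma quantum_permutation_algebra_w: "quantum_permutation_algebra n algebra_C magic_w"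
proof -
  let ?I = "{..<N}"
  let ?IJ = "prod_encode ` (?I \<times> ?I)"
  \<comment> \<open>The index of the product of the two permutations whose indices are paired in
    \<open>m\<close>.\<close>
  define h where "h m = idx (g (fst (prod_decode m)) \<circ> g (snd (prod_decode m)))" for m
  have h: "h (prod_encode (s, t)) < N" if "s < N" "t < N" for s t
    using that by (simp add: h_def idx_less G_comp g_in)
  have comult: "comultiplication n algebra_C magic_w (fun_alg ?IJ) fun_tensor
      (\<lambda>f m. if m \<in> ?IJ then f (h m) else 0)"
    unfolding comultiplication_def
  proof (intro conjI tensor_product_fun_alg star_hom_pullback ballI)
    show "h m \<in> ?I" if "m \<in> ?IJ" for m
      using that h by auto
    fix i j assume ij: "i \<in> {1..n}" "j \<in> {1..n}"
    have closed: "fun_tensor (magic_w i k) (magic_w k j) \<in> carrier (fun_alg ?IJ)" for k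
    proof -
      interpret tensor_product algebra_C algebra_C "fun_alg ?IJ" fun_tensor
        by (rule tensor_product_fun_alg) auto
      show ?thesis
        by (rule tens_closed[OF magic_w_closed magic_w_closed])
    qed
    have "(\<Oplus>\<^bsub>fun_alg ?IJ\<^esub>k\<in>{1..n}. fun_tensor (magic_w i k) (magic_w k j))
        = (\<lambda>m. \<Sum>k\<in>{1..n}. fun_tensor (magic_w i k) (magic_w k j) m)"
      using closed by (intro finsum_fun_alg) auto
    also have "\<dots> = (\<lambda>m. if m \<in> ?IJ then magic_w i j (h m) else 0)"
    proof
      fix m
      obtain s t where m: "m = prod_encode (s, t)"
        by (metis prod_decode_inverse surj_pair)
      have mem: "m \<in> ?IJ \<longleftrightarrow> s < N \<and> t < N"
        unfolding m by (subst inj_image_mem_iff[OF inj_prod_encode]) auto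
      show "(\<Sum>k\<in>{1..n}. fun_tensor (magic_w i k) (magic_w k j) m) = (if m \<in> ?IJ then magic_w i j (h m) else 0)"
      proof (cases "s < N \<and> t < N")
        case True
        then have st: "s < N" "t < N"
          by auto
        have tj: "g t j \<in> {1..n}"
          using permutes_in_image[OF g_permutes[OF st(2)]] ij by blast
        have "(\<Sum>k\<in>{1..n}. fun_tensor (magic_w i k) (magic_w k j) m)
            = (\<Sum>k\<in>{1..n}. if g t j = k then of_bool (g s k = i) else 0)"
          using st by (intro sum.cong) (auto simp: m fun_tensor_def magic_w_def)
        also have "\<dots> = of_bool (g s (g t j) = i)"
          using tj by simp
        also have "\<dots> = magic_w i j (h m)"
          using st h[OF st] by (simp add: m magic_w_def) (simp add: h_def g_idx G_comp g_in)
        finally show ?thesis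
          using True mem by simp
      next
        case False
        then show ?thesis
          using mem by (auto simp: m fun_tensor_def magic_w_def)
      qed
    qed
    finally show "(\<lambda>m. if m \<in> ?IJ then magic_w i j (h m) else 0)
        = (\<Oplus>\<^bsub>fun_alg ?IJ\<^esub>k\<in>{1..n}. fun_tensor (magic_w i k) (magic_w k j))"
      by (rule sym)
  qed auto
  have counit: "counit n algebra_C magic_w (\<lambda>f. f (idx id))"
    unfolding counit_def using idx_less[OF G_id]
    by (auto intro!: star_hom_eval simp: magic_w_def g_idx[OF G_id])
  have antipode: "antipode n algebra_C magic_w (\<lambda>f s. if s \<in> ?I then f (idx (inv' (g s))) else 0)"
    unfolding antipode_def
  proof (intro conjI ballI star_hom_opposite commutative_fun_alg star_hom_pullback)
    show "idx (inv' (g s)) \<in> ?I" if "s \<in> ?I" for s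
      using that by (simp add: idx_less G_inv g_in)
    fix i j assume "i \<in> {1..n}" "j \<in> {1..n}"
    have "inv' (g s) j = i \<longleftrightarrow> g s i = j" if "s < N" for s
      using permutes_inv_eq[OF g_permutes[OF that]] by blast
    then show "(\<lambda>s. if s \<in> ?I then magic_w i j (idx (inv' (g s))) else 0) = magic_w j i"
      by (auto simp: magic_w_def fun_eq_iff idx_less G_inv g_in g_idx)
  qed
  show ?thesis
    unfolding quantum_permutation_algebra_def star_gen_w
    using cstar_algebra_fun_alg[of ?I] magic_unitary_w enveloping_fun_alg[of ?I] comult counit antipode
    by blast
qed

end

section \<open>Minimal projections in the tensor square, and the flip\<close>

text \<open>A line is closed: if \<open>d m\<close> tends to \<open>x\<close> and
  \<open>e \<otimes> d m = c m \<odot> e\<close>, then dividing by the norm of \<open>e\<close>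
  shows that the scalars \<open>c m\<close> are Cauchy, and their limit serves for \<open>x\<close>.
  In the tensor square minimality is visible only on the dense span of the elementary
  tensors.\<close>

lemma (in cstar_algebra) minimal_on_closure:
  assumes dense: "dense_in A D" and e: "e \<in> carrier A"
    and minimal: "\<And>d. d \<in> D \<Longrightarrow> \<exists>c. e \<otimes> d = c \<odot> e" and x: "x \<in> carrier A"
  shows "\<exists>c. e \<otimes> x = c \<odot> e"
proof (cases "e = \<zero>")
  case True
  then show ?thesis
    using x by (intro exI[of _ 0]) simp
next
  case False
  then have pos: "0 < cnorm A e"
    using cnorm_zero[OF e] norm_ge0[OF e] order_le_less by metis
  define r where "r m = inverse (real (Suc m))" for m
  have "\<exists>d c. d \<in> carrier A \<and> cnorm A (x \<ominus> d) < r m \<and> e \<otimes> d = c \<odot> e" for m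
  proof -
    have "0 < r m"
      by (simp add: r_def)
    then obtain d where "d \<in> D" "cnorm A (x \<ominus> d) < r m"
      using dense x unfolding dense_in_def by blast
    then show ?thesis
      using dense minimal unfolding dense_in_def by blast
  qed
  then obtain d c where dc: "\<And>m. d m \<in> carrier A" "\<And>m. cnorm A (x \<ominus> d m) < r m" "\<And>m. e \<otimes> d m = c m \<odot> e"
    by metis
  have r0: "r \<longlonglongrightarrow> 0"
    unfolding r_def by (rule LIMSEQ_inverse_real_of_nat)
  have mult_minus: "e \<otimes> y \<ominus> e \<otimes> z = e \<otimes> (y \<ominus> z)" if "y \<in> carrier A" "z \<in> carrier A" for y z
    using e that by (simp add: a_minus_eq_smult r_distr smult_mult_right)
  have line: "cnorm A (a \<odot> e \<ominus> b \<odot> e) = cmod (a - b) * cnorm A e" for a b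
    using e smult_add_scalar[OF e, of a "- b"] norm_smult[OF e, of "a - b"]
    by (simp add: a_minus_eq_smult smult_smult)
  have diff: "cmod (c m - c l) \<le> cnorm A (d m \<ominus> d l)" for m l
  proof -
    have "cmod (c m - c l) * cnorm A e = cnorm A (e \<otimes> (d m \<ominus> d l))"
      using dc(1) by (simp add: line[symmetric] dc(3)[symmetric] mult_minus)
    also have "\<dots> \<le> cnorm A e * cnorm A (d m \<ominus> d l)"
      using e dc(1) by (intro norm_mult) auto
    finally show ?thesis
      using pos by (simp add: mult.commute)
  qed
  have "Cauchy c"
  proof (rule CauchyI)
    fix \<epsilon> :: real assume eps: "0 < \<epsilon>"
    obtain M where M: "\<And>m. m \<ge> M \<Longrightarrow> r m < \<epsilon> / 2"
      using order_tendstoD(2)[OF r0, of "\<epsilon> / 2"] eps unfolding eventually_sequentially by auto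
    have "cmod (c m - c l) < \<epsilon>" if "m \<ge> M" "l \<ge> M" for m l
    proof -
      have "cnorm A (d m \<ominus> d l) \<le> cnorm A (d m \<ominus> x) + cnorm A (x \<ominus> d l)"
        using dc(1) x by (intro norm_triangle_minus)
      moreover have "cnorm A (d m \<ominus> x) < r m"
        using dc(2)[of m] norm_minus_commute[OF x dc(1)[of m]] by linarith
      ultimately show ?thesis
        using diff[of m l] dc(2)[of l] M[OF that(1)] M[OF that(2)] by linarith
    qed
    then show "\<exists>M. \<forall>m\<ge>M. \<forall>l\<ge>M. cmod (c m - c l) < \<epsilon>"
      by blast
  qed
  then obtain a where a: "c \<longlonglongrightarrow> a"
    using Cauchy_convergent convergent_def by blast
  have "(\<lambda>m. cnorm A e * r m + cmod (c m - a) * cnorm A e) \<longlonglongrightarrow> 0"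
    using a r0 by (intro tendsto_add_zero tendsto_mult_right_zero tendsto_mult_left_zero)
      (auto simp: tendsto_norm_zero_iff LIM_zero)
  moreover have "cnorm A (e \<otimes> x \<ominus> a \<odot> e) \<le> cnorm A e * r m + cmod (c m - a) * cnorm A e" for m
  proof -
    have "cnorm A (e \<otimes> x \<ominus> a \<odot> e) \<le> cnorm A (e \<otimes> x \<ominus> e \<otimes> d m) + cnorm A (e \<otimes> d m \<ominus> a \<odot> e)"
      using e x dc(1) by (intro norm_triangle_minus) auto
    moreover have "cnorm A (e \<otimes> x \<ominus> e \<otimes> d m) \<le> cnorm A e * cnorm A (x \<ominus> d m)"
      using e x dc(1) by (simp add: mult_minus norm_mult)
    moreover have "cnorm A e * cnorm A (x \<ominus> d m) \<le> cnorm A e * r m"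
      using pos dc(2)[of m] by (intro mult_left_mono) auto
    ultimately show ?thesis
      by (simp add: dc(3) line)
  qed
  ultimately have "cnorm A (e \<otimes> x \<ominus> a \<odot> e) \<le> 0"
    by (intro LIMSEQ_le_const) auto
  then have "cnorm A (e \<otimes> x \<ominus> a \<odot> e) = 0"
    using e x by (intro order_antisym norm_ge0) auto
  then have "e \<otimes> x \<ominus> a \<odot> e = \<zero>"
    using e x by (intro cnorm_zero) auto
  then have "e \<otimes> x = a \<odot> e"
    using e x minus_self_iff by simp
  then show ?thesis
    by blast
qed

lemma (in star_algebra) minimal_finsum:
  assumes e: "e \<in> carrier A" and "finite I" "\<And>i. i \<in> I \<Longrightarrow> x i \<in> carrier A"
    and "\<And>i. i \<in> I \<Longrightarrow> \<exists>c. e \<otimes> x i = c \<odot> e"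
  shows "\<exists>c. e \<otimes> (\<Oplus>i\<in>I. x i) = c \<odot> e"
  using assms(2-)
proof (induction I rule: finite_induct)
  case empty
  then show ?case
    using e by (intro exI[of _ 0]) simp
next
  case (insert i I)
  then have "\<exists>c. e \<otimes> x i = c \<odot> e" "\<exists>d. e \<otimes> (\<Oplus>i\<in>I. x i) = d \<odot> e"
    by auto
  then obtain c d where cd: "e \<otimes> x i = c \<odot> e" "e \<otimes> (\<Oplus>i\<in>I. x i) = d \<odot> e"
    by blast
  have xI: "x \<in> I \<rightarrow> carrier A" "x i \<in> carrier A"
    using insert.prems by auto
  have "(\<Oplus>i\<in>insert i I. x i) = x i \<oplus> (\<Oplus>i\<in>I. x i)"
    using insert.hyps xI by (intro finsum_insert)
  then have "e \<otimes> (\<Oplus>i\<in>insert i I. x i) = (c + d) \<odot> e"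
    using e xI cd by (simp add: r_distr smult_add_scalar finsum_closed)
  then show ?case
    by blast
qed

text \<open>\<open>T\<close> is whatever tensor square a quantum permutation algebra comes with, so
  its structure has to be extracted from the axioms of \<open>tensor_product\<close>.\<close>

locale tensor_square_minimal_projections =
  tensor_product A A T tens + A: minimal_projections A K e
  for A :: "'a cstar" and T :: "'t cstar" and tens and K :: "'k set" and e
begin

definition tens_e :: "'k \<times> 'k \<Rightarrow> 't" where
  "tens_e q = tens (e (fst q)) (e (snd q))"

lemma tens_smult_smult:
  "\<lbrakk>x \<in> carrier A; y \<in> carrier A\<rbrakk> \<Longrightarrow> tens (c \<odot>\<^bsub>A\<^esub> x) (d \<odot>\<^bsub>A\<^esub> y) = (c * d) \<odot>\<^bsub>T\<^esub> tens x y"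
  using tens_smult_left[of x "d \<odot>\<^bsub>A\<^esub> y" c] by (simp add: tens_smult_right tens_closed smult_smult)

lemma tens_e_mult_tens:
  assumes "s \<in> K" "t \<in> K" "x \<in> carrier A" "y \<in> carrier A"
  shows "tens_e (s, t) \<otimes>\<^bsub>T\<^esub> tens x y = (A.coord s x * A.coord t y) \<odot>\<^bsub>T\<^esub> tens_e (s, t)"
  using assms A.e_closed by (simp add: tens_e_def tens_mult A.mult_e tens_smult_smult)

lemma tens_e_closed: "q \<in> K \<times> K \<Longrightarrow> tens_e q \<in> carrier T"
  using A.e_closed by (auto simp: tens_e_def tens_closed)

lemma tens_zero_zero:
  assumes x: "x \<in> carrier A"
  shows "tens \<zero>\<^bsub>A\<^esub> x = \<zero>\<^bsub>T\<^esub>" "tens x \<zero>\<^bsub>A\<^esub> = \<zero>\<^bsub>T\<^esub>"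
  using tens_smult_left[of "\<zero>\<^bsub>A\<^esub>" x 0] tens_smult_right[of x "\<zero>\<^bsub>A\<^esub>" 0] x by (simp_all add: tens_closed)

lemma sum_e: "A.of_coords (\<lambda>_. 1) = \<one>\<^bsub>A\<^esub>"
  by (rule A.eq_if_coord_eq) (auto simp: A.of_coords_closed A.coord_of_coords A.coord_simps)

text \<open>The product of the coordinates \<open>s\<close> and \<open>t\<close> is a bilinear form
  with value 1 at \<open>(e s, e t)\<close>. If the tensor vanished, comparison with the empty sum
  would make this value 0.\<close>

lemma tens_e_nonzero:
  assumes "s \<in> K" "t \<in> K"
  shows "tens_e (s, t) \<noteq> \<zero>\<^bsub>T\<^esub>"
proof
  assume zero: "tens_e (s, t) = \<zero>\<^bsub>T\<^esub>"
  have \<beta>: "bilinear_form A A (\<lambda>x y. A.coord s x * A.coord t y)"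
    using assms unfolding bilinear_form_def by (auto simp: A.coord_simps algebra_simps)
  have "(\<Sum>i\<in>{()}. A.coord s (e s) * A.coord t (e t)) = (\<Sum>i\<in>({} :: unit set). A.coord s (e s) * A.coord t (e t))"
    by (rule bilinear_form_eq[where I = "{()}" and J = "{}" and x = "\<lambda>_. e s" and y = "\<lambda>_. e t"
          and x' = "\<lambda>_. e s" and y' = "\<lambda>_. e t", OF A.star_algebra_axioms _ _ _ _ _ \<beta>])
      (use zero assms A.e_closed in \<open>auto simp: tens_e_def tens_closed\<close>)
  moreover have "A.coord s (e s) = 1" "A.coord t (e t) = 1"
    using assms A.e_closed A.e_idem by (auto intro!: A.coord_eqI)
  ultimately show False
    by simp
qed

text \<open>Applied to one tensor factor at a time; the sum of all \<open>e\<^sub>s\<close> is \<open>1\<close>.\<close>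

lemma separating_step:
  assumes F_closed: "\<And>y. y \<in> carrier A \<Longrightarrow> F y \<in> carrier T"
    and F_add: "\<And>y z. \<lbrakk>y \<in> carrier A; z \<in> carrier A\<rbrakk> \<Longrightarrow> F (y \<oplus>\<^bsub>A\<^esub> z) = F y \<oplus>\<^bsub>T\<^esub> F z"
    and zero: "\<And>s. s \<in> K \<Longrightarrow> F (e s) = \<zero>\<^bsub>T\<^esub>"
  shows "F \<one>\<^bsub>A\<^esub> = \<zero>\<^bsub>T\<^esub>"
proof -
  have "F (\<Oplus>\<^bsub>A\<^esub>s\<in>K. 1 \<odot>\<^bsub>A\<^esub> e s) = (\<Oplus>\<^bsub>T\<^esub>s\<in>K. F (1 \<odot>\<^bsub>A\<^esub> e s))"
    using A.e_closed
    by (intro additive_map_finsum A.star_algebra_axioms star_algebra_axioms F_closed F_add A.finite_K) auto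
  also have "\<dots> = (\<Oplus>\<^bsub>T\<^esub>s\<in>K. \<zero>\<^bsub>T\<^esub>)"
    using A.e_closed zero by (intro finsum_cong') auto
  finally show ?thesis
    using sum_e by (simp add: A.of_coords_def)
qed

text \<open>Minimality is computed on sums of elementary tensors and extended by
  \<open>minimal_on_closure\<close>. An \<open>X\<close> killed by all \<open>tens_e q\<close> is
  killed by \<open>tens (e s) \<one>\<close>, after summing over the second factor, and then by
  \<open>tens \<one> \<one>\<close>, the unit of \<open>T\<close>.\<close>

sublocale TT: minimal_projections T "K \<times> K" tens_e
proof
  show "finite (K \<times> K)"
    using A.finite_K by simp
  fix q assume q: "q \<in> K \<times> K"
  then obtain s t where st: "q = (s, t)" "s \<in> K" "t \<in> K"
    by auto
  show "tens_e q \<in> carrier T"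
    by (rule tens_e_closed[OF q])
  show "tens_e q \<otimes>\<^bsub>T\<^esub> tens_e q = tens_e q"
    using st A.e_closed A.e_idem by (simp add: tens_e_def tens_mult)
  show "star T (tens_e q) = tens_e q"
    using st A.e_closed A.e_star by (simp add: tens_e_def tens_star)
  show "tens_e q \<noteq> \<zero>\<^bsub>T\<^esub>"
    using st tens_e_nonzero by simp
  show "\<exists>c. tens_e q \<otimes>\<^bsub>T\<^esub> X = c \<odot>\<^bsub>T\<^esub> tens_e q" if X: "X \<in> carrier T" for X
  proof (rule minimal_on_closure[OF _ tens_e_closed[OF q] _ X])
    show "dense_in T (alg_tensor A A T tens)"
      using tens_enveloping unfolding enveloping_def by blast
    fix d assume "d \<in> alg_tensor A A T tens"
    then obtain m :: nat and x y where d: "d = (\<Oplus>\<^bsub>T\<^esub>i\<in>{..<m}. tens (x i) (y i))"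
      and xy: "\<forall>i<m. x i \<in> carrier A \<and> y i \<in> carrier A"
      unfolding alg_tensor_def by auto
    show "\<exists>c. tens_e q \<otimes>\<^bsub>T\<^esub> d = c \<odot>\<^bsub>T\<^esub> tens_e q"
      unfolding d using xy tens_e_mult_tens[OF st(2,3)] st(1)
      by (intro minimal_finsum tens_e_closed[OF q]) (auto simp: tens_closed)
  qed
next
  fix p q assume pq: "p \<in> K \<times> K" "q \<in> K \<times> K" "p \<noteq> q"
  then have closed: "e (fst p) \<in> carrier A" "e (snd p) \<in> carrier A" "e (fst q) \<in> carrier A" "e (snd q) \<in> carrier A"
    using A.e_closed by (auto simp: mem_Times_iff)
  have "fst p \<noteq> fst q \<or> snd p \<noteq> snd q"
    using pq(3) by (simp add: prod_eq_iff)
  then have "e (fst p) \<otimes>\<^bsub>A\<^esub> e (fst q) = \<zero>\<^bsub>A\<^esub> \<or> e (snd p) \<otimes>\<^bsub>A\<^esub> e (snd q) = \<zero>\<^bsub>A\<^esub>"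
    using pq A.e_orthogonal by (auto simp: mem_Times_iff)
  then show "tens_e p \<otimes>\<^bsub>T\<^esub> tens_e q = \<zero>\<^bsub>T\<^esub>"
    using closed by (auto simp: tens_e_def tens_mult tens_zero_zero)
next
  fix X assume X: "X \<in> carrier T" and zero: "\<And>q. q \<in> K \<times> K \<Longrightarrow> tens_e q \<otimes>\<^bsub>T\<^esub> X = \<zero>\<^bsub>T\<^esub>"
  have step: "tens (e s) \<one>\<^bsub>A\<^esub> \<otimes>\<^bsub>T\<^esub> X = \<zero>\<^bsub>T\<^esub>" if s: "s \<in> K" for s
  proof (rule separating_step[of "\<lambda>y. tens (e s) y \<otimes>\<^bsub>T\<^esub> X"])
    show "tens (e s) (e t) \<otimes>\<^bsub>T\<^esub> X = \<zero>\<^bsub>T\<^esub>" if "t \<in> K" for t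
      using zero[of "(s, t)"] s that by (simp add: tens_e_def)
  qed (use X A.e_closed[OF s] in \<open>auto simp: tens_closed tens_add_right l_distr\<close>)
  have "tens \<one>\<^bsub>A\<^esub> \<one>\<^bsub>A\<^esub> \<otimes>\<^bsub>T\<^esub> X = \<zero>\<^bsub>T\<^esub>"
    by (rule separating_step[of "\<lambda>y. tens y \<one>\<^bsub>A\<^esub> \<otimes>\<^bsub>T\<^esub> X"])
      (use X step in \<open>auto simp: tens_closed tens_add_left l_distr\<close>)
  then show "X = \<zero>\<^bsub>T\<^esub>"
    using X by (simp add: tens_one)
qed

lemma coord_tens:
  "\<lbrakk>s \<in> K; t \<in> K; x \<in> carrier A; y \<in> carrier A\<rbrakk> \<Longrightarrow> TT.coord (s, t) (tens x y) = A.coord s x * A.coord t y"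
  by (intro TT.coord_eqI tens_e_mult_tens) (auto simp: tens_closed)

text \<open>Defined in coordinates, where the flip is the exchange of the two arguments of a
  function on \<open>K \<times> K\<close>; this describes it on all of \<open>T\<close> at
  once.\<close>

definition flip :: "'t \<Rightarrow> 't" where
  "flip X = TT.of_coords (\<lambda>q. TT.coord (snd q, fst q) X)"

lemma star_hom_flip: "star_hom T T flip"
  unfolding flip_def by (intro TT.star_hom_of_coords TT.star_hom_coord star_algebra_axioms) auto

lemma flip_tens:
  assumes "x \<in> carrier A" "y \<in> carrier A"
  shows "flip (tens x y) = tens y x"
  using assms unfolding flip_def
  by (intro TT.eq_if_coord_eq TT.of_coords_closed) (auto simp: TT.coord_of_coords coord_tens tens_closed)

end

text \<open>\<open>\<psi>\<close> may annihilate point masses; these are left out of the index set,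
  and their terms in the expansion of an element vanish anyway. The second fact says that the
  coordinate of \<open>\<psi> f\<close> at a remaining \<open>s\<close> is
  \<open>f s\<close>.\<close>

lemma minimal_projections_image:
  assumes I: "finite I" and A: "star_algebra A" and \<psi>: "star_hom (fun_alg I) A \<psi>"
    and surj: "\<psi> ` carrier (fun_alg I) = carrier A"
  shows "minimal_projections A {s\<in>I. \<psi> (delta s) \<noteq> \<zero>\<^bsub>A\<^esub>} (\<lambda>s. \<psi> (delta s))"
    and "\<lbrakk>s \<in> I; f \<in> carrier (fun_alg I)\<rbrakk> \<Longrightarrow> \<psi> (delta s) \<otimes>\<^bsub>A\<^esub> \<psi> f = f s \<odot>\<^bsub>A\<^esub> \<psi> (delta s)"
proof -
  interpret star_algebra A by fact
  note h = star_homD[OF \<psi>]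
  have closed: "\<psi> (delta s) \<in> carrier A" if "s \<in> I" for s
    using h(1) delta_closed[OF that] .
  have mult: "\<psi> (delta s) \<otimes>\<^bsub>A\<^esub> \<psi> f = f s \<odot>\<^bsub>A\<^esub> \<psi> (delta s)"
    if s: "s \<in> I" and f: "f \<in> carrier (fun_alg I)" for s f
  proof -
    have "delta s \<otimes>\<^bsub>fun_alg I\<^esub> f = f s \<odot>\<^bsub>fun_alg I\<^esub> delta s"
      by (auto simp: delta_def fun_eq_iff)
    then show ?thesis
      using h(2)[OF delta_closed[OF s] f] h(5)[OF delta_closed[OF s], of "f s"] by simp
  qed
  show "\<psi> (delta s) \<otimes>\<^bsub>A\<^esub> \<psi> f = f s \<odot>\<^bsub>A\<^esub> \<psi> (delta s)"
    if "s \<in> I" "f \<in> carrier (fun_alg I)"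
    using mult[OF that] .
  show "minimal_projections A {s\<in>I. \<psi> (delta s) \<noteq> \<zero>\<^bsub>A\<^esub>} (\<lambda>s. \<psi> (delta s))"
  proof
    show "finite {s\<in>I. \<psi> (delta s) \<noteq> \<zero>\<^bsub>A\<^esub>}"
      using I by simp
    fix s assume "s \<in> {s\<in>I. \<psi> (delta s) \<noteq> \<zero>\<^bsub>A\<^esub>}"
    then have s: "s \<in> I" "\<psi> (delta s) \<noteq> \<zero>\<^bsub>A\<^esub>"
      by auto
    show "\<psi> (delta s) \<in> carrier A" "\<psi> (delta s) \<noteq> \<zero>\<^bsub>A\<^esub>"
      using s closed by auto
    show "\<psi> (delta s) \<otimes>\<^bsub>A\<^esub> \<psi> (delta s) = \<psi> (delta s)"
      using mult[OF s(1) delta_closed[OF s(1)]] closed[OF s(1)] by (simp add: delta_def)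
    have "star (fun_alg I) (delta s) = delta s"
      by (auto simp: delta_def)
    then show "star A (\<psi> (delta s)) = \<psi> (delta s)"
      using h(6)[OF delta_closed[OF s(1)]] by simp
    show "\<psi> (delta s) \<otimes>\<^bsub>A\<^esub> \<psi> (delta t) = \<zero>\<^bsub>A\<^esub>"
      if "t \<in> {s\<in>I. \<psi> (delta s) \<noteq> \<zero>\<^bsub>A\<^esub>}" "s \<noteq> t" for t
      using that mult[OF s(1) delta_closed[of t]] closed[OF s(1)] by (simp add: delta_def)
    show "\<exists>c. \<psi> (delta s) \<otimes>\<^bsub>A\<^esub> x = c \<odot>\<^bsub>A\<^esub> \<psi> (delta s)" if "x \<in> carrier A" for x
      using that mult[OF s(1)] surj by (metis imageE)
  next
    fix x assume "x \<in> carrier A"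
      and zero: "\<And>k. k \<in> {s\<in>I. \<psi> (delta s) \<noteq> \<zero>\<^bsub>A\<^esub>} \<Longrightarrow> \<psi> (delta k) \<otimes>\<^bsub>A\<^esub> x = \<zero>\<^bsub>A\<^esub>"
    then obtain f where f: "f \<in> carrier (fun_alg I)" "x = \<psi> f"
      using surj by blast
    have term0: "f s \<odot>\<^bsub>A\<^esub> \<psi> (delta s) = \<zero>\<^bsub>A\<^esub>" if s: "s \<in> I" for s
      using zero[of s] s mult[OF s f(1)] f(2) by (cases "\<psi> (delta s) = \<zero>\<^bsub>A\<^esub>") auto
    have "x = \<psi> (\<Oplus>\<^bsub>fun_alg I\<^esub>s\<in>I. f s \<odot>\<^bsub>fun_alg I\<^esub> delta s)"
      using fun_alg_expansion[OF I f(1)] f(2) by simp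
    also have "\<dots> = (\<Oplus>\<^bsub>A\<^esub>s\<in>I. \<psi> (f s \<odot>\<^bsub>fun_alg I\<^esub> delta s))"
    proof (rule star_hom_finsum[OF \<psi> star_algebra_fun_alg star_algebra_axioms I])
      show "f s \<odot>\<^bsub>fun_alg I\<^esub> delta s \<in> carrier (fun_alg I)" if "s \<in> I" for s
        using delta_closed[OF that] by simp
    qed
    also have "\<dots> = (\<Oplus>\<^bsub>A\<^esub>s\<in>I. \<zero>\<^bsub>A\<^esub>)"
      using h(5)[OF delta_closed] term0 by (intro finsum_cong') (auto simp del: fun_alg_simps)
    finally show "x = \<zero>\<^bsub>A\<^esub>"
      by simp
  qed
qed

text \<open>The coordinate of \<open>\<Delta> (u i j)\<close> at \<open>(s, t)\<close> is 1 or 0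
  according to whether \<open>g s (g t j) = i\<close>. This is symmetric in \<open>s\<close> and
  \<open>t\<close> when \<open>G\<close> commutes, so the flip fixes the generators' images under
  \<open>\<Delta>\<close>.\<close>

lemma (in enumerated_permutation_group) cocommutative_image:
  assumes qpa: "quantum_permutation_algebra n A u"
    and \<psi>: "star_hom algebra_C A \<psi>" and surj: "\<psi> ` carrier algebra_C = carrier A"
    and \<psi>w: "\<And>i j. \<lbrakk>i \<in> {1..n}; j \<in> {1..n}\<rbrakk> \<Longrightarrow> \<psi> (magic_w i j) = u i j"
    and comm: "\<And>p q. \<lbrakk>p \<in> G; q \<in> G\<rbrakk> \<Longrightarrow> p \<circ> q = q \<circ> p"
  shows "cocommutative n A u"
proof -
  obtain T :: "universe cstar" and tens \<Delta> where comult: "comultiplication n A u T tens \<Delta>"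
    using qpa unfolding quantum_permutation_algebra_def by blast
  interpret A: cstar_algebra A
    using qpa unfolding quantum_permutation_algebra_def by blast
  define e where "e s = \<psi> (delta s)" for s
  define K where "K = {s\<in>{..<N}. e s \<noteq> \<zero>\<^bsub>A\<^esub>}"
  note image = minimal_projections_image[OF _ A.star_algebra_axioms \<psi> surj, folded e_def, folded K_def]
  interpret M: minimal_projections A K e
    by (rule image(1)) simp
  interpret tensor_square_minimal_projections A T tens K e
    using comult M.minimal_projections_axioms
    unfolding comultiplication_def tensor_square_minimal_projections_def by blast
  have \<Delta>: "star_hom A T \<Delta>"
    and \<Delta>u: "\<And>i j. \<lbrakk>i \<in> {1..n}; j \<in> {1..n}\<rbrakk> \<Longrightarrow> \<Delta> (u i j) = (\<Oplus>\<^bsub>T\<^esub>k\<in>{1..n}. tens (u i k) (u k j))"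
    using comult unfolding comultiplication_def by auto
  have u: "u i j \<in> carrier A" if "i \<in> {1..n}" "j \<in> {1..n}" for i j
    using qpa that unfolding quantum_permutation_algebra_def magic_unitary_def by blast
  have coord_u: "M.coord s (u i j) = of_bool (g s j = i)"
    if "s \<in> K" "i \<in> {1..n}" "j \<in> {1..n}" for s i j
  proof (rule M.coord_eqI[OF that(1) u[OF that(2,3)]])
    show "e s \<otimes>\<^bsub>A\<^esub> u i j = of_bool (g s j = i) \<odot>\<^bsub>A\<^esub> e s"
      using image(2)[OF _ _ magic_w_closed, of s i j] that \<psi>w[OF that(2,3)] by (simp add: K_def magic_w_def)
  qed
  have coord_\<Delta>u: "TT.coord (s, t) (\<Delta> (u i j)) = of_bool (g s (g t j) = i)"
    if st: "s \<in> K" "t \<in> K" and ij: "i \<in> {1..n}" "j \<in> {1..n}" for s t i j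
  proof -
    have "g t j \<in> {1..n}"
      using permutes_in_image[OF g_permutes] st ij by (simp add: K_def)
    then have "(\<Sum>k\<in>{1..n}. if g t j = k then of_bool (g s k = i) else 0) = (of_bool (g s (g t j) = i) :: complex)"
      by simp
    moreover have "TT.coord (s, t) (\<Delta> (u i j)) = (\<Sum>k\<in>{1..n}. TT.coord (s, t) (tens (u i k) (u k j)))"
      unfolding \<Delta>u[OF ij] using st ij u by (intro TT.coord_finsum) (auto simp: tens_closed)
    moreover have "\<dots> = (\<Sum>k\<in>{1..n}. if g t j = k then of_bool (g s k = i) else 0)"
      using st ij u by (intro sum.cong) (auto simp: coord_tens coord_u)
    ultimately show ?thesis
      by simp
  qed
  have flip_\<Delta>u: "flip (\<Delta> (u i j)) = \<Delta> (u i j)" if ij: "i \<in> {1..n}" "j \<in> {1..n}" for i j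
  proof (rule TT.eq_if_coord_eq)
    show "\<Delta> (u i j) \<in> carrier T"
      using star_homD(1)[OF \<Delta> u[OF ij]] .
    show "flip (\<Delta> (u i j)) \<in> carrier T"
      unfolding flip_def by (rule TT.of_coords_closed)
    fix q assume "q \<in> K \<times> K"
    then obtain s t where st: "q = (s, t)" "s \<in> K" "t \<in> K"
      by auto
    have "g s (g t j) = g t (g s j)"
      using fun_cong[OF comm[OF g_in g_in], of s t j] st by (simp add: K_def)
    then show "TT.coord q (flip (\<Delta> (u i j))) = TT.coord q (\<Delta> (u i j))"
      using st ij by (simp add: flip_def TT.coord_of_coords coord_\<Delta>u)
  qed
  have "flip (\<Delta> x) = \<Delta> x" if x: "x \<in> carrier A" for x
  proof -
    obtain f where f: "f \<in> carrier algebra_C" "x = \<psi> f"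
      using x surj by blast
    \<comment> \<open>The comparison is pulled back along \<open>\<psi>\<close> to
      \<open>algebra_C\<close>, every element of which is a star polynomial in the generators;
      agreement there is purely algebraic.\<close>
    have hom: "star_hom algebra_C T (\<lambda>f. \<Delta> (\<psi> f))"
      by (rule star_hom_comp[OF \<psi> \<Delta>])
    have "flip (\<Delta> (\<psi> f)) = \<Delta> (\<psi> f)"
    proof (rule star_hom_eq_on_star_gen[OF star_hom_comp[OF hom star_hom_flip] hom star_algebra_fun_alg])
      show "entries n magic_w \<subseteq> carrier algebra_C"
        unfolding entries_def using magic_w_closed by blast
      show "f \<in> star_gen algebra_C (entries n magic_w)"
        unfolding star_gen_w by (rule f(1))
      show "flip (\<Delta> (\<psi> y)) = \<Delta> (\<psi> y)" if "y \<in> entries n magic_w" for y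
        using that flip_\<Delta>u unfolding entries_def by (auto simp: \<psi>w)
    qed
    then show ?thesis
      using f(2) by simp
  qed
  then show ?thesis
    unfolding cocommutative_def using comult star_hom_flip flip_tens by blast
qed

section \<open>Hopf images of Latin squares\<close>

lemma op_algebra_simps:
  "carrier op_algebra = bounded_ops" "f \<otimes>\<^bsub>op_algebra\<^esub> g = f \<circ> g" "\<one>\<^bsub>op_algebra\<^esub> = id"
  "f \<oplus>\<^bsub>op_algebra\<^esub> g = (\<lambda>x. f x + g x)" "c \<odot>\<^bsub>op_algebra\<^esub> f = (\<lambda>x. c *\<^sub>C f x)"
  by (simp_all add: op_algebra_def)

text \<open>The operator attached to \<open>f\<close> is diagonal in the basis \<open>b\<close>,
  with entries \<open>f (r k)\<close>. All laws are read off from inner products with the basis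
  vectors, and the adjoint has the conjugate entries.\<close>

lemma star_hom_diagonal_operators:
  fixes b :: "nat \<Rightarrow> 'h::complex_inner"
  assumes basis: "orthogonal_basis n b" and r: "\<And>k. k \<in> {1..n} \<Longrightarrow> r k \<in> I"
  shows "star_hom (fun_alg I) op_algebra (\<lambda>f x. \<Sum>k\<in>{1..n}. f (r k) *\<^sub>C orth_proj (cvec.span {b k}) x)"
proof -
  let ?P = "\<lambda>k. orth_proj (cvec.span {b k})"
  define D where "D f x = (\<Sum>k\<in>{1..n}. f (r k) *\<^sub>C ?P k x)" for f x
  note nz = orthogonal_basis_nonzero[OF basis]
  have P: "?P k x = (cinner x (b k) / cinner (b k) (b k)) *\<^sub>C b k" if "k \<in> {1..n}" for k x
    using orth_proj_line nz[OF that] .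
  have bounded: "D f \<in> bounded_ops" for f
    unfolding D_def using nz
    by (intro bounded_ops_closed_sum bounded_ops_closed_scaleC orth_proj_line_bounded)
  have coeff: "cinner (D f x) (b k) = f (r k) * cinner x (b k)" if k: "k \<in> {1..n}" for f x k
  proof -
    have "cinner (D f x) (b k) = (\<Sum>l\<in>{1..n}. if k = l then f (r k) * cinner x (b k) else 0)"
      unfolding D_def cinner_sum_left cinner_scaleC_left using k nz orthogonal_basis_orthogonal[OF basis]
      by (intro sum.cong) (auto simp: P cinner_scaleC_left)
    then show ?thesis
      using k by simp
  qed
  have eqI: "x = y" if "\<And>k. k \<in> {1..n} \<Longrightarrow> cinner x (b k) = cinner y (b k)" for x y
    using orthogonal_basis_eq_0[OF basis, of "x - y"] that by (simp add: cinner_diff_left)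
  have one: "D (\<lambda>i. of_bool (i \<in> I)) = id"
    using r by (intro ext eqI) (simp add: coeff)
  have mult: "D (\<lambda>i. f i * g i) = D f \<circ> D g" for f g
    by (intro ext eqI) (simp add: coeff)
  have add: "D (\<lambda>i. f i + g i) = (\<lambda>x. D f x + D g x)" for f g
    by (intro ext eqI) (simp add: coeff cinner_add_left distrib_right)
  have smult: "D (\<lambda>i. c * f i) = (\<lambda>x. c *\<^sub>C D f x)" for c f
    by (intro ext eqI) (simp add: coeff cinner_scaleC_left)
  have adjoint: "cinner (D f x) y = cinner x (D (\<lambda>i. cnj (f i)) y)" for f x y
  proof -
    have "cinner (D f x) y = (\<Sum>k\<in>{1..n}. f (r k) * (cinner x (b k) / cinner (b k) (b k) * cinner (b k) y))"
      unfolding D_def cinner_sum_left cinner_scaleC_left by (intro sum.cong) (auto simp: P cinner_scaleC_left)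
    also have "\<dots> = cinner x (D (\<lambda>i. cnj (f i)) y)"
      unfolding D_def cinner_sum_right cinner_scaleC_right
      by (intro sum.cong) (auto simp: P cinner_scaleC_right cinner_commute[of y "b _"])
    finally show ?thesis .
  qed
  have star: "D (\<lambda>i. cnj (f i)) = star op_algebra (D f)" for f
    using star_op_algebra_eqI[OF bounded adjoint] by simp
  have "star_hom (fun_alg I) op_algebra D"
    unfolding star_hom_def ring_hom_def fun_alg_simps(2-) op_algebra_simps
    by (intro conjI CollectI funcsetI ballI allI impI) (rule bounded one mult add smult star)+
  then show ?thesis
    by (simp add: D_def[abs_def])
qed

text \<open>The diagonal representation is taken with row \<open>k\<close> of the conjugate as the
  point attached to \<open>b k\<close>. It turns the functions on \<open>G\<close> into a competitor
  in the definition of the Hopf image, and minimality then supplies \<open>\<psi>\<close>.\<close>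

lemma latin_square_hopf_image:
  fixes As :: "'s cstar" and \<pi> :: "'s \<Rightarrow> 'h::complex_inner \<Rightarrow> 'h"
  assumes univ: "universal_magic n As v"
    and hopf: "hopf_image n As v (op_algebra :: ('h \<Rightarrow> 'h) cstar) \<pi> A u"
    and latin: "latin_square n \<Sigma>" and comes: "comes_from n As v \<pi> \<Sigma>"
  shows "\<exists>N g \<psi>. enumerated_permutation_group n N (latin_group n \<Sigma>) g \<and>
    star_hom (fun_alg {..<N}) A \<psi> \<and> \<psi> ` carrier (fun_alg {..<N}) = carrier A \<and>
    (\<forall>i\<in>{1..n}. \<forall>j\<in>{1..n}. \<psi> (enumerated_permutation_group.magic_w N g i j) = u i j)"
proof -
  let ?G = "latin_group n \<Sigma>"
  let ?row = "row_perm n (latin_conjugate n \<Sigma>)"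
  have sub: "subgroup ?G (sym_group n)"
    by (rule latin_group_subgroup[OF latin])
  have "?G \<subseteq> {p. p permutes {1..n}}"
    using subgroup.subset[OF sub] by (auto simp: sym_group_carrier)
  then have "finite ?G"
    using finite_permutations[of "{1..n}"] finite_subset by blast
  then obtain g where "bij_betw g {0..<card ?G} ?G"
    using ex_bij_betw_nat_finite by blast
  then have G: "enumerated_permutation_group n (card ?G) ?G g"
    using sub by (intro enumerated_permutation_group.intro) (simp_all add: atLeast0LessThan)
  define N where "N = card ?G"
  interpret enumerated_permutation_group n N ?G g
    using G unfolding N_def .
  obtain b where basis: "orthogonal_basis n b" and rep: "associated_rep n As v (\<lambda>i j. b (\<Sigma> i j)) \<pi>"
    using comes unfolding comes_from_def by blast
  have \<pi>: "star_hom As op_algebra \<pi>"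
    and \<pi>v: "\<And>i j. \<lbrakk>i \<in> {1..n}; j \<in> {1..n}\<rbrakk> \<Longrightarrow> \<pi> (v i j) = orth_proj (cvec.span {b (\<Sigma> i j)})"
    using rep unfolding associated_rep_def by auto
  interpret As: cstar_algebra As
    using univ unfolding universal_magic_def by blast
  have v: "v i j \<in> carrier As" if "i \<in> {1..n}" "j \<in> {1..n}" for i j
    using univ that unfolding universal_magic_def magic_unitary_def by blast
  have row: "?row k \<in> ?G" if "k \<in> {1..n}" for k
    unfolding latin_group_def using that by (intro generate.incl) auto
  define \<rho> where "\<rho> f x = (\<Sum>k\<in>{1..n}. f (idx (?row k)) *\<^sub>C orth_proj (cvec.span {b k}) x)"
    for f :: "nat \<Rightarrow> complex" and x
  have \<rho>: "star_hom algebra_C op_algebra \<rho>"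
    unfolding \<rho>_def[abs_def] using idx_less[OF row] by (intro star_hom_diagonal_operators basis) auto
  have \<rho>w: "\<rho> (magic_w i j) = orth_proj (cvec.span {b (\<Sigma> i j)})" if ij: "i \<in> {1..n}" "j \<in> {1..n}" for i j
  proof
    fix x
    \<comment> \<open>Row \<open>k\<close> of the conjugate sends \<open>j\<close> to
      \<open>i\<close> exactly when \<open>\<Sigma> i j = k\<close>. So of all the projections only
      the one onto the line of \<open>b (\<Sigma> i j)\<close> survives in
      \<open>\<rho> (magic_w i j)\<close>.\<close>
    have "magic_w i j (idx (?row k)) = of_bool (\<Sigma> i j = k)" if k: "k \<in> {1..n}" for k
      using idx_less[OF row[OF k]] g_idx[OF row[OF k]] latin_conjugate_eq_iff(2)[OF latin k ij(2,1)] ij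
      by (simp add: magic_w_def row_perm_def)
    then have "\<rho> (magic_w i j) x
        = (\<Sum>k\<in>{1..n}. if \<Sigma> i j = k then orth_proj (cvec.span {b k}) x else 0)"
      unfolding \<rho>_def by (intro sum.cong) (auto simp: scaleC_one)
    then show "\<rho> (magic_w i j) x = orth_proj (cvec.span {b (\<Sigma> i j)}) x"
      using latin_square_closed[OF latin ij] by simp
  qed
  have "cstar_algebra algebra_C"
    by (rule cstar_algebra_fun_alg) simp
  then obtain \<phi> where \<phi>: "star_hom As algebra_C \<phi>"
    and \<phi>v: "\<And>i j. \<lbrakk>i \<in> {1..n}; j \<in> {1..n}\<rbrakk> \<Longrightarrow> \<phi> (v i j) = magic_w i j"
    using univ magic_unitary_w unfolding universal_magic_def by blast
  \<comment> \<open>\<open>\<phi>\<close> is known only on the generators of \<open>As\<close>;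
    contractivity carries the equation over to the closure.\<close>
  have "\<rho> (\<phi> x) = \<pi> x" if x: "x \<in> carrier As" for x
  proof (rule As.star_hom_op_algebra_eq_if_dense[OF _ star_hom_comp[OF \<phi> \<rho>] \<pi> _ _ _ x])
    show "has_adjoints TYPE('h)"
      by (rule has_adjoints_if_orthogonal_basis[OF basis])
    show "entries n v \<subseteq> carrier As"
      unfolding entries_def using v by blast
    show "dense_in As (star_gen As (entries n v))"
      using univ unfolding universal_magic_def by blast
    show "\<rho> (\<phi> y) = \<pi> y" if "y \<in> entries n v" for y
      using that unfolding entries_def by (auto simp: \<phi>v \<rho>w \<pi>v)
  qed
  then have "factorizes n As v op_algebra \<pi> algebra_C magic_w"
    unfolding factorizes_def using \<phi> \<rho> \<phi>v by blast
  then obtain \<psi> where "star_hom algebra_C A \<psi>"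
    "\<forall>i\<in>{1..n}. \<forall>j\<in>{1..n}. \<psi> (magic_w i j) = u i j" "\<psi> ` carrier algebra_C = carrier A"
    using hopf quantum_permutation_algebra_w unfolding hopf_image_def by blast
  then show ?thesis
    using enumerated_permutation_group_axioms by blast
qed

theorem theorem4p3:
  fixes n :: nat
    and \<xi> :: "nat \<Rightarrow> nat \<Rightarrow> 'h::complex_inner"
    and As :: "'s cstar" and v :: "nat \<Rightarrow> nat \<Rightarrow> 's"
    and \<pi> :: "'s \<Rightarrow> 'h \<Rightarrow> 'h"
    and A :: "'a cstar" and u :: "nat \<Rightarrow> nat \<Rightarrow> 'a"
  assumes "\<exists>B :: 'h set. finite B \<and> card B = n \<and> cvec.independent B \<and> cvec.span B = UNIV"
    and "magic_basis n \<xi>"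
    and "universal_magic n As v"
    and "associated_rep n As v \<xi> \<pi>"
    and "hopf_image n As v (op_algebra :: ('h \<Rightarrow> 'h) cstar) \<pi> A u"
  shows "(commutative A \<longleftrightarrow> (\<exists>\<Sigma>. latin_square n \<Sigma> \<and> comes_from n As v \<pi> \<Sigma>)) \<and>
    (cocommutative n A u \<longleftrightarrow> (\<exists>\<Sigma>. abelian_latin_square n \<Sigma> \<and> comes_from n As v \<pi> \<Sigma>))"
proof -
  have qpa: "quantum_permutation_algebra n A u" and fact: "factorizes n As v op_algebra \<pi> A u"
    using assms(5) unfolding hopf_image_def by auto
  have A: "cstar_algebra A" "magic_unitary n A u"
    using qpa unfolding quantum_permutation_algebra_def by auto
  obtain \<phi> \<rho> where \<rho>: "star_hom A op_algebra \<rho>"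
    and \<phi>v: "\<And>i j. \<lbrakk>i \<in> {1..n}; j \<in> {1..n}\<rbrakk> \<Longrightarrow> \<phi> (v i j) = u i j"
    and \<rho>\<phi>: "\<And>x. x \<in> carrier As \<Longrightarrow> \<rho> (\<phi> x) = \<pi> x"
    using fact unfolding factorizes_def by blast
  have \<rho>u: "\<rho> (u i j) = orth_proj (cvec.span {\<xi> i j})" if ij: "i \<in> {1..n}" "j \<in> {1..n}" for i j
  proof -
    have "v i j \<in> carrier As"
      using assms(3) ij unfolding universal_magic_def magic_unitary_def by blast
    then show ?thesis
      using \<rho>\<phi>[of "v i j"] \<phi>v[OF ij] assms(4) ij unfolding associated_rep_def by simp
  qed
  \<comment> \<open>The factorization through \<open>A\<close> supplies \<open>\<rho>\<close>, which
    sends \<open>u i j\<close> to the projections of the magic basis; these are the premises of both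
    forward directions.\<close>
  note ctx = assms(2) A \<rho> \<rho>u
  have "\<exists>\<Sigma>. latin_square n \<Sigma> \<and> comes_from n As v \<pi> \<Sigma>" if "commutative A"
    using latin_square_if_eigenvectors[OF ctx assms(1,4)] commutative_eigenvectors[OF ctx that] by blast
  moreover have "\<exists>\<Sigma>. abelian_latin_square n \<Sigma> \<and> comes_from n As v \<pi> \<Sigma>" if "cocommutative n A u"
    using latin_square_if_eigenvectors[OF ctx assms(1,4)] cocommutative_eigenvectors[OF ctx that] that
    by blast
  moreover have "commutative A" if latin: "latin_square n \<Sigma>" and comes: "comes_from n As v \<pi> \<Sigma>" for \<Sigma>
  proof -
    obtain N \<psi> where \<psi>: "star_hom (fun_alg {..<N :: nat}) A \<psi>"
      "\<psi> ` carrier (fun_alg {..<N}) = carrier A"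
      using latin_square_hopf_image[OF assms(3,5) latin comes] by blast
    show ?thesis
      unfolding commutative_def
    proof (intro ballI)
      fix x y assume "x \<in> carrier A" "y \<in> carrier A"
      then obtain f h where f: "f \<in> carrier (fun_alg {..<N})" "h \<in> carrier (fun_alg {..<N})"
        "x = \<psi> f" "y = \<psi> h"
        using \<psi>(2) by blast
      have "f \<otimes>\<^bsub>fun_alg {..<N}\<^esub> h = h \<otimes>\<^bsub>fun_alg {..<N}\<^esub> f"
        using commutative_fun_alg f(1,2) unfolding commutative_def by blast
      then show "x \<otimes>\<^bsub>A\<^esub> y = y \<otimes>\<^bsub>A\<^esub> x"
        unfolding f(3,4) star_homD(2)[OF \<psi>(1) f(1,2), symmetric]
          star_homD(2)[OF \<psi>(1) f(2,1), symmetric] by (rule arg_cong)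
    qed
  qed
  moreover have "cocommutative n A u"
    if abelian: "abelian_latin_square n \<Sigma>" and comes: "comes_from n As v \<pi> \<Sigma>" for \<Sigma>
  proof -
    have latin: "latin_square n \<Sigma>"
      and comm: "comm_group (sym_group n\<lparr>carrier := latin_group n \<Sigma>\<rparr>)"
      using abelian unfolding abelian_latin_square_def by auto
    obtain N g \<psi> where G: "enumerated_permutation_group n N (latin_group n \<Sigma>) g"
      and \<psi>: "star_hom (fun_alg {..<N}) A \<psi>" "\<psi> ` carrier (fun_alg {..<N}) = carrier A"
        "\<forall>i\<in>{1..n}. \<forall>j\<in>{1..n}. \<psi> (enumerated_permutation_group.magic_w N g i j) = u i j"
      using latin_square_hopf_image[OF assms(3,5) latin comes] by (elim exE conjE) rule
    show ?thesis
    proof (rule enumerated_permutation_group.cocommutative_image[OF G qpa \<psi>(1,2)])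
      show "\<psi> (enumerated_permutation_group.magic_w N g i j) = u i j"
        if "i \<in> {1..n}" "j \<in> {1..n}" for i j
        using \<psi>(3) that by blast
      fix p q assume "p \<in> latin_group n \<Sigma>" "q \<in> latin_group n \<Sigma>"
      then show "p \<circ> q = q \<circ> p"
        using comm_groupE(4)[OF comm, of p q] by (simp add: sym_group_mult)
    qed
  qed
  ultimately show ?thesis
    by blast
qed

end
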